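(* Let $P$ be a locally finite poset that is graded with a corank function and let $F$ be a presheaf on $P$. Then there are isomorphisms $$C^n(P;F)\cong\prod_{|x|=n}A_x\otimes F(x),$$ where $A_x$ is the abelian group having presentation with generators the non-degenerate simplices $\sigma\in N^n_\circ P_{\ge x}$ and relations $\sum_{\sigma\in B_\tau}\sigma=0$, one for each compatible family $B_\tau$ in $N^n_\circ P_{\ge x}$. With respect to these isomorphisms, if $|x|=n$, $|y|=n-1$ and $x\prec y$, then the matrix element $\delta^y_x:A_y\otimes F(y)\to A_x\otimes F(x)$ of the differential $\delta:C^{n-1}(P;F)\to C^n(P;F)$ is given by $$\delta^y_x:\sigma\otimes a\mapsto x\sigma\otimes(-1)^nF^y_x(a),$$ where $\sigma\in N^{n-1}_\circ P_{\ge y}$ is a generator of $A_y$, $a\in F(y)$, and $x\sigma$ is the result of pre-appending $x$ to $\sigma$.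
   Context: Posets and presheaves. A poset $P$ is viewed as a category with a unique morphism $x\to y$ iff $x\le y$. A presheaf on $P$ is a functor $F:P^{\mathrm{op}}\to\mathbf{Ab}$; write $F^y_x:F(y)\to F(x)$ for the map induced by $x\le y$. A presheaf on $P$ restricts to a presheaf, also written $F$, on any subposet. $P_{\ge x}=\{y\in P:y\ge x\}$ and $P_{>x}=\{y\in P:y>x\}$. Nerve and cochains. $N^nP$ is the set of $n$-simplices $\sigma=(\sigma_n\le\cdots\le\sigma_0)$ in $P$, and $N^n_\circ P$ is the subset of non-degenerate ones $\sigma_n<\cdots<\sigma_0$; the face map $d_i$ deletes $\sigma_i$. Let $S^n(P;F)=\prod_{\sigma\in N^nP}F(\sigma_n)$ and write $s\cdot\sigma$ for the $\sigma$-component of $s$. The differential $d:S^{n-1}(P;F)\to S^n(P;F)$ is $$ds\cdot\sigma=\sum_{i=0}^{n-1}(-1)^i s\cdot d_i\sigma+(-1)^nF^{\sigma_{n-1}}_{\sigma_n}(s\cdot d_n\sigma).$$ By convention $S^*(\varnothing;F)=0$. For a subposet $Q\subseteq P$, $S^*(P,Q;F)$ is the kernel of the restriction map $S^*(P;F)\to S^*(Q;F)$; $HS^*(P,Q;F)$ is its cohomology, and $S^*(P,\varnothing;F)=S^*(P;F)$. Graded posets. $x\prec y$ ($y$ covers $x$) means $x<y$ and there is no $z$ with $x<z<y$. $P$ is graded if there is a rank function $\mathrm{rk}:P\to\mathbb Z$ such that $x<y$ implies $\mathrm{rk}(x)<\mathrm{rk}(y)$, and $x\prec y$ implies $\mathrm{rk}(y)=\mathrm{rk}(x)+1$.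 "Graded with a corank function" means: a rank function is fixed which is bounded above, with maximum $r$, and the corank is $|x|=r-\mathrm{rk}(x)\ge 0$. Let $P^k=\{x\in P:|x|\le k\}$ (so $P^k=\varnothing$ for $k<0$). $P$ is locally finite if for every $x\in P$ there are only finitely many $y$ with $x\prec y$. Cellular cochain complex. $C^n(P;F)=HS^n(P^n,P^{n-1};F)$, with differential $\delta:C^{n-1}(P;F)\to C^n(P;F)$ the connecting homomorphism of the long exact sequence arising from $$0\to S^*(P^n,P^{n-1};F)\to S^*(P^n,P^{n-2};F)\to S^*(P^{n-1},P^{n-2};F)\to0.$$ Matrix elements. When $C^{n-1}$ and $C^n$ are identified with products indexed by the elements of corank $n-1$ and $n$ respectively, the matrix element $\delta^y_x$ is the composite of the inclusion of the $y$-factor of $C^{n-1}$, the map $\delta$, and the projection to the $x$-factor of $C^n$. Compatible families. Fix $x$ with $|x|=n$. The elements of $N^n_\circ P_{\ge x}$ have the form $\sigma=x\sigma_{n-1}\cdots\sigma_0$ (meaning $x<\sigma_{n-1}<\cdots<\sigma_0$) with $|\sigma_i|=i$. For a simplex $\tau=x\tau_{n-1}\cdots\tau_{j+1}\tau_{j-1}\cdots\tau_0\in N^{n-1}_\circ P_{\ge x}$ with $0\le j<n$ and $|\tau_i|=i$, the compatible family $B_\tau$ given by $\tau$ is the set of all $n$-simplices in $N^n_\circ P_{\ge x}$ of the form $x\tau_{n-1}\cdots\tau_{j+1}\,y\,\tau_{j-1}\cdots\tau_0$ (necessarily $|y|=j$). *)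

theory Defs
  imports "HOL-Algebra.Free_Abelian_Groups"
begin

text \<open>
  A poset is a subset \<open>P\<close> of an ordered type with the induced order.  Abelian groups are
  commutative groups in the sense of HOL-Algebra, hence written multiplicatively: \<open>\<otimes>\<close>, \<open>\<one>\<close> and
  \<open>[^]\<close> stand for addition, zero and multiplication by integers.
\<close>

definition covers :: "'a::order set \<Rightarrow> 'a \<Rightarrow> 'a \<Rightarrow> bool" where
  "covers P x y \<longleftrightarrow> x \<in> P \<and> y \<in> P \<and> x < y \<and> \<not> (\<exists>z\<in>P. x < z \<and> z < y)"

definition locally_finite_poset :: "'a::order set \<Rightarrow> bool" where
  "locally_finite_poset P \<longleftrightarrow> (\<forall>x\<in>P. finite {y. covers P x y})"

definition rank_function :: "'a::order set \<Rightarrow> ('a \<Rightarrow> int) \<Rightarrow> bool" where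
  "rank_function P rk \<longleftrightarrow>
     (\<forall>x\<in>P. \<forall>y\<in>P. x < y \<longrightarrow> rk x < rk y) \<and>
     (\<forall>x y. covers P x y \<longrightarrow> rk y = rk x + 1)"

text \<open>Here \<open>r\<close> is the maximum of the rank function on \<open>P\<close>.\<close>

definition graded_with_corank :: "'a::order set \<Rightarrow> ('a \<Rightarrow> int) \<Rightarrow> int \<Rightarrow> bool" where
  "graded_with_corank P rk r \<longleftrightarrow>
     rank_function P rk \<and> r \<in> rk ` P \<and> (\<forall>x\<in>P. rk x \<le> r)"

definition corank :: "('a \<Rightarrow> int) \<Rightarrow> int \<Rightarrow> 'a \<Rightarrow> int" where
  "corank rk r x = r - rk x"

definition skel :: "'a set \<Rightarrow> ('a \<Rightarrow> int) \<Rightarrow> int \<Rightarrow> int \<Rightarrow> 'a set" where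
  "skel P rk r k = {x \<in> P. corank rk r x \<le> k}"

definition up_set :: "'a::order set \<Rightarrow> 'a \<Rightarrow> 'a set" where
  "up_set P x = {y \<in> P. x \<le> y}"

definition corank_set :: "'a set \<Rightarrow> ('a \<Rightarrow> int) \<Rightarrow> int \<Rightarrow> nat \<Rightarrow> 'a set" where
  "corank_set P rk r n = {x \<in> P. corank rk r x = int n}"


text \<open>
  A presheaf has groups \<open>F x\<close> and maps \<open>\<rho> y x : F y \<rightarrow> F x\<close> for \<open>x \<le> y\<close>.
\<close>

locale presheaf =
  fixes P :: "'a::order set"
    and F :: "'a \<Rightarrow> 'b monoid"
    and \<rho> :: "'a \<Rightarrow> 'a \<Rightarrow> 'b \<Rightarrow> 'b"
  assumes comm_group_at: "x \<in> P \<Longrightarrow> comm_group (F x)"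
    and map_hom: "\<lbrakk>x \<in> P; y \<in> P; x \<le> y\<rbrakk> \<Longrightarrow> \<rho> y x \<in> hom (F y) (F x)"
    and map_id: "\<lbrakk>x \<in> P; a \<in> carrier (F x)\<rbrakk> \<Longrightarrow> \<rho> x x a = a"
    and map_comp: "\<lbrakk>x \<in> P; y \<in> P; z \<in> P; x \<le> y; y \<le> z; a \<in> carrier (F z)\<rbrakk>
      \<Longrightarrow> \<rho> y x (\<rho> z y a) = \<rho> z x a"


text \<open>
  An \<open>n\<close>-simplex \<open>\<sigma>\<^sub>n \<le> \<dots> \<le> \<sigma>\<^sub>0\<close> is the list \<open>[\<sigma>\<^sub>n, \<dots>, \<sigma>\<^sub>0]\<close>: the vertex \<open>\<sigma>\<^sub>i\<close> is at
  position \<open>n - i\<close>, the smallest vertex \<open>\<sigma>\<^sub>n\<close> is the head, and \<open>x\<sigma>\<close> is \<open>x # \<sigma>\<close>.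
\<close>

definition simplices :: "nat \<Rightarrow> 'a::order set \<Rightarrow> 'a list set" where
  "simplices n Q = {\<sigma>. length \<sigma> = Suc n \<and> set \<sigma> \<subseteq> Q \<and> sorted_wrt (\<le>) \<sigma>}"

definition nd_simplices :: "nat \<Rightarrow> 'a::order set \<Rightarrow> 'a list set" where
  "nd_simplices n Q = {\<sigma>. length \<sigma> = Suc n \<and> set \<sigma> \<subseteq> Q \<and> sorted_wrt (<) \<sigma>}"

definition face :: "nat \<Rightarrow> 'a list \<Rightarrow> 'a list" where
  "face i \<sigma> = take (length \<sigma> - Suc i) \<sigma> @ drop (length \<sigma> - i) \<sigma>"

definition cochains :: "('a::order \<Rightarrow> 'b monoid) \<Rightarrow> 'a set \<Rightarrow> nat \<Rightarrow> ('a list \<Rightarrow> 'b) monoid" where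
  "cochains F Q n = product_group (simplices n Q) (\<lambda>\<sigma>. F (hd \<sigma>))"

definition codiff :: "('a::order \<Rightarrow> 'b monoid) \<Rightarrow> ('a \<Rightarrow> 'a \<Rightarrow> 'b \<Rightarrow> 'b) \<Rightarrow> 'a set \<Rightarrow> nat
    \<Rightarrow> ('a list \<Rightarrow> 'b) \<Rightarrow> 'a list \<Rightarrow> 'b" where
  "codiff F \<rho> Q n s = (\<lambda>\<sigma>\<in>simplices (Suc n) Q.
     (\<Otimes>\<^bsub>F (hd \<sigma>)\<^esub>i\<in>{0..n}. s (face i \<sigma>) [^]\<^bsub>F (hd \<sigma>)\<^esub> ((-1) ^ i :: int))
     \<otimes>\<^bsub>F (hd \<sigma>)\<^esub>
     \<rho> (hd (face (Suc n) \<sigma>)) (hd \<sigma>) (s (face (Suc n) \<sigma>)) [^]\<^bsub>F (hd \<sigma>)\<^esub> ((-1) ^ Suc n :: int))"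

definition cochain_restrict :: "'a::order set \<Rightarrow> nat \<Rightarrow> ('a list \<Rightarrow> 'b) \<Rightarrow> 'a list \<Rightarrow> 'b" where
  "cochain_restrict Q n s = restrict s (simplices n Q)"

definition rel_cochains :: "('a::order \<Rightarrow> 'b monoid) \<Rightarrow> 'a set \<Rightarrow> 'a set \<Rightarrow> nat
    \<Rightarrow> ('a list \<Rightarrow> 'b) monoid" where
  "rel_cochains F X Y n =
     (cochains F X n)\<lparr>carrier := kernel (cochains F X n) (cochains F Y n) (cochain_restrict Y n)\<rparr>"

definition rel_cocycles :: "('a::order \<Rightarrow> 'b monoid) \<Rightarrow> ('a \<Rightarrow> 'a \<Rightarrow> 'b \<Rightarrow> 'b) \<Rightarrow> 'a set \<Rightarrow> 'a set
    \<Rightarrow> nat \<Rightarrow> ('a list \<Rightarrow> 'b) monoid" where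
  "rel_cocycles F \<rho> X Y n = (rel_cochains F X Y n)
     \<lparr>carrier := kernel (rel_cochains F X Y n) (rel_cochains F X Y (Suc n)) (codiff F \<rho> X n)\<rparr>"

definition rel_coboundaries :: "('a::order \<Rightarrow> 'b monoid) \<Rightarrow> ('a \<Rightarrow> 'a \<Rightarrow> 'b \<Rightarrow> 'b) \<Rightarrow> 'a set \<Rightarrow> 'a set
    \<Rightarrow> nat \<Rightarrow> ('a list \<Rightarrow> 'b) set" where
  "rel_coboundaries F \<rho> X Y n = (case n of
       0 \<Rightarrow> {\<one>\<^bsub>rel_cochains F X Y 0\<^esub>}
     | Suc m \<Rightarrow> codiff F \<rho> X m ` carrier (rel_cochains F X Y m))"

definition rel_cohomology :: "('a::order \<Rightarrow> 'b monoid) \<Rightarrow> ('a \<Rightarrow> 'a \<Rightarrow> 'b \<Rightarrow> 'b) \<Rightarrow> 'a set \<Rightarrow> 'a set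
    \<Rightarrow> nat \<Rightarrow> ('a list \<Rightarrow> 'b) set monoid" where
  "rel_cohomology F \<rho> X Y n = rel_cocycles F \<rho> X Y n Mod rel_coboundaries F \<rho> X Y n"

definition rel_class :: "('a::order \<Rightarrow> 'b monoid) \<Rightarrow> ('a \<Rightarrow> 'a \<Rightarrow> 'b \<Rightarrow> 'b) \<Rightarrow> 'a set \<Rightarrow> 'a set
    \<Rightarrow> nat \<Rightarrow> ('a list \<Rightarrow> 'b) \<Rightarrow> ('a list \<Rightarrow> 'b) set" where
  "rel_class F \<rho> X Y n s = rel_coboundaries F \<rho> X Y n #>\<^bsub>rel_cocycles F \<rho> X Y n\<^esub> s"

text \<open>
  The connecting homomorphism \<open>HS\<^sup>n(Y,Z;F) \<rightarrow> HS\<^sup>n\<^sup>+\<^sup>1(X,Y;F)\<close> of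
  \<open>0 \<rightarrow> S\<^sup>*(X,Y;F) \<rightarrow> S\<^sup>*(X,Z;F) \<rightarrow> S\<^sup>*(Y,Z;F) \<rightarrow> 0\<close> for \<open>Z \<subseteq> Y \<subseteq> X\<close>: lift a cocycle
  representing \<open>c\<close> to a cochain \<open>t\<close> in \<open>S\<^sup>n(X,Z;F)\<close> and take the class of \<open>dt\<close>.
\<close>

definition connecting_hom :: "('a::order \<Rightarrow> 'b monoid) \<Rightarrow> ('a \<Rightarrow> 'a \<Rightarrow> 'b \<Rightarrow> 'b)
    \<Rightarrow> 'a set \<Rightarrow> 'a set \<Rightarrow> 'a set \<Rightarrow> nat \<Rightarrow> ('a list \<Rightarrow> 'b) set \<Rightarrow> ('a list \<Rightarrow> 'b) set" where
  "connecting_hom F \<rho> X Y Z n c =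
     (THE c'. \<exists>t \<in> carrier (rel_cochains F X Z n).
        cochain_restrict Y n t \<in> c \<and> c' = rel_class F \<rho> X Y (Suc n) (codiff F \<rho> X n t))"

definition cellular_cochains :: "'a::order set \<Rightarrow> ('a \<Rightarrow> int) \<Rightarrow> int \<Rightarrow> ('a \<Rightarrow> 'b monoid)
    \<Rightarrow> ('a \<Rightarrow> 'a \<Rightarrow> 'b \<Rightarrow> 'b) \<Rightarrow> nat \<Rightarrow> ('a list \<Rightarrow> 'b) set monoid" where
  "cellular_cochains P rk r F \<rho> n =
     rel_cohomology F \<rho> (skel P rk r (int n)) (skel P rk r (int n - 1)) n"

text \<open>The differential from degree \<open>n\<close> to degree \<open>n + 1\<close>.\<close>

definition cellular_diff :: "'a::order set \<Rightarrow> ('a \<Rightarrow> int) \<Rightarrow> int \<Rightarrow> ('a \<Rightarrow> 'b monoid)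
    \<Rightarrow> ('a \<Rightarrow> 'a \<Rightarrow> 'b \<Rightarrow> 'b) \<Rightarrow> nat \<Rightarrow> ('a list \<Rightarrow> 'b) set \<Rightarrow> ('a list \<Rightarrow> 'b) set" where
  "cellular_diff P rk r F \<rho> n =
     connecting_hom F \<rho> (skel P rk r (int n + 1)) (skel P rk r (int n)) (skel P rk r (int n - 1)) n"


definition presented_group :: "'g set \<Rightarrow> ('g \<Rightarrow>\<^sub>0 int) set \<Rightarrow> ('g \<Rightarrow>\<^sub>0 int) set monoid" where
  "presented_group S R = free_Abelian_group S Mod generate (free_Abelian_group S) R"

definition presented_gen :: "'g set \<Rightarrow> ('g \<Rightarrow>\<^sub>0 int) set \<Rightarrow> 'g \<Rightarrow> ('g \<Rightarrow>\<^sub>0 int) set" where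
  "presented_gen S R g = generate (free_Abelian_group S) R #>\<^bsub>free_Abelian_group S\<^esub> frag_of g"

text \<open>
  The tensor product over the integers, as generators \<open>(a, b)\<close> modulo biadditivity; compatibility
  with multiplication by integers follows.
\<close>

definition tensor_rels :: "'c monoid \<Rightarrow> 'd monoid \<Rightarrow> ('c \<times> 'd \<Rightarrow>\<^sub>0 int) set" where
  "tensor_rels A B =
     {frag_of (a \<otimes>\<^bsub>A\<^esub> a', b) - frag_of (a, b) - frag_of (a', b) | a a' b.
        a \<in> carrier A \<and> a' \<in> carrier A \<and> b \<in> carrier B} \<union>
     {frag_of (a, b \<otimes>\<^bsub>B\<^esub> b') - frag_of (a, b) - frag_of (a, b') | a b b'.
        a \<in> carrier A \<and> b \<in> carrier B \<and> b' \<in> carrier B}"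

definition tensor_group :: "'c monoid \<Rightarrow> 'd monoid \<Rightarrow> ('c \<times> 'd \<Rightarrow>\<^sub>0 int) set monoid" where
  "tensor_group A B = presented_group (carrier A \<times> carrier B) (tensor_rels A B)"

definition pure_tensor :: "'c monoid \<Rightarrow> 'd monoid \<Rightarrow> 'c \<Rightarrow> 'd \<Rightarrow> ('c \<times> 'd \<Rightarrow>\<^sub>0 int) set" where
  "pure_tensor A B a b = presented_gen (carrier A \<times> carrier B) (tensor_rels A B) (a, b)"


text \<open>
  For \<open>x\<close> of corank \<open>n\<close>, a simplex \<open>\<tau>\<close> giving a compatible family is written \<open>x # us @ vs\<close>, where
  \<open>us = [\<tau>\<^sub>n\<^sub>-\<^sub>1, \<dots>, \<tau>\<^sub>j\<^sub>+\<^sub>1]\<close> and \<open>vs = [\<tau>\<^sub>j\<^sub>-\<^sub>1, \<dots>, \<tau>\<^sub>0]\<close>.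
\<close>

definition compatible_families :: "'a::order set \<Rightarrow> ('a \<Rightarrow> int) \<Rightarrow> int \<Rightarrow> 'a \<Rightarrow> nat \<Rightarrow> 'a list set set" where
  "compatible_families P rk r x n =
     {{x # us @ y # vs | y. x # us @ y # vs \<in> nd_simplices n (up_set P x)} | us vs j.
        j < n \<and> x # us @ vs \<in> nd_simplices (n - 1) (up_set P x) \<and>
        map (corank rk r) us = map int (rev [Suc j..<n]) \<and>
        map (corank rk r) vs = map int (rev [0..<j])}"

definition A_rels :: "'a::order set \<Rightarrow> ('a \<Rightarrow> int) \<Rightarrow> int \<Rightarrow> 'a \<Rightarrow> nat \<Rightarrow> ('a list \<Rightarrow>\<^sub>0 int) set" where
  "A_rels P rk r x n = {(\<Sum>\<sigma>\<in>B. frag_of \<sigma>) | B. B \<in> compatible_families P rk r x n}"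

definition A_group :: "'a::order set \<Rightarrow> ('a \<Rightarrow> int) \<Rightarrow> int \<Rightarrow> 'a \<Rightarrow> nat \<Rightarrow> ('a list \<Rightarrow>\<^sub>0 int) set monoid" where
  "A_group P rk r x n = presented_group (nd_simplices n (up_set P x)) (A_rels P rk r x n)"

definition A_gen :: "'a::order set \<Rightarrow> ('a \<Rightarrow> int) \<Rightarrow> int \<Rightarrow> 'a \<Rightarrow> nat \<Rightarrow> 'a list \<Rightarrow> ('a list \<Rightarrow>\<^sub>0 int) set" where
  "A_gen P rk r x n \<sigma> = presented_gen (nd_simplices n (up_set P x)) (A_rels P rk r x n) \<sigma>"


definition factor_incl :: "'i set \<Rightarrow> ('i \<Rightarrow> 'c monoid) \<Rightarrow> 'i \<Rightarrow> 'c \<Rightarrow> 'i \<Rightarrow> 'c" where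
  "factor_incl I G i t = (\<lambda>k\<in>I. if k = i then t else \<one>\<^bsub>G k\<^esub>)"

text \<open>
  The matrix element from the factor \<open>y\<close> to the factor \<open>x\<close> of a map \<open>\<delta> : C \<rightarrow> D\<close>, where
  \<open>\<phi> : C \<rightarrow> (\<Prod>i\<in>I. G i)\<close> and \<open>\<psi>\<close>, from \<open>D\<close> to another product, are the identifications.
\<close>

definition matrix_element :: "'i set \<Rightarrow> ('i \<Rightarrow> 'c monoid) \<Rightarrow> 'p monoid \<Rightarrow> ('p \<Rightarrow> 'i \<Rightarrow> 'c)
    \<Rightarrow> ('q \<Rightarrow> 'j \<Rightarrow> 'd) \<Rightarrow> ('p \<Rightarrow> 'q) \<Rightarrow> 'i \<Rightarrow> 'j \<Rightarrow> 'c \<Rightarrow> 'd" where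
  "matrix_element I G C \<phi> \<psi> \<delta> y x t = \<psi> (\<delta> (inv_into (carrier C) \<phi> (factor_incl I G y t))) x"

end

theory Submission
  imports Defs
begin

text \<open>
  Coranks strictly decrease along a non-degenerate simplex, so the non-degenerate simplices of the
  \<open>n\<close>-skeleton have dimension at most \<open>n\<close>, and those of dimension \<open>n\<close> start at a vertex of
  corank \<open>n\<close> and use every corank once.  Hence relative cohomology in degree \<open>n\<close> is a top cohomology
  group: modulo degenerate simplices every cochain is a cocycle, and the group is the cokernel of
  one coboundary map.  A relative cochain vanishes on simplices that start in the
  \<open>(n-1)\<close>-skeleton, so everything splits as a product over the vertices \<open>x\<close> of corank \<open>n\<close>.

  At such an \<open>x\<close> the cochains are the functions from the finite set of these simplices starting at
  \<open>x\<close> to the group \<open>F x\<close>.  A non-degenerate \<open>(n-1)\<close>-simplex starting at \<open>x\<close> misses exactly one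
  corank \<open>j < n\<close> (\<open>gap_chain\<close>), and the coboundary of a cochain supported on it is, up to sign, constant
  on the corresponding compatible family and trivial elsewhere (\<open>lookup_signed_boundary_gapped\<close>).
  The cokernel is therefore \<open>F x\<close>-valued functions on the generators modulo the relators of
  \<open>A_x\<close>.  Right exactness of the tensor product, with finiteness of the generating set,
  identifies this cokernel with \<open>A_x \<otimes> F x\<close> through \<open>s \<mapsto> \<Sum>\<sigma>. \<sigma> \<otimes> s \<sigma>\<close>
  (\<open>Phi_surj\<close> and \<open>kernel_Phi\<close>).

  Two points need work.  Degenerate simplices are removed by the classical normalisation argument
  (\<open>normalise\<close>): a relative cocycle can be corrected by coboundaries, one degeneracy position at a
  time, until it vanishes on all degenerate simplices.  The computations behind it, and the
  identity \<open>d d = 0\<close>, take place in the free abelian group on lists, where they are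
  identities between formal chains; a cochain \<open>s\<close> turns them into identities in \<open>F x\<close> by
  linear extension of \<open>\<tau> \<mapsto> F(x \<le> \<tau>) (s \<tau>)\<close>, because the codifferential evaluates \<open>s\<close> on
  the formal boundary (\<open>codiff_eq\<close>).

  For the differential, extend a cocycle by zero and apply \<open>d\<close>.  On a chain \<open>x\<sigma>\<close> with
  \<open>x\<close> of corank \<open>n + 1\<close> every face that keeps \<open>x\<close> lies outside the \<open>n\<close>-skeleton, where the
  extension vanishes, so only the face \<open>\<sigma>\<close> survives, with sign \<open>(-1)^(n+1)\<close> and the restriction map
  to \<open>F x\<close> (\<open>lift_codiff_apply\<close>).
\<close>

abbreviation keys :: "('c \<Rightarrow>\<^sub>0 int) \<Rightarrow> 'c set" where
  "keys \<equiv> Poly_Mapping.keys"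

abbreviation lookup :: "('c \<Rightarrow>\<^sub>0 int) \<Rightarrow> 'c \<Rightarrow> int" where
  "lookup \<equiv> Poly_Mapping.lookup"

section \<open>Integer combinations in an abelian group\<close>

lemma hom_finprod:
  assumes "comm_group G" "comm_group H" "h \<in> hom G H" "f \<in> A \<rightarrow> carrier G"
  shows "h (finprod G f A) = finprod H (\<lambda>a. h (f a)) A"
proof -
  interpret G: comm_group G by fact
  interpret H: comm_group H by fact
  interpret group_hom G H h
    using assms(3) by unfold_locales
  show ?thesis
    using assms(4)
  proof (induction A rule: infinite_finite_induct)
    case (insert a A)
    then show ?case
      by (simp add: Pi_iff)
  qed auto
qed

text \<open>
  The uniqueness half of the universal property.  It reduces identities between expressions that are
  additive in a formal combination to the case of a single generator.
\<close>

lemma free_hom_eq: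
  assumes "g \<in> hom (free_Abelian_group S) H" "h \<in> hom (free_Abelian_group S) H" "group H"
    and "\<And>s. s \<in> S \<Longrightarrow> g (frag_of s) = h (frag_of s)"
    and "keys c \<subseteq> S"
  shows "g c = h c"
proof -
  interpret g: group_hom "free_Abelian_group S" H g
    using assms by (simp add: group_hom_def group_hom_axioms_def)
  interpret h: group_hom "free_Abelian_group S" H h
    using assms by (simp add: group_hom_def group_hom_axioms_def)
  show ?thesis
  proof (rule free_Abelian_group_induct[OF assms(5)])
    show "g 0 = h 0" using g.hom_one h.hom_one by simp
  next
    fix x y assume 2: "keys x \<subseteq> S" "keys y \<subseteq> S" "g x = h x" "g y = h y"
    have "g (x \<otimes>\<^bsub>free_Abelian_group S\<^esub> inv\<^bsub>free_Abelian_group S\<^esub> y)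
        = h (x \<otimes>\<^bsub>free_Abelian_group S\<^esub> inv\<^bsub>free_Abelian_group S\<^esub> y)"
      using 2 g.hom_mult h.hom_mult g.hom_inv h.hom_inv
      by (metis carrier_free_Abelian_group_iff g.G.inv_closed)
    then show "g (x - y) = h (x - y)" using 2 by simp
  qed (use assms in auto)
qed

text \<open>
  The linear extension of \<open>f\<close> to formal combinations.  It is a total function, and it is a
  homomorphism on the combinations whose keys \<open>f\<close> sends into the group; keeping the domain implicit
  allows one \<open>f\<close> to be used on several sets of simplices.
\<close>

definition lin :: "('g, 'm) monoid_scheme \<Rightarrow> ('c \<Rightarrow> 'g) \<Rightarrow> ('c \<Rightarrow>\<^sub>0 int) \<Rightarrow> 'g" where
  "lin G f c = finprod G (\<lambda>k. f k [^]\<^bsub>G\<^esub> lookup c k) (keys c)"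

context comm_group
begin

lemma lin_cong:
  assumes "\<And>k. k \<in> keys c \<Longrightarrow> f k = g k" "g \<in> keys c \<rightarrow> carrier G"
  shows "lin G f c = lin G g c"
  unfolding lin_def using assms by (intro finprod_cong') (auto simp: Pi_iff)

lemma lin_superset:
  assumes "finite T" "keys c \<subseteq> T" "f \<in> T \<rightarrow> carrier G"
  shows "lin G f c = finprod G (\<lambda>k. f k [^] lookup c k) T"
  unfolding lin_def
  using assms by (intro finprod_mono_neutral_cong_left) (auto simp: in_keys_iff)

lemma lin_closed [intro]: "f \<in> keys c \<rightarrow> carrier G \<Longrightarrow> lin G f c \<in> carrier G"
  unfolding lin_def by (auto intro!: finprod_closed)

lemma lin_zero [simp]: "lin G f 0 = \<one>"
  by (simp add: lin_def)

lemma lin_frag_of: "f k \<in> carrier G \<Longrightarrow> lin G f (frag_of k) = f k"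
  by (simp add: lin_def)

lemma lin_add:
  assumes "f \<in> keys c \<union> keys d \<rightarrow> carrier G"
  shows "lin G f (c + d) = lin G f c \<otimes> lin G f d"
proof -
  let ?T = "keys c \<union> keys d"
  have "lin G f (c + d) = finprod G (\<lambda>k. f k [^] lookup (c + d) k) ?T"
    using assms keys_add[of c d] by (intro lin_superset) auto
  also have "\<dots> = finprod G (\<lambda>k. f k [^] lookup c k \<otimes> f k [^] lookup d k) ?T"
    using assms by (intro finprod_cong) (auto simp: lookup_add int_pow_mult Pi_iff simp_implies_def)
  also have "\<dots> = finprod G (\<lambda>k. f k [^] lookup c k) ?T \<otimes> finprod G (\<lambda>k. f k [^] lookup d k) ?T"
    using assms by (intro finprod_multf) auto
  also have "\<dots> = lin G f c \<otimes> lin G f d"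
    using assms lin_superset[of ?T c f] lin_superset[of ?T d f] by simp
  finally show ?thesis .
qed

lemma lin_hom: "f \<in> S \<rightarrow> carrier G \<Longrightarrow> lin G f \<in> hom (free_Abelian_group S) G"
  by (rule homI) (auto intro!: lin_closed lin_add)

lemma lin_eq_hom:
  assumes "h \<in> hom (free_Abelian_group S) G" "keys c \<subseteq> S"
  shows "lin G (\<lambda>s. h (frag_of s)) c = h c"
proof -
  have *: "h (frag_of s) \<in> carrier G" if "s \<in> S" for s
    using hom_in_carrier[OF assms(1)] that by simp
  show ?thesis
    by (rule free_hom_eq[where S = S and H = G]) (use assms * in \<open>auto intro!: lin_hom lin_frag_of\<close>)
qed

lemma lin_cmul:
  assumes "f \<in> keys c \<rightarrow> carrier G"
  shows "lin G f (frag_cmul n c) = lin G f c [^] n"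
proof -
  have "lin G f (c [^]\<^bsub>free_Abelian_group (keys c)\<^esub> n) = lin G f c [^] n"
    by (rule hom_int_pow[OF lin_hom[OF assms]]) auto
  then show ?thesis by simp
qed

lemma lin_minus:
  assumes "f \<in> keys c \<rightarrow> carrier G"
  shows "lin G f (- c) = inv (lin G f c)"
proof -
  have "lin G f (frag_cmul (-1) c) = lin G f c [^] (- 1 :: int)"
    by (rule lin_cmul[OF assms])
  then show ?thesis using assms
    by (simp add: int_pow_neg lin_closed)
qed

lemma lin_diff:
  assumes "f \<in> keys c \<union> keys d \<rightarrow> carrier G"
  shows "lin G f (c - d) = lin G f c \<otimes> inv (lin G f d)"
  using lin_add[of f c "- d"] lin_minus[of f d] assms by auto

lemma lin_sum:
  assumes "finite I" "\<And>i. i \<in> I \<Longrightarrow> f \<in> keys (c i) \<rightarrow> carrier G"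
  shows "lin G f (sum c I) = finprod G (\<lambda>i. lin G f (c i)) I"
  using assms
proof (induction I rule: finite_induct)
  case (insert i I)
  have "f \<in> keys (sum c I) \<rightarrow> carrier G"
    using insert keys_sum[of c I] by blast
  then have "lin G f (c i + sum c I) = lin G f (c i) \<otimes> lin G f (sum c I)"
    using \<open>f \<in> keys (sum c I) \<rightarrow> _\<close> insert.prems[of i] by (intro lin_add) auto
  moreover have "(\<lambda>i. lin G f (c i)) \<in> insert i I \<rightarrow> carrier G"
    using lin_closed[OF insert.prems] by blast
  ultimately show ?case
    using insert.hyps insert.IH[OF insert.prems] by (simp add: Pi_iff)
qed simp

text \<open>
  Evaluating a formal combination of formal combinations in one or in two stages gives the same
  result.  With boundaries as the inner combinations this reduces \<open>d d = 0\<close> to a statement about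
  formal chains.
\<close>

lemma lin_frag_extend:
  assumes "f \<in> S \<rightarrow> carrier G" "\<And>k. k \<in> keys c \<Longrightarrow> keys (g k) \<subseteq> S"
  shows "lin G f (frag_extend g c) = lin G (\<lambda>k. lin G f (g k)) c"
proof -
  let ?K = "{k. keys (g k) \<subseteq> S}"
  have f: "f \<in> keys c \<rightarrow> carrier G" if "keys c \<subseteq> S" for c
    using that assms by blast
  have sub: "keys (frag_extend g x) \<subseteq> S" if "keys x \<subseteq> ?K" for x
    using keys_frag_extend[of g x] that by blast
  have h: "(\<lambda>c. lin G f (frag_extend g c)) \<in> hom (free_Abelian_group ?K) G"
  proof (rule homI)
    fix x y assume "x \<in> carrier (free_Abelian_group ?K)" "y \<in> carrier (free_Abelian_group ?K)"
    then have "f \<in> keys (frag_extend g x) \<union> keys (frag_extend g y) \<rightarrow> carrier G"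
      using f[OF sub] by auto
    then show "lin G f (frag_extend g (x \<otimes>\<^bsub>free_Abelian_group ?K\<^esub> y)) =
        lin G f (frag_extend g x) \<otimes> lin G f (frag_extend g y)"
      by (simp add: frag_extend_add lin_add)
  qed (use f[OF sub] in \<open>auto intro!: lin_closed\<close>)
  have *: "(\<lambda>k. lin G f (g k)) \<in> ?K \<rightarrow> carrier G"
    using lin_closed[OF f] by simp
  show ?thesis
  proof (rule free_hom_eq[OF h lin_hom[OF *] is_group])
    fix s assume "s \<in> ?K"
    then show "lin G f (frag_extend g (frag_of s)) = lin G (\<lambda>k. lin G f (g k)) (frag_of s)"
      using lin_frag_of[of "\<lambda>k. lin G f (g k)" s] * by (simp add: Pi_iff)
  qed (use assms(2) in auto)
qed

lemma lin_mult_fun: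
  assumes "f \<in> keys c \<rightarrow> carrier G" "g \<in> keys c \<rightarrow> carrier G"
  shows "lin G (\<lambda>k. f k \<otimes> g k) c = lin G f c \<otimes> lin G g c"
proof -
  have "lin G (\<lambda>k. f k \<otimes> g k) c = finprod G (\<lambda>k. f k [^] lookup c k \<otimes> g k [^] lookup c k) (keys c)"
    unfolding lin_def
    using assms by (intro finprod_cong) (auto simp: int_pow_distrib Pi_iff simp_implies_def)
  also have "\<dots> = lin G f c \<otimes> lin G g c"
    unfolding lin_def using assms by (intro finprod_multf) auto
  finally show ?thesis .
qed

lemma lin_one_fun: "(\<And>k. k \<in> keys c \<Longrightarrow> f k = \<one>) \<Longrightarrow> lin G f c = \<one>"
  unfolding lin_def by (rule finprod_one_eqI) simp

lemma hom_lin: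
  assumes "comm_group H" "h \<in> hom G H" "f \<in> keys c \<rightarrow> carrier G"
  shows "h (lin G f c) = lin H (\<lambda>k. h (f k)) c"
proof -
  interpret H: comm_group H by fact
  have "h \<circ> lin G f \<in> hom (free_Abelian_group (keys c)) H"
    using lin_hom[OF assms(3)] assms(2)
    by (auto simp: hom_def Pi_iff)
  then have "(h \<circ> lin G f) c = lin H (\<lambda>s. (h \<circ> lin G f) (frag_of s)) c"
    by (rule H.lin_eq_hom[symmetric]) simp
  also have "\<dots> = lin H (\<lambda>k. h (f k)) c"
    using assms(3) hom_in_carrier[OF assms(2)]
    by (intro H.lin_cong) (auto simp: lin_frag_of Pi_iff)
  finally show ?thesis by simp
qed

end

section \<open>Presented groups and tensor products\<close>

lemma generate_subset_vimage:
  assumes "group G" "group H" "h \<in> hom G H" "subgroup K H" "R \<subseteq> carrier G" "h ` R \<subseteq> K"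
    and "z \<in> generate G R"
  shows "h z \<in> K"
proof -
  interpret group_hom G H h
    using assms by (simp add: group_hom_def group_hom_axioms_def)
  interpret K: subgroup K H by fact
  show ?thesis
    using assms(7)
  proof (induction rule: generate.induct)
    case (inv z)
    then show ?case using assms by (metis K.m_inv_closed hom_inv image_subset_iff subsetD)
  next
    case (eng a b)
    then show ?case using assms G.generate_in_carrier[OF assms(5)] by simp
  qed (use assms in auto)
qed

text \<open>
  Membership of \<open>f s \<otimes> inv (g s)\<close> in \<open>K\<close> is congruence modulo \<open>K\<close>; in this form products are
  compared without passing to the quotient group.
\<close>

lemma (in comm_group) finprod_ratio_mem_subgroup:
  assumes "subgroup K G" "f \<in> S \<rightarrow> carrier G" "g \<in> S \<rightarrow> carrier G"
    and "\<And>s. s \<in> S \<Longrightarrow> f s \<otimes> inv (g s) \<in> K"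
  shows "finprod G f S \<otimes> inv (finprod G g S) \<in> K"
proof -
  interpret K: subgroup K G by fact
  show ?thesis
    using assms(2-)
  proof (induction S rule: infinite_finite_induct)
    case (insert s S)
    then have c: "f s \<in> carrier G" "g s \<in> carrier G" "finprod G f S \<in> carrier G" "finprod G g S \<in> carrier G"
      by auto
    have "finprod G f (insert s S) \<otimes> inv (finprod G g (insert s S)) =
        (f s \<otimes> inv (g s)) \<otimes> (finprod G f S \<otimes> inv (finprod G g S))"
      using insert c by (simp add: inv_mult m_ac)
    then show ?case using insert by simp
  qed auto
qed

lemma (in comm_group) finprod_mem_subgroup:
  assumes "subgroup K G" "\<And>s. s \<in> S \<Longrightarrow> f s \<in> K"
  shows "finprod G f S \<in> K"
proof -
  have "finprod G f S \<otimes> inv (finprod G (\<lambda>s. \<one>) S) \<in> K"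
    using assms subgroup.mem_carrier[OF assms(1)] by (intro finprod_ratio_mem_subgroup) auto
  moreover have "finprod G f S \<in> carrier G"
    using assms subgroup.mem_carrier[OF assms(1)] by auto
  ultimately show ?thesis by simp
qed

text \<open>
  The projection from the free abelian group, of which \<open>presented_gen\<close> is the value on generators.
\<close>

definition pres_class :: "'g set \<Rightarrow> ('g \<Rightarrow>\<^sub>0 int) set \<Rightarrow> ('g \<Rightarrow>\<^sub>0 int) \<Rightarrow> ('g \<Rightarrow>\<^sub>0 int) set" where
  "pres_class S R z = generate (free_Abelian_group S) R #>\<^bsub>free_Abelian_group S\<^esub> z"

lemma presented_gen_eq: "presented_gen S R g = pres_class S R (frag_of g)"
  by (simp add: presented_gen_def pres_class_def)

locale presentation =
  fixes S :: "'g set" and R :: "('g \<Rightarrow>\<^sub>0 int) set"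
  assumes relators: "r \<in> R \<Longrightarrow> keys r \<subseteq> S"
begin

abbreviation "N \<equiv> generate (free_Abelian_group S) R"

lemma relators_carrier: "R \<subseteq> carrier (free_Abelian_group S)"
  using relators by auto

sublocale N: normal N "free_Abelian_group S"
  by (rule comm_group.subgroup_imp_normal[OF abelian_free_Abelian_group])
     (rule group.generate_is_subgroup[OF group_free_Abelian_group relators_carrier])

lemma comm_group_presented: "comm_group (presented_group S R)"
  unfolding presented_group_def
  by (rule comm_group.abelian_FactGroup[OF abelian_free_Abelian_group N.subgroup_axioms])

lemma pres_class_hom: "pres_class S R \<in> hom (free_Abelian_group S) (presented_group S R)"
  unfolding pres_class_def presented_group_def by (rule N.r_coset_hom_Mod)

lemma pres_class_surj:
  assumes "a \<in> carrier (presented_group S R)"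
  shows "\<exists>z. keys z \<subseteq> S \<and> pres_class S R z = a"
proof -
  from assms obtain z where "z \<in> carrier (free_Abelian_group S)" "a = N #>\<^bsub>free_Abelian_group S\<^esub> z"
    unfolding presented_group_def FactGroup_def RCOSETS_def by auto
  then show ?thesis by (intro exI[of _ z]) (simp add: pres_class_def)
qed

lemma pres_class_eq_one_iff:
  assumes "keys z \<subseteq> S"
  shows "pres_class S R z = \<one>\<^bsub>presented_group S R\<^esub> \<longleftrightarrow> z \<in> N"
proof -
  have "pres_class S R z = \<one>\<^bsub>presented_group S R\<^esub> \<longleftrightarrow> N #>\<^bsub>free_Abelian_group S\<^esub> z = N"
    by (simp add: pres_class_def presented_group_def)
  also have "\<dots> \<longleftrightarrow> z \<in> N"
    using N.rcos_self[of z] N.subgroup_axioms assms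
    by (metis N.coset_join1 N.coset_join2 N.subset carrier_free_Abelian_group_iff N.is_subgroup)
  finally show ?thesis .
qed

lemma pres_class_add:
  assumes "keys y \<subseteq> S" "keys z \<subseteq> S"
  shows "pres_class S R (y + z) = pres_class S R y \<otimes>\<^bsub>presented_group S R\<^esub> pres_class S R z"
  using hom_mult[OF pres_class_hom, of y z] assms by simp

lemma pres_class_closed: "keys z \<subseteq> S \<Longrightarrow> pres_class S R z \<in> carrier (presented_group S R)"
  using hom_in_carrier[OF pres_class_hom, of z] by simp

lemma pres_class_eq_iff:
  assumes "keys y \<subseteq> S" "keys z \<subseteq> S"
  shows "pres_class S R y = pres_class S R z \<longleftrightarrow> y - z \<in> N"
proof -
  interpret Q: comm_group "presented_group S R" by (rule comm_group_presented)
  have d: "keys (y - z) \<subseteq> S" using assms keys_diff[of y z] by blast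
  have "pres_class S R y = pres_class S R (y - z) \<otimes>\<^bsub>presented_group S R\<^esub> pres_class S R z"
    using pres_class_add[OF d assms(2)] by simp
  then show ?thesis
    using pres_class_eq_one_iff[OF d] Q.r_cancel_one'[OF pres_class_closed[OF assms(2)] pres_class_closed[OF d]]
    by (metis)
qed

end

lemma presentation_tensor:
  assumes "comm_group A" "comm_group B"
  shows "presentation (carrier A \<times> carrier B) (tensor_rels A B)"
proof -
  interpret A: comm_group A by fact
  interpret B: comm_group B by fact
  show ?thesis
  proof
    fix r assume "r \<in> tensor_rels A B"
    then obtain p q q' where "r = frag_of p - frag_of q - frag_of q'"
      and "{p, q, q'} \<subseteq> carrier A \<times> carrier B"
      unfolding tensor_rels_def by auto
    then show "keys r \<subseteq> carrier A \<times> carrier B"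
      using keys_diff[of "frag_of p - frag_of q" "frag_of q'"] keys_diff[of "frag_of p" "frag_of q"] by auto
  qed
qed

locale two_comm_groups = A: comm_group A + B: comm_group B
  for A :: "'c monoid" (structure) and B :: "'d monoid" (structure)
begin

abbreviation "T \<equiv> tensor_group A B"
abbreviation "pure \<equiv> pure_tensor A B"

sublocale TP: presentation "carrier A \<times> carrier B" "tensor_rels A B"
  by (rule presentation_tensor) unfold_locales

sublocale T: comm_group "tensor_group A B"
  unfolding tensor_group_def by (rule TP.comm_group_presented)

lemma pure_closed [intro, simp]: "a \<in> carrier A \<Longrightarrow> b \<in> carrier B \<Longrightarrow> pure a b \<in> carrier T"
  unfolding pure_tensor_def presented_gen_eq tensor_group_def by (rule TP.pres_class_closed) auto

text \<open>
  Both biadditivity relators have the shape \<open>p - q - q'\<close> for pairs \<open>p, q, q'\<close>.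
\<close>

lemma pure_eqI:
  assumes "frag_of p - frag_of q - frag_of q' \<in> tensor_rels A B"
    "{p, q, q'} \<subseteq> carrier A \<times> carrier B"
  shows "pure (fst p) (snd p) = pure (fst q) (snd q) \<otimes>\<^bsub>T\<^esub> pure (fst q') (snd q')"
proof -
  have "frag_of p - (frag_of q + frag_of q') \<in> TP.N"
    using assms(1) generate.incl by (metis diff_diff_add)
  moreover have "keys (frag_of q + frag_of q') \<subseteq> carrier A \<times> carrier B"
    using keys_add[of "frag_of q" "frag_of q'"] assms(2) by auto
  ultimately show ?thesis
    using assms(2) unfolding pure_tensor_def presented_gen_eq tensor_group_def
    by (simp add: TP.pres_class_eq_iff flip: TP.pres_class_add)
qed

lemma pure_hom_left:
  assumes "b \<in> carrier B"
  shows "(\<lambda>a. pure a b) \<in> hom A T"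
proof (rule homI)
  fix a a' assume a: "a \<in> carrier A" "a' \<in> carrier A"
  then have "frag_of (a \<otimes>\<^bsub>A\<^esub> a', b) - frag_of (a, b) - frag_of (a', b) \<in> tensor_rels A B"
    unfolding tensor_rels_def using assms by (intro UnI1 CollectI exI conjI) (rule refl | assumption)+
  from pure_eqI[OF this] show "pure (a \<otimes>\<^bsub>A\<^esub> a') b = pure a b \<otimes>\<^bsub>T\<^esub> pure a' b"
    using a assms by simp
qed (use assms in auto)

lemma pure_hom_right:
  assumes "a \<in> carrier A"
  shows "(\<lambda>b. pure a b) \<in> hom B T"
proof (rule homI)
  fix b b' assume b: "b \<in> carrier B" "b' \<in> carrier B"
  then have "frag_of (a, b \<otimes>\<^bsub>B\<^esub> b') - frag_of (a, b) - frag_of (a, b') \<in> tensor_rels A B"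
    unfolding tensor_rels_def using assms by (intro UnI2 CollectI exI conjI) (rule refl | assumption)+
  from pure_eqI[OF this] show "pure a (b \<otimes>\<^bsub>B\<^esub> b') = pure a b \<otimes>\<^bsub>T\<^esub> pure a b'"
    using b assms by simp
qed (use assms in auto)

end

lemma hom_comp: "g \<in> hom G H \<Longrightarrow> h \<in> hom H K \<Longrightarrow> (\<lambda>x. h (g x)) \<in> hom G K"
  by (auto simp: hom_def Pi_iff)

lemma comm_group_product_group:
  assumes "\<And>i. i \<in> I \<Longrightarrow> comm_group (G i)"
  shows "comm_group (product_group I G)"
proof (rule group.group_comm_groupI)
  show "group (product_group I G)"
    using assms by (intro product_group) (simp add: comm_group.axioms)
  fix x y assume "x \<in> carrier (product_group I G)" "y \<in> carrier (product_group I G)"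
  then show "x \<otimes>\<^bsub>product_group I G\<^esub> y = y \<otimes>\<^bsub>product_group I G\<^esub> x"
    using assms by (auto simp: PiE_iff comm_monoid.m_comm comm_group.axioms intro!: restrict_ext)
qed

lemma proj_hom: "i \<in> I \<Longrightarrow> (\<lambda>x. x i) \<in> hom (product_group I G) (G i)"
  by (rule homI) auto

lemma (in group) mem_subgroup_cancel:
  assumes "subgroup K G" "x \<in> K" "a \<in> carrier G" "x \<otimes> inv a \<in> K"
  shows "a \<in> K"
proof -
  interpret K: subgroup K G by fact
  have "inv (x \<otimes> inv a) \<otimes> x \<in> K"
    using assms by blast
  then show ?thesis
    using assms K.mem_carrier[OF assms(2)] by (simp add: inv_mult_group m_assoc)
qed

text \<open>
  Tensoring the presentation \<open>Z^(R) \<rightarrow> Z^S \<rightarrow> A \<rightarrow> 0\<close> with \<open>M\<close> gives an exact sequence ending in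
  \<open>M^S \<rightarrow> A \<otimes> M \<rightarrow> 0\<close>.  Finiteness of \<open>S\<close> is what allows \<open>Z^S \<otimes> M\<close> to be the full
  product \<open>M^S\<close>.
\<close>

locale presentation_tensor = presentation S R + M: comm_group M
  for S :: "'g set" and R :: "('g \<Rightarrow>\<^sub>0 int) set" and M :: "'d monoid" +
  assumes finite_S: "finite S"
begin

sublocale two_comm_groups "presented_group S R" M
  unfolding two_comm_groups_def using comm_group_presented M.comm_group_axioms by blast

abbreviation "pairs \<equiv> carrier (presented_group S R) \<times> carrier M"
abbreviation "tensor_class \<equiv> pres_class pairs (tensor_rels (presented_group S R) M)"
abbreviation "W \<equiv> product_group S (\<lambda>_. M)"

sublocale W: comm_group W
  by (rule comm_group_product_group) (rule M.comm_group_axioms)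

text \<open>
  The image of \<open>f \<otimes> m\<close> under the identification of \<open>Z^S \<otimes> M\<close> with \<open>M^S\<close>.
\<close>

definition scal :: "('g \<Rightarrow>\<^sub>0 int) \<Rightarrow> 'd \<Rightarrow> 'g \<Rightarrow> 'd" where
  "scal f m = (\<lambda>s\<in>S. m [^]\<^bsub>M\<^esub> lookup f s)"

definition Phi :: "('g \<Rightarrow> 'd) \<Rightarrow> (('g \<Rightarrow>\<^sub>0 int) set \<times> 'd \<Rightarrow>\<^sub>0 int) set" where
  "Phi a = finprod T (\<lambda>s. pure (presented_gen S R s) (a s)) S"

lemma gen_closed [simp, intro]: "s \<in> S \<Longrightarrow> presented_gen S R s \<in> carrier (presented_group S R)"
  unfolding presented_gen_eq by (rule pres_class_closed) simp

lemma scal_closed [simp, intro]: "m \<in> carrier M \<Longrightarrow> scal f m \<in> carrier W"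
  by (simp add: scal_def)

lemma scal_apply_closed [simp]: "m \<in> carrier M \<Longrightarrow> s \<in> S \<Longrightarrow> scal f m s \<in> carrier M"
  by (simp add: scal_def)

lemma scal_outside [simp]: "s \<notin> S \<Longrightarrow> scal f m s = undefined"
  by (simp add: scal_def)

lemma scal_hom_left: "m \<in> carrier M \<Longrightarrow> (\<lambda>f. scal f m) \<in> hom (free_Abelian_group S) W"
  by (rule homI) (auto simp: scal_def lookup_add M.int_pow_mult)

lemma scal_hom_right: "(\<lambda>m. scal f m) \<in> hom M W"
  by (rule homI) (auto simp: scal_def M.int_pow_distrib)

lemma Phi_hom: "Phi \<in> hom W T"
proof (rule homI)
  fix a b assume ab: "a \<in> carrier W" "b \<in> carrier W"
  have "Phi (a \<otimes>\<^bsub>W\<^esub> b) =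
      finprod T (\<lambda>s. pure (presented_gen S R s) (a s) \<otimes>\<^bsub>T\<^esub> pure (presented_gen S R s) (b s)) S"
    unfolding Phi_def
    using ab hom_mult[OF pure_hom_right]
    by (intro T.finprod_cong') (auto simp: PiE_iff Pi_iff)
  also have "\<dots> = Phi a \<otimes>\<^bsub>T\<^esub> Phi b"
    unfolding Phi_def using ab by (intro T.finprod_multf) auto
  finally show "Phi (a \<otimes>\<^bsub>W\<^esub> b) = Phi a \<otimes>\<^bsub>T\<^esub> Phi b" .
qed (auto simp: Phi_def intro!: T.finprod_closed)

lemma Phi_single:
  assumes "s \<in> S" "a s \<in> carrier M" "\<And>s'. s' \<in> S \<Longrightarrow> s' \<noteq> s \<Longrightarrow> a s' = \<one>\<^bsub>M\<^esub>"
  shows "Phi a = pure (presented_gen S R s) (a s)"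
proof -
  have eq: "pure (presented_gen S R s') (a s') = (if s = s' then pure (presented_gen S R s) (a s) else \<one>\<^bsub>T\<^esub>)"
    if "s' \<in> S" for s'
    using that assms hom_one[OF pure_hom_right M.is_group T.is_group, OF gen_closed[OF that]] by auto
  have "Phi a = finprod T (\<lambda>s'. if s = s' then pure (presented_gen S R s) (a s) else \<one>\<^bsub>T\<^esub>) S"
    unfolding Phi_def using assms(1,2) by (intro T.finprod_cong' refl eq) auto
  also have "\<dots> = pure (presented_gen S R s) (a s)"
    using assms(1,2) finite_S by (intro T.finprod_singleton) auto
  finally show ?thesis .
qed

text \<open>
  The map \<open>Phi\<close> is induced by the projection \<open>Z^S \<rightarrow> A\<close>; in particular it kills \<open>r \<otimes> m\<close> for
  every relator \<open>r\<close>.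
\<close>

lemma Phi_scal:
  assumes "keys f \<subseteq> S" "m \<in> carrier M"
  shows "Phi (scal f m) = pure (pres_class S R f) m"
proof (rule free_hom_eq[OF hom_comp[OF scal_hom_left[OF assms(2)] Phi_hom]
      hom_comp[OF pres_class_hom pure_hom_left[OF assms(2)]] T.is_group _ assms(1)])
  fix s assume "s \<in> S"
  then show "Phi (scal (frag_of s) m) = pure (pres_class S R (frag_of s)) m"
    using Phi_single[of s "scal (frag_of s) m"] assms(2) by (simp add: scal_def presented_gen_eq)
qed

text \<open>
  A section of the projection \<open>Z^S \<rightarrow> A\<close>, not additive in general.  Together with \<open>scal\<close> it
  yields a map \<open>Psi\<close> from the free group on pairs to \<open>M^S\<close> that becomes well defined on
  \<open>A \<otimes> M\<close> modulo the relators, hence an inverse of \<open>Phi\<close> on the cokernel.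
\<close>

definition rep :: "('g \<Rightarrow>\<^sub>0 int) set \<Rightarrow> 'g \<Rightarrow>\<^sub>0 int" where
  "rep c = (SOME z. keys z \<subseteq> S \<and> pres_class S R z = c)"

lemma rep:
  assumes "c \<in> carrier (presented_group S R)"
  shows "keys (rep c) \<subseteq> S" "pres_class S R (rep c) = c"
  using someI_ex[OF pres_class_surj[OF assms]] unfolding rep_def by auto

definition Psi :: "(('g \<Rightarrow>\<^sub>0 int) set \<times> 'd \<Rightarrow>\<^sub>0 int) \<Rightarrow> 'g \<Rightarrow> 'd" where
  "Psi = lin W (\<lambda>p. scal (rep (fst p)) (snd p))"

lemma Psi_hom: "Psi \<in> hom (free_Abelian_group pairs) W"
  unfolding Psi_def by (rule W.lin_hom) auto

lemma Psi_frag_of: "m \<in> carrier M \<Longrightarrow> Psi (frag_of (c, m)) = scal (rep c) m"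
  unfolding Psi_def by (subst W.lin_frag_of) auto

lemma tclass_hom: "tensor_class
    \<in> hom (free_Abelian_group pairs) T"
  unfolding tensor_group_def by (rule TP.pres_class_hom)

lemma Phi_Psi:
  assumes "keys z \<subseteq> pairs"
  shows "Phi (Psi z) = tensor_class z"
proof (rule free_hom_eq[OF hom_comp[OF Psi_hom Phi_hom] tclass_hom T.is_group _ assms])
  fix p assume "p \<in> pairs"
  then obtain c m where p: "p = (c, m)" "c \<in> carrier (presented_group S R)" "m \<in> carrier M"
    by auto
  then show "Phi (Psi (frag_of p)) =
      tensor_class (frag_of p)"
    by (simp add: Psi_frag_of Phi_scal rep pure_tensor_def presented_gen_eq)
qed

lemma Phi_surj: "Phi ` carrier W = carrier T"
proof
  show "Phi ` carrier W \<subseteq> carrier T"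
    using hom_in_carrier[OF Phi_hom] by auto
  show "carrier T \<subseteq> Phi ` carrier W"
  proof
    fix u assume "u \<in> carrier T"
    then obtain z where z: "keys z \<subseteq> pairs"
      "tensor_class z = u"
      using TP.pres_class_surj unfolding tensor_group_def by blast
    then have "u = Phi (Psi z)" "Psi z \<in> carrier W"
      using hom_in_carrier[OF Psi_hom, of z] by (simp_all add: Phi_Psi)
    then show "u \<in> Phi ` carrier W" by blast
  qed
qed

text \<open>
  The image of \<open>Z^(R) \<otimes> M\<close> in \<open>M^S\<close>.
\<close>

definition "K = generate W {scal r m | r m. r \<in> R \<and> m \<in> carrier M}"

lemma K_subgroup: "subgroup K W"
  unfolding K_def by (rule W.generate_is_subgroup) auto

lemma scal_mem_K:
  assumes "z \<in> N" "m \<in> carrier M"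
  shows "scal z m \<in> K"
  by (rule generate_subset_vimage[OF group_free_Abelian_group W.is_group scal_hom_left[OF assms(2)] K_subgroup
        relators_carrier _ assms(1)])
     (use assms in \<open>auto simp: K_def intro!: generate.incl\<close>)

lemma scal_diff: "m \<in> carrier M \<Longrightarrow> scal (f - g) m = scal f m \<otimes>\<^bsub>W\<^esub> inv\<^bsub>W\<^esub> scal g m"
  by (auto simp: scal_def lookup_minus M.int_pow_diff intro!: restrict_ext)

lemma N_rep_add:
  assumes "a \<in> carrier (presented_group S R)" "a' \<in> carrier (presented_group S R)"
  shows "rep (a \<otimes>\<^bsub>presented_group S R\<^esub> a') - rep a - rep a' \<in> N"
proof -
  have "keys (rep a + rep a') \<subseteq> S"
    using keys_add[of "rep a" "rep a'"] rep[OF assms(1)] rep[OF assms(2)] by blast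
  then have "rep (a \<otimes>\<^bsub>presented_group S R\<^esub> a') - (rep a + rep a') \<in> N"
    using rep[OF assms(1)] rep[OF assms(2)] rep[OF A.m_closed[OF assms]]
    by (simp add: pres_class_add flip: pres_class_eq_iff)
  then show ?thesis by (simp add: diff_diff_eq)
qed

lemma Psi_diff:
  assumes "b \<in> carrier M" "b' \<in> carrier M" "b'' \<in> carrier M"
  shows "Psi (frag_of (a, b) - frag_of (a', b') - frag_of (a'', b'')) =
    (scal (rep a) b \<otimes>\<^bsub>W\<^esub> inv\<^bsub>W\<^esub> scal (rep a') b') \<otimes>\<^bsub>W\<^esub> inv\<^bsub>W\<^esub> scal (rep a'') b''"
proof -
  let ?f = "\<lambda>p. scal (rep (fst p)) (snd p)"
  have "keys (frag_of (a, b) - frag_of (a', b')) \<subseteq> {(a, b), (a', b')}"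
    using keys_diff[of "frag_of (a, b)" "frag_of (a', b')"] by auto
  then have "?f \<in> keys (frag_of (a, b) - frag_of (a', b')) \<union> keys (frag_of (a'', b'')) \<rightarrow> carrier W"
    "?f \<in> keys (frag_of (a, b)) \<union> keys (frag_of (a', b')) \<rightarrow> carrier W"
    using scal_closed[OF assms(1)] scal_closed[OF assms(2)] scal_closed[OF assms(3)] by (auto simp del: carrier_product_group)
  then have "Psi (frag_of (a, b) - frag_of (a', b') - frag_of (a'', b'')) =
      (Psi (frag_of (a, b)) \<otimes>\<^bsub>W\<^esub> inv\<^bsub>W\<^esub> Psi (frag_of (a', b'))) \<otimes>\<^bsub>W\<^esub> inv\<^bsub>W\<^esub> Psi (frag_of (a'', b''))"
    unfolding Psi_def by (simp only: W.lin_diff)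
  then show ?thesis
    using assms by (simp only: Psi_frag_of)
qed

text \<open>
  Additivity in the second argument holds on the nose, since \<open>scal\<close> is additive there.  Additivity
  in the first argument holds modulo \<open>K\<close>, since two representatives of a class differ by a
  consequence of the relators.
\<close>

lemma Psi_rels:
  assumes "z \<in> TP.N"
  shows "Psi z \<in> K"
proof (rule generate_subset_vimage[OF group_free_Abelian_group W.is_group Psi_hom K_subgroup
      TP.relators_carrier _ assms], safe)
  fix z assume "z \<in> tensor_rels (presented_group S R) M"
  then consider (l) a a' b where "z = frag_of (a \<otimes>\<^bsub>presented_group S R\<^esub> a', b) - frag_of (a, b) - frag_of (a', b)"
      "a \<in> carrier (presented_group S R)" "a' \<in> carrier (presented_group S R)" "b \<in> carrier M"
    | (r) a b b' where "z = frag_of (a, b \<otimes>\<^bsub>M\<^esub> b') - frag_of (a, b) - frag_of (a, b')"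
      "a \<in> carrier (presented_group S R)" "b \<in> carrier M" "b' \<in> carrier M"
    unfolding tensor_rels_def by auto
  then show "Psi z \<in> K"
  proof cases
    case l
    have "Psi z = (scal (rep (a \<otimes>\<^bsub>presented_group S R\<^esub> a')) b \<otimes>\<^bsub>W\<^esub> inv\<^bsub>W\<^esub> scal (rep a) b) \<otimes>\<^bsub>W\<^esub> inv\<^bsub>W\<^esub> scal (rep a') b"
      using l by (simp only: l(1) Psi_diff)
    also have "\<dots> = scal (rep (a \<otimes>\<^bsub>presented_group S R\<^esub> a') - rep a - rep a') b"
      using l by (simp only: scal_diff)
    finally show ?thesis
      using scal_mem_K[OF N_rep_add] l by simp
  next
    case r
    have "Psi z = (scal (rep a) (b \<otimes>\<^bsub>M\<^esub> b') \<otimes>\<^bsub>W\<^esub> inv\<^bsub>W\<^esub> scal (rep a) b) \<otimes>\<^bsub>W\<^esub> inv\<^bsub>W\<^esub> scal (rep a) b'"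
      using r by (simp only: r(1) Psi_diff M.m_closed)
    also have "\<dots> = \<one>\<^bsub>W\<^esub>"
      using hom_mult[OF scal_hom_right r(3,4), of "rep a"] W.m_comm[OF scal_closed[OF r(3)] scal_closed[OF r(4)]]
        scal_closed[OF r(3)] scal_closed[OF r(4)]
      by (simp add: W.m_assoc W.inv_solve_right W.inv_solve_left del: mult_product_group inv_product_group carrier_product_group one_product_group)
    finally show ?thesis
      using subgroup.one_closed[OF K_subgroup] by simp
  qed
qed

lemma finprod_W_apply:
  assumes "s \<in> S" "f \<in> I \<rightarrow> carrier W"
  shows "finprod W f I s = finprod M (\<lambda>i. f i s) I"
  using hom_finprod[OF W.comm_group_axioms M.comm_group_axioms proj_hom[OF assms(1)] assms(2)] .

lemma W_eq_finprod:
  assumes "a \<in> carrier W"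
  shows "a = finprod W (\<lambda>s. scal (frag_of s) (a s)) S"
proof (rule extensionalityI[of _ S])
  have aM: "a s \<in> carrier M" if "s \<in> S" for s
    using assms that by auto
  have f: "(\<lambda>s. scal (frag_of s) (a s)) \<in> S \<rightarrow> carrier W"
    using aM by auto
  then have "finprod W (\<lambda>s. scal (frag_of s) (a s)) S \<in> carrier W"
    by (rule W.finprod_closed)
  then show "finprod W (\<lambda>s. scal (frag_of s) (a s)) S \<in> extensional S"
    by (auto simp: PiE_iff)
  fix s assume s: "s \<in> S"
  have "finprod W (\<lambda>s. scal (frag_of s) (a s)) S s = finprod M (\<lambda>i. if s = i then a i else \<one>\<^bsub>M\<^esub>) S"
    unfolding finprod_W_apply[OF s f]
    using s assms by (intro M.finprod_cong') (auto simp: scal_def PiE_iff)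
  also have "\<dots> = a s"
    using s assms finite_S by (intro M.finprod_singleton) auto
  finally show "a s = finprod W (\<lambda>s. scal (frag_of s) (a s)) S s" ..
qed (use assms in \<open>auto simp: PiE_iff\<close>)

text \<open>
  If \<open>Phi a\<close> vanishes, then the formal sum \<open>z\<close> of the pairs \<open>([s], a s)\<close> is a consequence of the
  tensor relators, so \<open>Psi z\<close> lies in \<open>K\<close>.  But \<open>Psi z\<close> and \<open>a\<close> differ by an element of
  \<open>K\<close>, because the chosen representative of \<open>[s]\<close> agrees with \<open>s\<close> up to relators.
\<close>

theorem kernel_Phi: "kernel W T Phi = K"
proof
  interpret Phi: group_hom W T Phi
    using Phi_hom by unfold_locales
  have "scal r m \<in> kernel W T Phi" if "r \<in> R" "m \<in> carrier M" for r m
  proof -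
    have "pres_class S R r = \<one>\<^bsub>presented_group S R\<^esub>"
      using that relators pres_class_eq_one_iff generate.incl by metis
    then show ?thesis
      using that relators[OF that(1)] hom_one[OF pure_hom_left A.is_group T.is_group, OF that(2)]
        scal_closed[OF that(2)] by (simp add: kernel_def Phi_scal)
  qed
  then show "K \<subseteq> kernel W T Phi"
    unfolding K_def by (intro W.generate_subgroup_incl Phi.subgroup_kernel) auto
  show "kernel W T Phi \<subseteq> K"
  proof
    fix a assume "a \<in> kernel W T Phi"
    then have a: "a \<in> carrier W" "Phi a = \<one>\<^bsub>T\<^esub>" by (auto simp: kernel_def)
    then have aM: "a s \<in> carrier M" if "s \<in> S" for s using that by auto
    \<comment> \<open>the formal preimage of \<open>Phi a\<close> among pairs\<close>
    define z where "z = (\<Sum>s\<in>S. frag_of (presented_gen S R s, a s))"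
    have kz: "keys z \<subseteq> pairs"
      using keys_sum[of "\<lambda>s. frag_of (presented_gen S R s, a s)" S] aM unfolding z_def by auto
    have "tensor_class z
        = lin T (\<lambda>p. pure (fst p) (snd p)) z"
      using T.lin_eq_hom[OF tclass_hom kz] by (simp add: pure_tensor_def presented_gen_eq)
    also have "\<dots> = Phi a"
    proof -
      have "lin T (\<lambda>p. pure (fst p) (snd p)) z =
          finprod T (\<lambda>s. lin T (\<lambda>p. pure (fst p) (snd p)) (frag_of (presented_gen S R s, a s))) S"
        unfolding z_def using aM finite_S by (intro T.lin_sum) auto
      also have "\<dots> = Phi a"
        unfolding Phi_def using aM by (intro T.finprod_cong') (auto simp: T.lin_frag_of)
      finally show ?thesis .
    qed
    finally have "z \<in> TP.N"
      using a kz by (simp add: TP.pres_class_eq_one_iff tensor_group_def)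
    then have "Psi z \<in> K" by (rule Psi_rels)
    moreover have Pz: "Psi z = finprod W (\<lambda>s. scal (rep (presented_gen S R s)) (a s)) S"
    proof -
      have "Psi z = finprod W (\<lambda>s. Psi (frag_of (presented_gen S R s, a s))) S"
        unfolding z_def Psi_def using aM finite_S by (intro W.lin_sum) auto
      also have "\<dots> = finprod W (\<lambda>s. scal (rep (presented_gen S R s)) (a s)) S"
        using aM by (intro W.finprod_cong') (auto simp: Psi_frag_of)
      finally show ?thesis .
    qed
    moreover have "finprod W (\<lambda>s. scal (rep (presented_gen S R s)) (a s)) S
        \<otimes>\<^bsub>W\<^esub> inv\<^bsub>W\<^esub> finprod W (\<lambda>s. scal (frag_of s) (a s)) S \<in> K"
    proof (rule W.finprod_ratio_mem_subgroup[OF K_subgroup])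
      fix s assume s: "s \<in> S"
      have "rep (presented_gen S R s) - frag_of s \<in> N"
        using s rep[OF gen_closed[OF s]] by (simp add: presented_gen_eq flip: pres_class_eq_iff)
      then show "scal (rep (presented_gen S R s)) (a s) \<otimes>\<^bsub>W\<^esub> inv\<^bsub>W\<^esub> scal (frag_of s) (a s) \<in> K"
        unfolding scal_diff[OF aM[OF s], symmetric] by (rule scal_mem_K[OF _ aM[OF s]])
    qed (use aM in auto)
    then have "Psi z \<otimes>\<^bsub>W\<^esub> inv\<^bsub>W\<^esub> a \<in> K"
      unfolding Pz W_eq_finprod[OF a(1), symmetric] .
    ultimately show "a \<in> K"
      using W.mem_subgroup_cancel[OF K_subgroup _ a(1)] by blast
  qed
qed

end

section \<open>Formal chains on lists\<close>

lemma frag_induct [case_names zero one diff]: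
  assumes "Q 0" "\<And>x. Q (frag_of x)" "\<And>a b. Q a \<Longrightarrow> Q b \<Longrightarrow> Q (a - b)"
  shows "Q c"
  using frag_induction[of c UNIV Q] assms by auto

lemma keys_diff_subset: "keys a \<subseteq> S \<Longrightarrow> keys b \<subseteq> S \<Longrightarrow> keys (a - b) \<subseteq> S"
  for a b :: "'c \<Rightarrow>\<^sub>0 int"
  using keys_diff[of a b] by blast

lemma keys_add_subset: "keys a \<subseteq> S \<Longrightarrow> keys b \<subseteq> S \<Longrightarrow> keys (a + b) \<subseteq> S"
  for a b :: "'c \<Rightarrow>\<^sub>0 int"
  using keys_add[of a b] by blast

definition cone :: "'a \<Rightarrow> ('a list \<Rightarrow>\<^sub>0 int) \<Rightarrow> ('a list \<Rightarrow>\<^sub>0 int)" where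
  "cone v = frag_extend (\<lambda>\<tau>. frag_of (v # \<tau>))"

lemma cone_simps [simp]:
  "cone v 0 = 0" "cone v (frag_of \<tau>) = frag_of (v # \<tau>)"
  "cone v (c + d) = cone v c + cone v d" "cone v (c - d) = cone v c - cone v d" "cone v (- c) = - cone v c"
  "cone v (frag_cmul n c) = frag_cmul n (cone v c)"
  by (simp_all add: cone_def frag_extend_add frag_extend_diff frag_extend_minus frag_extend_cmul)

lemma cone_sum: "finite I \<Longrightarrow> cone v (sum f I) = (\<Sum>i\<in>I. cone v (f i))"
  by (simp add: cone_def frag_extend_sum o_def)

lemma lookup_cone: "lookup (cone v c) \<tau> = (case \<tau> of [] \<Rightarrow> 0 | w # \<tau>' \<Rightarrow> if w = v then lookup c \<tau>' else 0)"
proof (induction c rule: frag_induct)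
  case (one x) then show ?case by (auto split: list.splits)
next
  case (diff a b) then show ?case by (auto simp: lookup_minus split: list.splits)
qed (auto split: list.splits)

lemma keys_cone [simp]: "keys (cone v c) = (#) v ` keys c"
  by (auto simp: in_keys_iff lookup_cone split: list.splits if_splits)

text \<open>
  The alternating sum of the faces, with signs counted from the head of the list.  Then prepending
  a vertex is a cone construction, and the boundary obeys the cone formula
  \<open>d(v\<tau>) = \<tau> - v d(\<tau>)\<close>, which makes all boundary identities plain list inductions.  The face of
  a singleton is the empty list, so this is the augmented complex.
\<close>

fun boundary :: "'a list \<Rightarrow> ('a list \<Rightarrow>\<^sub>0 int)" where
  "boundary [] = 0"
| "boundary (v # \<tau>) = frag_of \<tau> - cone v (boundary \<tau>)"

text \<open>
  The same sum with signs counted from the last vertex \<open>\<sigma>_0\<close>, which is the convention of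
  \<open>codiff\<close>; for a fixed length the two differ by a global sign.
\<close>

definition signed_boundary :: "'a list \<Rightarrow> ('a list \<Rightarrow>\<^sub>0 int)" where
  "signed_boundary \<sigma> = frag_cmul ((- 1) ^ (length \<sigma> - 1)) (boundary \<sigma>)"

lemma extend_boundary_cone: "frag_extend boundary (cone v c) = c - cone v (frag_extend boundary c)"
proof (induction c rule: frag_induct)
  case (diff a b) then show ?case by (simp add: frag_extend_diff)
qed auto

lemma boundary_boundary: "frag_extend boundary (boundary \<sigma>) = 0"
  by (induction \<sigma>) (simp_all add: frag_extend_diff extend_boundary_cone)

lemma keys_boundary_Cons: "keys (boundary (v # \<tau>)) \<subseteq> insert \<tau> ((#) v ` keys (boundary \<tau>))"
  using keys_diff[of "frag_of \<tau>" "cone v (boundary \<tau>)"] by auto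

lemma length_keys_boundary: "\<tau> \<in> keys (boundary \<sigma>) \<Longrightarrow> Suc (length \<tau>) = length \<sigma>"
proof (induction \<sigma> arbitrary: \<tau>)
  case (Cons v \<sigma>) then show ?case using keys_boundary_Cons[of v \<sigma>] by auto
qed simp

lemma subseq_keys_boundary: "\<tau> \<in> keys (boundary \<sigma>) \<Longrightarrow> set \<tau> \<subseteq> set \<sigma> \<and> (sorted_wrt R \<sigma> \<longrightarrow> sorted_wrt R \<tau>)"
proof (induction \<sigma> arbitrary: \<tau>)
  case (Cons v \<sigma>)
  then show ?case using keys_boundary_Cons[of v \<sigma>] by fastforce
qed simp

lemma keys_signed_boundary: "keys (signed_boundary \<sigma>) = keys (boundary \<sigma>)"
  by (auto simp: signed_boundary_def)

lemma signed_boundary_signed_boundary: "frag_extend signed_boundary (signed_boundary \<sigma>) = 0"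
proof -
  have "frag_extend signed_boundary (signed_boundary \<sigma>) = frag_extend (\<lambda>\<tau>. frag_cmul ((- 1) ^ (length \<sigma> - 2)) (boundary \<tau>)) (signed_boundary \<sigma>)"
  proof (rule frag_extend_eq)
    fix \<tau> assume "\<tau> \<in> keys (signed_boundary \<sigma>)"
    then have "length \<tau> - 1 = length \<sigma> - 2"
      by (auto simp: signed_boundary_def dest!: length_keys_boundary)
    then show "signed_boundary \<tau> = frag_cmul ((- 1) ^ (length \<sigma> - 2)) (boundary \<tau>)"
      unfolding signed_boundary_def by (rule arg_cong)
  qed
  also have "\<dots> = frag_cmul ((- 1) ^ (length \<sigma> - 2)) (frag_extend boundary (signed_boundary \<sigma>))"
    by (simp add: frag_extend_def frag_cmul_sum mult.commute)
  also have "frag_extend boundary (signed_boundary \<sigma>) = 0"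
    by (simp add: signed_boundary_def frag_extend_cmul boundary_boundary)
  finally show ?thesis by simp
qed

lemma signed_boundary_Cons:
  assumes "\<tau> \<noteq> []"
  shows "signed_boundary (v # \<tau>) = cone v (signed_boundary \<tau>) + frag_cmul ((- 1) ^ length \<tau>) (frag_of \<tau>)"
proof -
  obtain m where "length \<tau> = Suc m" using assms by (cases \<tau>) auto
  then show ?thesis
    by (intro poly_mapping_eqI) (simp add: signed_boundary_def lookup_add lookup_minus right_diff_distrib)
qed

lemma signed_boundary_eq_sum_faces: "\<sigma> \<noteq> [] \<Longrightarrow> signed_boundary \<sigma> = (\<Sum>i<length \<sigma>. frag_cmul ((- 1) ^ i) (frag_of (face i \<sigma>)))"
proof (induction \<sigma>)
  case (Cons v \<tau>)
  show ?case
  proof (cases "\<tau> = []")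
    case True
    then show ?thesis by (simp add: signed_boundary_def face_def)
  next
    case False
    have "face i (v # \<tau>) = v # face i \<tau>" if "i < length \<tau>" for i
    proof -
      have "length \<tau> - i = Suc (length \<tau> - Suc i)" "Suc (length \<tau>) - i = Suc (length \<tau> - i)" using that by auto
      then show ?thesis by (simp add: face_def)
    qed
    then have "(\<Sum>i<length (v # \<tau>). frag_cmul ((- 1) ^ i) (frag_of (face i (v # \<tau>)))) =
        cone v (\<Sum>i<length \<tau>. frag_cmul ((- 1) ^ i) (frag_of (face i \<tau>))) + frag_cmul ((- 1) ^ length \<tau>) (frag_of \<tau>)"
      by (simp add: cone_sum face_def)
    then show ?thesis using Cons False by (simp add: signed_boundary_Cons)
  qed
qed simp

text \<open>
  When the vertices of a list have distinct colours \<open>\<kappa>\<close>, a list that carries all colours but \<open>j\<close>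
  can arise only by deleting the vertex of colour \<open>j\<close>, so no two faces coincide and the
  coefficient is a single sign.
\<close>

lemma lookup_boundary:
  assumes "distinct (map \<kappa> \<sigma>)" "map \<kappa> \<sigma> = map \<kappa> us @ j # map \<kappa> vs"
  shows "lookup (boundary \<sigma>) (us @ vs) = (if \<exists>y. \<sigma> = us @ y # vs then (- 1) ^ length us else 0)"
  using assms
proof (induction us arbitrary: \<sigma>)
  case Nil
  then obtain y \<tau> where s: "\<sigma> = y # \<tau>" "map \<kappa> \<tau> = map \<kappa> vs" "\<kappa> y = j"
    by (cases \<sigma>) auto
  then have "\<kappa> y \<notin> set (map \<kappa> vs)" using Nil by simp
  then have "y \<notin> set vs" by auto
  then have "lookup (cone y (boundary \<tau>)) vs = 0"
    by (auto simp: lookup_cone split: list.splits)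
  then show ?case using s by (auto simp: lookup_minus)
next
  case (Cons u us)
  then obtain w \<tau> where s: "\<sigma> = w # \<tau>" "map \<kappa> \<tau> = map \<kappa> us @ j # map \<kappa> vs" "\<kappa> w = \<kappa> u"
    by (cases \<sigma>) auto
  have "\<kappa> u \<notin> set (map \<kappa> \<tau>)" using Cons s by simp
  then have "\<tau> \<noteq> u # us @ vs" by auto
  moreover have "lookup (boundary \<tau>) (us @ vs) = (if \<exists>y. \<tau> = us @ y # vs then (- 1) ^ length us else 0)"
    using Cons s by (intro Cons.IH) auto
  ultimately show ?case using s by (auto simp: lookup_minus lookup_cone)
qed

section \<open>Degeneracies\<close>

text \<open>
  Positions are counted from the head: \<open>degen_at k\<close> says that the entries at positions \<open>k\<close>
  and \<open>k + 1\<close> agree, and \<open>degen_below k\<close> that this happens at some position less than \<open>k\<close>.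
\<close>

fun degen_below :: "nat \<Rightarrow> 'a list \<Rightarrow> bool" where
  "degen_below (Suc k) (v # w # \<tau>) = (v = w \<or> degen_below k (w # \<tau>))"
| "degen_below _ _ = False"

fun degen_at :: "nat \<Rightarrow> 'a list \<Rightarrow> bool" where
  "degen_at 0 (v # w # \<tau>) = (v = w)"
| "degen_at (Suc k) (v # \<tau>) = degen_at k \<tau>"
| "degen_at _ _ = False"

fun duplicate :: "nat \<Rightarrow> 'a list \<Rightarrow> 'a list" where
  "duplicate 0 (v # \<tau>) = v # v # \<tau>"
| "duplicate (Suc k) (v # \<tau>) = v # duplicate k \<tau>"
| "duplicate _ [] = []"

lemma degen_below_0 [simp]: "\<not> degen_below 0 \<sigma>"
  by (cases "(0::nat, \<sigma>)" rule: degen_below.cases) auto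

lemma degen_below_Suc_Cons: "degen_below (Suc k) (v # \<tau>) \<longleftrightarrow> (\<exists>\<tau>'. \<tau> = v # \<tau>') \<or> degen_below k \<tau>"
  by (cases \<tau>; cases k) auto

lemma degen_below_Suc: "degen_below (Suc k) \<sigma> \<longleftrightarrow> degen_below k \<sigma> \<or> degen_at k \<sigma>"
proof (induction k arbitrary: \<sigma>)
  case 0
  show ?case
  proof (cases \<sigma>)
    case (Cons v \<tau>) then show ?thesis by (cases \<tau>) auto
  qed simp
next
  case (Suc k)
  then show ?case by (cases \<sigma>) (auto simp: degen_below_Suc_Cons)
qed

lemma degen_below_mono: "degen_below k \<sigma> \<Longrightarrow> k \<le> l \<Longrightarrow> degen_below l \<sigma>"
  by (induction l) (auto simp: le_Suc_eq degen_below_Suc)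

text \<open>
  Repetitions in a weakly increasing list are adjacent.
\<close>

lemma degen_below_iff:
  fixes \<sigma> :: "'a::order list"
  assumes "sorted_wrt (\<le>) \<sigma>" "length \<sigma> \<le> Suc k"
  shows "degen_below k \<sigma> \<longleftrightarrow> \<not> sorted_wrt (<) \<sigma>"
  using assms
proof (induction k arbitrary: \<sigma>)
  case 0 then show ?case by (cases \<sigma>) auto
next
  case (Suc k)
  show ?case
  proof (cases \<sigma>)
    case (Cons v \<tau>)
    have "degen_below k \<tau> \<longleftrightarrow> \<not> sorted_wrt (<) \<tau>" using Suc Cons by auto
    moreover have "(\<exists>\<tau>'. \<tau> = v # \<tau>') \<longleftrightarrow> v \<in> set \<tau>"
      using Suc.prems Cons by (cases \<tau>) (auto dest: order_antisym)
    moreover have "(\<forall>w\<in>set \<tau>. v < w) \<longleftrightarrow> v \<notin> set \<tau>"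
      using Suc.prems Cons by (auto simp: order.strict_iff_order)
    ultimately show ?thesis using Cons by (auto simp: degen_below_Suc_Cons)
  qed simp
qed

text \<open>
  The two faces that delete one of two equal adjacent entries cancel, and every other face keeps
  the repetition at the same position or one step to the left.
\<close>

lemma keys_boundary_degen_below:
  assumes "degen_below k \<sigma>"
  shows "keys (boundary \<sigma>) \<subseteq> Collect (degen_below k)"
  using assms
proof (induction k arbitrary: \<sigma>)
  case (Suc k)
  then obtain v \<tau> where s: "\<sigma> = v # \<tau>" by (cases \<sigma>) auto
  show ?case
  proof (cases "\<exists>\<tau>'. \<tau> = v # \<tau>'")
    case True
    then obtain \<tau>' where t: "\<tau> = v # \<tau>'" by blast
    have "keys (cone v (cone v (boundary \<tau>'))) \<subseteq> Collect (degen_below (Suc k))"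
      by auto
    then show ?thesis using s t by simp
  next
    case False
    then have "degen_below k \<tau>" using Suc s by (simp add: degen_below_Suc_Cons)
    then have "insert \<tau> ((#) v ` keys (boundary \<tau>)) \<subseteq> Collect (degen_below (Suc k))"
      using Suc.IH[of \<tau>] degen_below_mono[of k \<tau> "Suc k"] by (auto simp: degen_below_Suc_Cons)
    then show ?thesis
      unfolding s using keys_boundary_Cons[of v \<tau>] by (rule order_trans[rotated])
  qed
qed simp

definition dup_chain :: "nat \<Rightarrow> ('a list \<Rightarrow>\<^sub>0 int) \<Rightarrow> ('a list \<Rightarrow>\<^sub>0 int)" where
  "dup_chain k = frag_extend (\<lambda>\<tau>. frag_of (duplicate k \<tau>))"

lemma dup_chain_simps [simp]:
  "dup_chain k 0 = 0" "dup_chain k (frag_of \<tau>) = frag_of (duplicate k \<tau>)" "dup_chain k (c - d) = dup_chain k c - dup_chain k d"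
  by (simp_all add: dup_chain_def frag_extend_diff)

lemma dup_chain_Suc_cone [simp]: "dup_chain (Suc k) (cone v c) = cone v (dup_chain k c)"
proof (induction c rule: frag_induct)
  case (diff a b) then show ?case by simp
qed auto

lemma dup_chain_0_cone [simp]: "dup_chain 0 (cone v c) = cone v (cone v c)"
proof (induction c rule: frag_induct)
  case (diff a b) then show ?case by simp
qed auto

lemma degen_below_duplicate: "degen_below k \<sigma> \<Longrightarrow> degen_below k (duplicate k \<sigma>)"
proof (induction k arbitrary: \<sigma>)
  case (Suc k)
  then obtain v \<tau> where s: "\<sigma> = v # \<tau>" by (cases \<sigma>) auto
  with Suc show ?case by (cases k) (auto simp: degen_below_Suc_Cons)
qed simp

lemma degen_below_Suc_duplicate: "k < length \<sigma> \<Longrightarrow> degen_below (Suc k) (duplicate k \<sigma>)"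
proof (induction k arbitrary: \<sigma>)
  case 0 then show ?case by (cases \<sigma>) auto
next
  case (Suc k) then show ?case by (cases \<sigma>) (auto simp: degen_below_Suc_Cons)
qed

lemma keys_cone_degen_below: "keys c \<subseteq> Collect (degen_below k) \<Longrightarrow> keys (cone v c) \<subseteq> Collect (degen_below (Suc k))"
  by (auto simp: degen_below_Suc_Cons)

text \<open>
  Once a cochain vanishes on chains degenerate below \<open>k\<close>, the correction with the \<open>k\<close>-th
  duplication does not spoil this.
\<close>

lemma keys_dup_chain_boundary:
  assumes "degen_below k \<sigma>"
  shows "keys (dup_chain k (boundary \<sigma>)) \<subseteq> Collect (degen_below k)"
  using assms
proof (induction k arbitrary: \<sigma>)
  case (Suc k)
  then obtain v \<tau> where s: "\<sigma> = v # \<tau>" by (cases \<sigma>) auto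
  show ?case
  proof (cases "\<exists>\<tau>'. \<tau> = v # \<tau>'")
    case True
    then obtain \<tau>' where t: "\<tau> = v # \<tau>'" by blast
    have "keys (cone v (dup_chain k (cone v (boundary \<tau>')))) \<subseteq> Collect (degen_below (Suc k))"
    proof (cases k)
      case 0
      then show ?thesis by auto
    next
      case (Suc k')
      then show ?thesis by auto
    qed
    then show ?thesis using s t by simp
  next
    case False
    then have d: "degen_below k \<tau>" using Suc s by (simp add: degen_below_Suc_Cons)
    then obtain k' where k': "k = Suc k'" by (cases k) auto
    have "degen_below (Suc k) (duplicate (Suc k) \<tau>)"
      using degen_below_mono[OF d, of "Suc k"] by (intro degen_below_duplicate) simp
    moreover have "keys (cone v (dup_chain k (boundary \<tau>))) \<subseteq> Collect (degen_below (Suc k))"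
      using Suc.IH[OF d] by (rule keys_cone_degen_below)
    ultimately have "keys (frag_of (duplicate (Suc k) \<tau>) - cone v (dup_chain k (boundary \<tau>))) \<subseteq> Collect (degen_below (Suc k))"
      by (intro keys_diff_subset) auto
    then show ?thesis using s by simp
  qed
qed simp

text \<open>
  The operator that duplicates the entry at position \<open>k\<close> is a contracting homotopy, up to the
  sign \<open>(-1)^k\<close>, on lists with a repetition at \<open>k\<close>, modulo lists degenerate below \<open>k\<close>.
\<close>

lemma keys_duplicate_homotopy:
  assumes "degen_at k \<sigma>"
  shows "keys (dup_chain k (boundary \<sigma>) + boundary (duplicate k \<sigma>) - frag_cmul ((- 1) ^ k) (frag_of \<sigma>)) \<subseteq> Collect (degen_below k)"
  using assms
proof (induction k arbitrary: \<sigma>)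
  case 0
  then obtain v \<tau> where "\<sigma> = v # v # \<tau>"
    by (cases \<sigma> rule: remdups_adj.cases) auto
  then show ?case by simp
next
  case (Suc k)
  then obtain v \<tau> where s: "\<sigma> = v # \<tau>" "degen_at k \<tau>" by (cases \<sigma>) auto
  let ?e = "dup_chain k (boundary \<tau>) + boundary (duplicate k \<tau>) - frag_cmul ((- 1) ^ k) (frag_of \<tau>)"
  have eq: "dup_chain (Suc k) (boundary \<sigma>) + boundary (duplicate (Suc k) \<sigma>) - frag_cmul ((- 1) ^ Suc k) (frag_of \<sigma>) =
      frag_of (duplicate (Suc k) \<tau>) + frag_of (duplicate k \<tau>) - cone v ?e"
    using s by (simp flip: minus_frag_cmul)
  have "degen_below (Suc k) \<tau>" using s by (simp add: degen_below_Suc)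
  then have "degen_below (Suc k) (duplicate (Suc k) \<tau>)" by (rule degen_below_duplicate)
  moreover have "degen_below (Suc k) (duplicate k \<tau>)"
  proof (rule degen_below_Suc_duplicate)
    show "k < length \<tau>" using s(2) by (induction k \<tau> rule: degen_at.induct) auto
  qed
  moreover have "keys (cone v ?e) \<subseteq> Collect (degen_below (Suc k))"
    using Suc.IH[OF s(2)] by (rule keys_cone_degen_below)
  ultimately show ?case
    unfolding eq by (intro keys_diff_subset keys_add_subset) auto
qed

section \<open>Cochains with values in a presheaf\<close>

lemma (in comm_group) subgroup_comm_group:
  assumes "subgroup H G"
  shows "comm_group (G\<lparr>carrier := H\<rparr>)"
proof -
  interpret H: group "G\<lparr>carrier := H\<rparr>" using assms by (rule subgroup_imp_group)
  show ?thesis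
    using subgroup.subset[OF assms] by (intro H.group_comm_groupI) (auto intro!: m_comm)
qed

lemma simplices_nonempty: "\<sigma> \<in> simplices n Q \<Longrightarrow> \<sigma> \<noteq> []"
  by (auto simp: simplices_def)

lemma hd_simplex: "\<sigma> \<in> simplices n Q \<Longrightarrow> hd \<sigma> \<in> Q"
  by (cases \<sigma>) (auto simp: simplices_def)

lemma hd_le_simplex: "\<sigma> \<in> simplices n Q \<Longrightarrow> v \<in> set \<sigma> \<Longrightarrow> hd \<sigma> \<le> v"
  by (cases \<sigma>) (auto simp: simplices_def)

lemma simplices_mono: "Q \<subseteq> Q' \<Longrightarrow> simplices n Q \<subseteq> simplices n Q'"
  by (auto simp: simplices_def)

lemma face_simplex:
  assumes "\<sigma> \<in> simplices (Suc n) Q" "i \<le> Suc n"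
  shows "face i \<sigma> \<in> simplices n Q"
proof -
  let ?k = "length \<sigma> - Suc i"
  have l: "length \<sigma> = Suc (Suc n)" using assms by (simp add: simplices_def)
  then have k: "?k < length \<sigma>" "length \<sigma> - i = Suc ?k" using assms by auto
  have "sorted_wrt (\<le>) (take ?k \<sigma> @ \<sigma> ! ?k # drop (Suc ?k) \<sigma>)"
    using assms k by (simp add: simplices_def flip: id_take_nth_drop)
  then have "sorted_wrt (\<le>) (face i \<sigma>)"
    unfolding face_def k(2) by (simp add: sorted_wrt_append)
  moreover have "set (face i \<sigma>) \<subseteq> set \<sigma>"
    by (auto simp: face_def dest: in_set_takeD in_set_dropD)
  ultimately show ?thesis
    using assms l by (auto simp: simplices_def face_def)
qed

lemma hd_face: "\<sigma> \<in> simplices (Suc n) Q \<Longrightarrow> i \<le> n \<Longrightarrow> hd (face i \<sigma>) = hd \<sigma>"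
  by (cases \<sigma>) (auto simp: face_def simplices_def hd_append take_Cons split: nat.splits)

text \<open>
  The simplices \<open>\<tau>\<close> on which a cochain value can be transported from \<open>F (hd \<tau>)\<close> to \<open>F x\<close>.
\<close>

definition simplices_above :: "'a::order \<Rightarrow> nat \<Rightarrow> 'a set \<Rightarrow> 'a list set" where
  "simplices_above x n Q = {\<tau> \<in> simplices n Q. x \<le> hd \<tau>}"

lemma face_simplices_above:
  assumes "\<sigma> \<in> simplices (Suc n) Q" "i \<le> Suc n"
  shows "face i \<sigma> \<in> simplices_above (hd \<sigma>) n Q"
proof -
  have "face i \<sigma> \<in> simplices n Q" by (rule face_simplex[OF assms])
  moreover have "set (face i \<sigma>) \<subseteq> set \<sigma>"
    by (auto simp: face_def dest: in_set_takeD in_set_dropD)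
  ultimately show ?thesis
    using hd_le_simplex[OF assms(1)] simplices_nonempty hd_in_set unfolding simplices_above_def by blast
qed

lemma keys_boundary_simplex:
  assumes "\<sigma> \<in> simplices (Suc n) Q"
  shows "keys (boundary \<sigma>) \<subseteq> simplices_above (hd \<sigma>) n Q"
proof
  fix \<tau> assume t: "\<tau> \<in> keys (boundary \<sigma>)"
  have "\<tau> \<in> simplices n Q"
    using length_keys_boundary[OF t] subseq_keys_boundary[OF t, of "(\<le>)"] assms by (auto simp: simplices_def)
  moreover from this have "hd \<sigma> \<le> hd \<tau>"
    using subseq_keys_boundary[OF t] hd_le_simplex[OF assms] simplices_nonempty hd_in_set by blast
  ultimately show "\<tau> \<in> simplices_above (hd \<sigma>) n Q" by (simp add: simplices_above_def)
qed

lemma keys_signed_boundary_simplex: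
  assumes "\<sigma> \<in> simplices (Suc n) Q"
  shows "keys (signed_boundary \<sigma>) \<subseteq> simplices_above (hd \<sigma>) n Q"
  using keys_boundary_simplex[OF assms] by (simp add: keys_signed_boundary)

lemma simplices_above_trans: "x \<le> y \<Longrightarrow> simplices_above y n Q \<subseteq> simplices_above x n Q"
  by (auto simp: simplices_above_def)

lemma hd_duplicate: "\<tau> \<noteq> [] \<Longrightarrow> hd (duplicate k \<tau>) = hd \<tau>"
  by (induction k \<tau> rule: duplicate.induct) auto

lemma set_duplicate: "set (duplicate k \<tau>) = set \<tau>"
  by (induction k \<tau> rule: duplicate.induct) auto

lemma length_duplicate: "k < length \<tau> \<Longrightarrow> length (duplicate k \<tau>) = Suc (length \<tau>)"
  by (induction k \<tau> rule: duplicate.induct) auto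

lemma sorted_duplicate: "sorted_wrt (\<le>) \<tau> \<Longrightarrow> sorted_wrt (\<le>) (duplicate k \<tau>)" for \<tau> :: "'a::order list"
  by (induction k \<tau> rule: duplicate.induct) (auto simp: set_duplicate)

lemma duplicate_simplex: "\<tau> \<in> simplices m Q \<Longrightarrow> k \<le> m \<Longrightarrow> duplicate k \<tau> \<in> simplices (Suc m) Q"
  by (auto simp: simplices_def set_duplicate sorted_duplicate length_duplicate)

lemma keys_dup_chain:
  assumes "keys c \<subseteq> simplices_above x m Q" "k \<le> m"
  shows "keys (dup_chain k c) \<subseteq> simplices_above x (Suc m) Q"
proof -
  have "keys (dup_chain k c) \<subseteq> (\<Union>\<tau>\<in>keys c. {duplicate k \<tau>})"
    using keys_frag_extend[of "\<lambda>\<tau>. frag_of (duplicate k \<tau>)" c] by (simp add: dup_chain_def)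
  also have "\<dots> \<subseteq> simplices_above x (Suc m) Q"
  proof safe
    fix \<tau> assume "\<tau> \<in> keys c"
    then have t: "\<tau> \<in> simplices m Q" "x \<le> hd \<tau>"
      using assms(1) by (auto simp: simplices_above_def)
    then show "duplicate k \<tau> \<in> simplices_above x (Suc m) Q"
      using duplicate_simplex[OF t(1) assms(2)] hd_duplicate[OF simplices_nonempty[OF t(1)]] by (simp add: simplices_above_def)
  qed
  finally show ?thesis .
qed

context presheaf
begin

text \<open>
  A cochain \<open>s\<close> viewed from \<open>x\<close>: its values on simplices above \<open>x\<close> are restricted to the single
  group \<open>F x\<close> and extended linearly, so that chain-level identities apply.
\<close>

definition ev :: "'a \<Rightarrow> ('a list \<Rightarrow> 'b) \<Rightarrow> ('a list \<Rightarrow>\<^sub>0 int) \<Rightarrow> 'b" where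
  "ev x s = lin (F x) (\<lambda>\<tau>. \<rho> (hd \<tau>) x (s \<tau>))"

lemma comm_group_cochains: "Q \<subseteq> P \<Longrightarrow> comm_group (cochains F Q n)"
  unfolding cochains_def by (rule comm_group_product_group) (use comm_group_at hd_simplex in blast)

lemma cochain_apply: "s \<in> carrier (cochains F Q n) \<Longrightarrow> \<sigma> \<in> simplices n Q \<Longrightarrow> s \<sigma> \<in> carrier (F (hd \<sigma>))"
  unfolding cochains_def by auto

lemma ev_terms:
  assumes "Q \<subseteq> P" "s \<in> carrier (cochains F Q n)" "x \<in> P"
  shows "(\<lambda>\<tau>. \<rho> (hd \<tau>) x (s \<tau>)) \<in> simplices_above x n Q \<rightarrow> carrier (F x)"
proof
  fix \<tau> assume "\<tau> \<in> simplices_above x n Q"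
  then have t: "\<tau> \<in> simplices n Q" "x \<le> hd \<tau>" by (auto simp: simplices_above_def)
  with assms hd_simplex have "hd \<tau> \<in> P" by blast
  then show "\<rho> (hd \<tau>) x (s \<tau>) \<in> carrier (F x)"
    using map_hom[OF assms(3) _ t(2)] cochain_apply[OF assms(2) t(1)] by (blast intro: hom_in_carrier)
qed

lemma ev_closed:
  assumes "Q \<subseteq> P" "s \<in> carrier (cochains F Q n)" "x \<in> P" "keys c \<subseteq> simplices_above x n Q"
  shows "ev x s c \<in> carrier (F x)"
  unfolding ev_def
  by (rule comm_group.lin_closed[OF comm_group_at[OF assms(3)]]) (use ev_terms[OF assms(1-3)] assms(4) in blast)

text \<open>
  The restriction map in the last term of the codifferential is built into \<open>ev\<close>; in the other
  terms the face still starts at \<open>hd \<sigma>\<close>, and the restriction map is the identity.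
\<close>

lemma codiff_eq:
  assumes "Q \<subseteq> P" "s \<in> carrier (cochains F Q n)" "\<sigma> \<in> simplices (Suc n) Q"
  shows "codiff F \<rho> Q n s \<sigma> = ev (hd \<sigma>) s (signed_boundary \<sigma>)"
proof -
  let ?x = "hd \<sigma>"
  have x: "?x \<in> P" using assms hd_simplex by blast
  interpret G: comm_group "F ?x" by (rule comm_group_at[OF x])
  let ?f = "\<lambda>\<tau>. \<rho> (hd \<tau>) ?x (s \<tau>)"
  have f: "?f (face i \<sigma>) \<in> carrier (F ?x)" if "i \<le> Suc n" for i
    using ev_terms[OF assms(1,2) x] face_simplices_above[OF assms(3) that] by blast
  have f': "?f (face i \<sigma>) = s (face i \<sigma>)" if "i \<le> n" for i
    using map_id[OF x] cochain_apply[OF assms(2) face_simplex[OF assms(3)], of i] that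
    by (simp add: hd_face[OF assms(3)])
  have l: "length \<sigma> = Suc (Suc n)" "\<sigma> \<noteq> []" using assms by (auto simp: simplices_def)
  have "ev ?x s (signed_boundary \<sigma>) = finprod (F ?x) (\<lambda>i. lin (F ?x) ?f (frag_cmul ((- 1) ^ i) (frag_of (face i \<sigma>)))) {..<Suc (Suc n)}"
    unfolding ev_def signed_boundary_eq_sum_faces[OF l(2)] l(1) using f
    by (intro G.lin_sum) auto
  also have "\<dots> = finprod (F ?x) (\<lambda>i. ?f (face i \<sigma>) [^]\<^bsub>F ?x\<^esub> ((- 1) ^ i :: int)) {..<Suc (Suc n)}"
    using f by (intro G.finprod_cong') (auto simp: G.lin_cmul G.lin_frag_of)
  also have "{..<Suc (Suc n)} = insert (Suc n) {0..n}" by auto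
  also have "finprod (F ?x) (\<lambda>i. ?f (face i \<sigma>) [^]\<^bsub>F ?x\<^esub> ((- 1) ^ i :: int)) (insert (Suc n) {0..n}) =
      ?f (face (Suc n) \<sigma>) [^]\<^bsub>F ?x\<^esub> ((- 1) ^ Suc n :: int) \<otimes>\<^bsub>F ?x\<^esub>
      finprod (F ?x) (\<lambda>i. ?f (face i \<sigma>) [^]\<^bsub>F ?x\<^esub> ((- 1) ^ i :: int)) {0..n}"
    using f by (intro G.finprod_insert) auto
  also have "finprod (F ?x) (\<lambda>i. ?f (face i \<sigma>) [^]\<^bsub>F ?x\<^esub> ((- 1) ^ i :: int)) {0..n} =
      finprod (F ?x) (\<lambda>i. s (face i \<sigma>) [^]\<^bsub>F ?x\<^esub> ((- 1) ^ i :: int)) {0..n}"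
  proof (rule G.finprod_cong')
    show "(\<lambda>i. s (face i \<sigma>) [^]\<^bsub>F ?x\<^esub> ((- 1) ^ i :: int)) \<in> {0..n} \<rightarrow> carrier (F ?x)"
      using f f' by (metis (no_types, lifting) G.int_pow_closed Pi_I atLeastAtMost_iff le_Suc_eq)
  qed (auto simp: f')
  finally have "ev ?x s (signed_boundary \<sigma>) = ?f (face (Suc n) \<sigma>) [^]\<^bsub>F ?x\<^esub> ((- 1) ^ Suc n :: int) \<otimes>\<^bsub>F ?x\<^esub>
      finprod (F ?x) (\<lambda>i. s (face i \<sigma>) [^]\<^bsub>F ?x\<^esub> ((- 1) ^ i :: int)) {0..n}" .
  moreover have "finprod (F ?x) (\<lambda>i. s (face i \<sigma>) [^]\<^bsub>F ?x\<^esub> ((- 1) ^ i :: int)) {0..n} \<in> carrier (F ?x)"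
    using f f' by (intro G.finprod_closed) (metis (no_types, lifting) G.int_pow_closed Pi_I atLeastAtMost_iff le_Suc_eq)
  ultimately show ?thesis
    using assms(3) f[of "Suc n"] by (simp add: codiff_def G.m_comm del: power_Suc)
qed

lemma codiff_closed:
  assumes "Q \<subseteq> P" "s \<in> carrier (cochains F Q n)"
  shows "codiff F \<rho> Q n s \<in> carrier (cochains F Q (Suc n))"
proof -
  have "codiff F \<rho> Q n s \<sigma> \<in> carrier (F (hd \<sigma>))" if "\<sigma> \<in> simplices (Suc n) Q" for \<sigma>
    unfolding codiff_eq[OF assms that]
    using hd_simplex[OF that] assms(1) keys_signed_boundary_simplex[OF that] by (intro ev_closed[OF assms]) auto
  moreover have "codiff F \<rho> Q n s \<in> extensional (simplices (Suc n) Q)"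
    by (simp add: codiff_def)
  ultimately show ?thesis by (simp add: cochains_def PiE_iff)
qed

lemma cochain_mult_apply: "\<sigma> \<in> simplices n Q \<Longrightarrow> (s \<otimes>\<^bsub>cochains F Q n\<^esub> t) \<sigma> = s \<sigma> \<otimes>\<^bsub>F (hd \<sigma>)\<^esub> t \<sigma>"
  by (simp add: cochains_def)

lemma cochain_eqI:
  assumes "s \<in> carrier (cochains F Q n)" "t \<in> carrier (cochains F Q n)"
    "\<And>\<sigma>. \<sigma> \<in> simplices n Q \<Longrightarrow> s \<sigma> = t \<sigma>"
  shows "s = t"
  using assms unfolding cochains_def by (auto intro: PiE_ext)

lemma codiff_hom:
  assumes "Q \<subseteq> P"
  shows "codiff F \<rho> Q n \<in> hom (cochains F Q n) (cochains F Q (Suc n))"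
proof (rule homI)
  fix s t assume st: "s \<in> carrier (cochains F Q n)" "t \<in> carrier (cochains F Q n)"
  interpret C: comm_group "cochains F Q n" by (rule comm_group_cochains[OF assms])
  interpret C': comm_group "cochains F Q (Suc n)" by (rule comm_group_cochains[OF assms])
  have st': "s \<otimes>\<^bsub>cochains F Q n\<^esub> t \<in> carrier (cochains F Q n)" using st by (rule C.m_closed)
  show "codiff F \<rho> Q n (s \<otimes>\<^bsub>cochains F Q n\<^esub> t) =
      codiff F \<rho> Q n s \<otimes>\<^bsub>cochains F Q (Suc n)\<^esub> codiff F \<rho> Q n t"
  proof (rule cochain_eqI[OF codiff_closed[OF assms st'] C'.m_closed[OF codiff_closed[OF assms st(1)] codiff_closed[OF assms st(2)]]])
    fix \<sigma> assume s: "\<sigma> \<in> simplices (Suc n) Q"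
    then have x: "hd \<sigma> \<in> P" using assms hd_simplex by blast
    interpret G: comm_group "F (hd \<sigma>)" by (rule comm_group_at[OF x])
    have fs: "(\<lambda>\<tau>. \<rho> (hd \<tau>) (hd \<sigma>) (s \<tau>)) \<in> keys (signed_boundary \<sigma>) \<rightarrow> carrier (F (hd \<sigma>))"
      and ft: "(\<lambda>\<tau>. \<rho> (hd \<tau>) (hd \<sigma>) (t \<tau>)) \<in> keys (signed_boundary \<sigma>) \<rightarrow> carrier (F (hd \<sigma>))"
      using ev_terms[OF assms st(1) x] ev_terms[OF assms st(2) x] keys_signed_boundary_simplex[OF s] by blast+
    have "ev (hd \<sigma>) (s \<otimes>\<^bsub>cochains F Q n\<^esub> t) (signed_boundary \<sigma>) =
        lin (F (hd \<sigma>)) (\<lambda>\<tau>. \<rho> (hd \<tau>) (hd \<sigma>) (s \<tau>) \<otimes>\<^bsub>F (hd \<sigma>)\<^esub> \<rho> (hd \<tau>) (hd \<sigma>) (t \<tau>)) (signed_boundary \<sigma>)"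
      unfolding ev_def
    proof (rule G.lin_cong)
      fix \<tau> assume "\<tau> \<in> keys (signed_boundary \<sigma>)"
      then have t: "\<tau> \<in> simplices n Q" "hd \<sigma> \<le> hd \<tau>"
        using keys_signed_boundary_simplex[OF s] by (auto simp: simplices_above_def)
      then have "hd \<tau> \<in> P" using assms hd_simplex by blast
      then show "\<rho> (hd \<tau>) (hd \<sigma>) ((s \<otimes>\<^bsub>cochains F Q n\<^esub> t) \<tau>) =
          \<rho> (hd \<tau>) (hd \<sigma>) (s \<tau>) \<otimes>\<^bsub>F (hd \<sigma>)\<^esub> \<rho> (hd \<tau>) (hd \<sigma>) (t \<tau>)"
        unfolding cochain_mult_apply[OF t(1)]
        using hom_mult[OF map_hom[OF x _ t(2)]] cochain_apply[OF st(1) t(1)] cochain_apply[OF st(2) t(1)] by blast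
    qed (use fs ft in auto)
    also have "\<dots> = ev (hd \<sigma>) s (signed_boundary \<sigma>) \<otimes>\<^bsub>F (hd \<sigma>)\<^esub> ev (hd \<sigma>) t (signed_boundary \<sigma>)"
      unfolding ev_def by (rule G.lin_mult_fun[OF fs ft])
    finally show "codiff F \<rho> Q n (s \<otimes>\<^bsub>cochains F Q n\<^esub> t) \<sigma> =
        (codiff F \<rho> Q n s \<otimes>\<^bsub>cochains F Q (Suc n)\<^esub> codiff F \<rho> Q n t) \<sigma>"
      using s by (simp add: cochain_mult_apply codiff_eq[OF assms] st st')
  qed
qed (rule codiff_closed[OF assms])

text \<open>
  Functoriality of the presheaf allows both restrictions to be carried out in one step.
\<close>

lemma ev_codiff:
  assumes "Q \<subseteq> P" "s \<in> carrier (cochains F Q n)" "x \<in> P" "keys c \<subseteq> simplices_above x (Suc n) Q"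
  shows "ev x (codiff F \<rho> Q n s) c = ev x s (frag_extend signed_boundary c)"
proof -
  interpret G: comm_group "F x" by (rule comm_group_at[OF assms(3)])
  have keys_signed_boundary_above: "keys (signed_boundary \<tau>) \<subseteq> simplices_above x n Q" if "\<tau> \<in> keys c" for \<tau>
    using that assms(4) keys_signed_boundary_simplex[of \<tau> n Q] simplices_above_trans[of x "hd \<tau>" n Q]
    by (auto simp: simplices_above_def)
  have "ev x (codiff F \<rho> Q n s) c = lin (F x) (\<lambda>\<tau>. ev x s (signed_boundary \<tau>)) c"
    unfolding ev_def[of x "codiff F \<rho> Q n s"]
  proof (rule G.lin_cong)
    fix \<tau> assume "\<tau> \<in> keys c"
    then have t: "\<tau> \<in> simplices (Suc n) Q" "x \<le> hd \<tau>"
      using assms(4) by (auto simp: simplices_above_def)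
    then have y: "hd \<tau> \<in> P" using assms hd_simplex by blast
    have f: "(\<lambda>\<upsilon>. \<rho> (hd \<upsilon>) (hd \<tau>) (s \<upsilon>)) \<in> keys (signed_boundary \<tau>) \<rightarrow> carrier (F (hd \<tau>))"
      using ev_terms[OF assms(1,2) y] keys_signed_boundary_simplex[OF t(1)] by blast
    have "\<rho> (hd \<tau>) x (codiff F \<rho> Q n s \<tau>) = lin (F x) (\<lambda>\<upsilon>. \<rho> (hd \<tau>) x (\<rho> (hd \<upsilon>) (hd \<tau>) (s \<upsilon>))) (signed_boundary \<tau>)"
      unfolding codiff_eq[OF assms(1,2) t(1)] ev_def
      by (rule comm_group.hom_lin[OF comm_group_at[OF y] G.comm_group_axioms map_hom[OF assms(3) y t(2)] f])
    also have "\<dots> = ev x s (signed_boundary \<tau>)"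
      unfolding ev_def
    proof (rule G.lin_cong)
      fix \<upsilon> assume "\<upsilon> \<in> keys (signed_boundary \<tau>)"
      then have u: "\<upsilon> \<in> simplices n Q" "hd \<tau> \<le> hd \<upsilon>"
        using keys_signed_boundary_simplex[OF t(1)] by (auto simp: simplices_above_def)
      then have z: "hd \<upsilon> \<in> P" using assms hd_simplex by blast
      show "\<rho> (hd \<tau>) x (\<rho> (hd \<upsilon>) (hd \<tau>) (s \<upsilon>)) = \<rho> (hd \<upsilon>) x (s \<upsilon>)"
        by (rule map_comp[OF assms(3) y z t(2) u(2) cochain_apply[OF assms(2) u(1)]])
    qed (use ev_terms[OF assms(1-3)] keys_signed_boundary_above[OF \<open>\<tau> \<in> keys c\<close>] in blast)
    finally show "\<rho> (hd \<tau>) x (codiff F \<rho> Q n s \<tau>) = ev x s (signed_boundary \<tau>)" .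
  qed (use ev_closed[OF assms(1-3)] keys_signed_boundary_above in blast)
  also have "\<dots> = ev x s (frag_extend signed_boundary c)"
    unfolding ev_def
    by (rule G.lin_frag_extend[symmetric, OF ev_terms[OF assms(1-3)] keys_signed_boundary_above])
  finally show ?thesis .
qed

lemma codiff_codiff:
  assumes "Q \<subseteq> P" "s \<in> carrier (cochains F Q n)"
  shows "codiff F \<rho> Q (Suc n) (codiff F \<rho> Q n s) = \<one>\<^bsub>cochains F Q (Suc (Suc n))\<^esub>"
proof (rule cochain_eqI)
  fix \<sigma> assume s: "\<sigma> \<in> simplices (Suc (Suc n)) Q"
  then have x: "hd \<sigma> \<in> P" using assms hd_simplex by blast
  interpret G: comm_group "F (hd \<sigma>)" by (rule comm_group_at[OF x])
  have "codiff F \<rho> Q (Suc n) (codiff F \<rho> Q n s) \<sigma> = ev (hd \<sigma>) s (frag_extend signed_boundary (signed_boundary \<sigma>))"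
    using codiff_eq[OF assms(1) codiff_closed[OF assms] s] ev_codiff[OF assms x keys_signed_boundary_simplex[OF s]] by simp
  also have "\<dots> = \<one>\<^bsub>F (hd \<sigma>)\<^esub>"
    by (simp add: signed_boundary_signed_boundary ev_def)
  finally show "codiff F \<rho> Q (Suc n) (codiff F \<rho> Q n s) \<sigma> = \<one>\<^bsub>cochains F Q (Suc (Suc n))\<^esub> \<sigma>"
    using s by (simp add: cochains_def)
next
  show "\<one>\<^bsub>cochains F Q (Suc (Suc n))\<^esub> \<in> carrier (cochains F Q (Suc (Suc n)))"
    using comm_group_cochains[OF assms(1)] by (simp add: comm_group.axioms monoid.one_closed comm_monoid.axioms)
qed (intro codiff_closed assms)

lemma cochain_restrict_closed:
  "Y \<subseteq> X \<Longrightarrow> s \<in> carrier (cochains F X n) \<Longrightarrow> cochain_restrict Y n s \<in> carrier (cochains F Y n)"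
  using simplices_mono[of Y X n] by (auto simp: cochain_restrict_def cochains_def PiE_iff)

lemma cochain_restrict_hom:
  assumes "Y \<subseteq> X"
  shows "cochain_restrict Y n \<in> hom (cochains F X n) (cochains F Y n)"
proof (rule homI)
  fix s t assume "s \<in> carrier (cochains F X n)" "t \<in> carrier (cochains F X n)"
  show "cochain_restrict Y n (s \<otimes>\<^bsub>cochains F X n\<^esub> t) =
      cochain_restrict Y n s \<otimes>\<^bsub>cochains F Y n\<^esub> cochain_restrict Y n t"
    using simplices_mono[OF assms, of n] by (intro ext) (auto simp: cochain_restrict_def cochains_def)
qed (rule cochain_restrict_closed[OF assms])

lemma codiff_restrict:
  assumes "Y \<subseteq> X" "X \<subseteq> P" "s \<in> carrier (cochains F X n)" "\<sigma> \<in> simplices (Suc n) Y"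
  shows "codiff F \<rho> X n s \<sigma> = codiff F \<rho> Y n (cochain_restrict Y n s) \<sigma>"
proof -
  have x: "hd \<sigma> \<in> P" using assms hd_simplex by blast
  interpret G: comm_group "F (hd \<sigma>)" by (rule comm_group_at[OF x])
  have s: "\<sigma> \<in> simplices (Suc n) X" using assms simplices_mono by blast
  have Y: "Y \<subseteq> P" using assms by blast
  have "ev (hd \<sigma>) s (signed_boundary \<sigma>) = ev (hd \<sigma>) (cochain_restrict Y n s) (signed_boundary \<sigma>)"
    unfolding ev_def
  proof (rule G.lin_cong)
    fix \<tau> assume "\<tau> \<in> keys (signed_boundary \<sigma>)"
    then have "\<tau> \<in> simplices n Y" using keys_signed_boundary_simplex[OF assms(4)] by (auto simp: simplices_above_def)
    then show "\<rho> (hd \<tau>) (hd \<sigma>) (s \<tau>) = \<rho> (hd \<tau>) (hd \<sigma>) (cochain_restrict Y n s \<tau>)"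
      by (simp add: cochain_restrict_def)
  qed (use ev_terms[OF Y cochain_restrict_closed[OF assms(1,3)] x] keys_signed_boundary_simplex[OF assms(4)] in blast)
  then show ?thesis
    using codiff_eq[OF assms(2,3) s] codiff_eq[OF Y cochain_restrict_closed[OF assms(1,3)] assms(4)] by simp
qed

end

section \<open>Relative cocycles and normalisation\<close>

locale presheaf_pair = presheaf P F \<rho>
  for P :: "'a::order set" and F :: "'a \<Rightarrow> 'b monoid" and \<rho> :: "'a \<Rightarrow> 'a \<Rightarrow> 'b \<Rightarrow> 'b" +
  fixes X Y :: "'a set"
  assumes YX: "Y \<subseteq> X" and XP: "X \<subseteq> P"
begin

abbreviation "RC n \<equiv> rel_cochains F X Y n"
abbreviation "RZ n \<equiv> rel_cocycles F \<rho> X Y n"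
abbreviation "RB n \<equiv> rel_coboundaries F \<rho> X Y n"
abbreviation "dX n \<equiv> codiff F \<rho> X n"

lemma YP: "Y \<subseteq> P"
  using YX XP by blast

sublocale CX: comm_group "cochains F X n" for n
  by (rule comm_group_cochains[OF XP])

sublocale res: group_hom "cochains F X n" "cochains F Y n" "cochain_restrict Y n" for n
  using comm_group.axioms(2)[OF comm_group_cochains[OF YP]] cochain_restrict_hom[OF YX] CX.is_group
  by (simp add: group_hom_def group_hom_axioms_def)

sublocale RC: comm_group "rel_cochains F X Y n" for n
  unfolding rel_cochains_def by (rule CX.subgroup_comm_group[OF res.subgroup_kernel])

lemma RC_iff:
  "s \<in> carrier (RC n) \<longleftrightarrow>
     s \<in> carrier (cochains F X n) \<and> (\<forall>\<sigma>\<in>simplices n Y. s \<sigma> = \<one>\<^bsub>F (hd \<sigma>)\<^esub>)"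
  by (auto simp: rel_cochains_def kernel_def cochain_restrict_def cochains_def restrict_def fun_eq_iff)

lemma RC_cochain: "s \<in> carrier (RC n) \<Longrightarrow> s \<in> carrier (cochains F X n)"
  by (simp add: RC_iff)

lemma RC_apply: "s \<in> carrier (RC n) \<Longrightarrow> \<sigma> \<in> simplices n X \<Longrightarrow> s \<sigma> \<in> carrier (F (hd \<sigma>))"
  using cochain_apply RC_cochain by blast

lemma mult_RC [simp]: "(\<otimes>\<^bsub>RC n\<^esub>) = (\<otimes>\<^bsub>cochains F X n\<^esub>)"
  by (simp add: rel_cochains_def)

lemma one_RC [simp]: "\<one>\<^bsub>RC n\<^esub> = \<one>\<^bsub>cochains F X n\<^esub>"
  by (simp add: rel_cochains_def)

lemma group_at: "\<sigma> \<in> simplices n X \<Longrightarrow> comm_group (F (hd \<sigma>))"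
  using comm_group_at hd_simplex XP by blast

lemma codiff_RC_closed:
  assumes "s \<in> carrier (RC n)"
  shows "dX n s \<in> carrier (RC (Suc n))"
proof -
  have s: "s \<in> carrier (cochains F X n)" by (rule RC_cochain[OF assms])
  have "dX n s \<sigma> = \<one>\<^bsub>F (hd \<sigma>)\<^esub>" if sig: "\<sigma> \<in> simplices (Suc n) Y" for \<sigma>
  proof -
    have sX: "\<sigma> \<in> simplices (Suc n) X" using sig simplices_mono[OF YX] by blast
    interpret G: comm_group "F (hd \<sigma>)" by (rule group_at[OF sX])
    have x: "hd \<sigma> \<in> P" using hd_simplex[OF sig] YP by blast
    show ?thesis
      unfolding codiff_eq[OF XP s sX] ev_def
    proof (rule G.lin_one_fun)
      fix \<tau> assume "\<tau> \<in> keys (signed_boundary \<sigma>)"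
      then have t: "\<tau> \<in> simplices n Y" "hd \<sigma> \<le> hd \<tau>"
        using keys_signed_boundary_simplex[OF sig] by (auto simp: simplices_above_def)
      then have y: "hd \<tau> \<in> P" using hd_simplex YP by blast
      show "\<rho> (hd \<tau>) (hd \<sigma>) (s \<tau>) = \<one>\<^bsub>F (hd \<sigma>)\<^esub>"
        using assms t hom_one[OF map_hom[OF x y t(2)]] comm_group_at[OF y] G.is_group
        by (simp add: RC_iff comm_group.axioms)
    qed
  qed
  then show ?thesis
    using codiff_closed[OF XP s] by (simp add: RC_iff)
qed

lemma codiff_RC_hom: "dX n \<in> hom (RC n) (RC (Suc n))"
proof (rule homI)
  fix s t assume "s \<in> carrier (RC n)" "t \<in> carrier (RC n)"
  then show "dX n (s \<otimes>\<^bsub>RC n\<^esub> t) = dX n s \<otimes>\<^bsub>RC (Suc n)\<^esub> dX n t"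
    using hom_mult[OF codiff_hom[OF XP]] RC_cochain by simp
qed (rule codiff_RC_closed)

sublocale d: group_hom "rel_cochains F X Y n" "rel_cochains F X Y (Suc n)" "codiff F \<rho> X n" for n
  using codiff_RC_hom by unfold_locales

sublocale RZ: comm_group "rel_cocycles F \<rho> X Y n" for n
  unfolding rel_cocycles_def by (rule RC.subgroup_comm_group[OF d.subgroup_kernel])

lemma RZ_iff: "s \<in> carrier (RZ n) \<longleftrightarrow> s \<in> carrier (RC n) \<and> dX n s = \<one>\<^bsub>cochains F X (Suc n)\<^esub>"
  by (auto simp: rel_cocycles_def kernel_def)

lemma RZ_RC: "s \<in> carrier (RZ n) \<Longrightarrow> s \<in> carrier (RC n)"
  by (simp add: RZ_iff)

lemma mult_RZ [simp]: "(\<otimes>\<^bsub>RZ n\<^esub>) = (\<otimes>\<^bsub>cochains F X n\<^esub>)"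
  by (simp add: rel_cocycles_def)

lemma one_RZ [simp]: "\<one>\<^bsub>RZ n\<^esub> = \<one>\<^bsub>cochains F X n\<^esub>"
  by (simp add: rel_cocycles_def)

lemma RZ_iff_pointwise:
  "s \<in> carrier (RZ n) \<longleftrightarrow> s \<in> carrier (RC n) \<and> (\<forall>\<sigma>\<in>simplices (Suc n) X. dX n s \<sigma> = \<one>\<^bsub>F (hd \<sigma>)\<^esub>)"
proof -
  have "dX n s = \<one>\<^bsub>cochains F X (Suc n)\<^esub> \<longleftrightarrow> (\<forall>\<sigma>\<in>simplices (Suc n) X. dX n s \<sigma> = \<one>\<^bsub>F (hd \<sigma>)\<^esub>)"
    if "s \<in> carrier (RC n)"
  proof
    assume "\<forall>\<sigma>\<in>simplices (Suc n) X. dX n s \<sigma> = \<one>\<^bsub>F (hd \<sigma>)\<^esub>"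
    then show "dX n s = \<one>\<^bsub>cochains F X (Suc n)\<^esub>"
      by (intro cochain_eqI[OF codiff_closed[OF XP RC_cochain[OF that]] CX.one_closed]) (simp add: cochains_def)
  qed (simp add: cochains_def)
  then show ?thesis by (auto simp: RZ_iff)
qed

lemma codiff_RZ: "s \<in> carrier (RC n) \<Longrightarrow> dX n s \<in> carrier (RZ (Suc n))"
  using codiff_RC_closed codiff_codiff[OF XP RC_cochain] by (simp add: RZ_iff)

lemma codiff_RZ_hom: "dX n \<in> hom (RC n) (RZ (Suc n))"
  using codiff_RC_hom codiff_RZ by (simp add: hom_def Pi_iff)

lemma RB_subgroup: "subgroup (RB n) (RZ n)"
proof (cases n)
  case 0
  then show ?thesis using RZ.triv_subgroup[of 0] by (simp add: rel_coboundaries_def)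
next
  case (Suc m)
  interpret h: group_hom "RC m" "RZ (Suc m)" "dX m"
    using codiff_RZ_hom by unfold_locales
  show ?thesis using Suc h.img_is_subgroup by (simp add: rel_coboundaries_def)
qed

lemma apply_RC_hom: "\<sigma> \<in> simplices n X \<Longrightarrow> (\<lambda>s. s \<sigma>) \<in> hom (RC n) (F (hd \<sigma>))"
  by (rule homI) (auto simp: RC_apply cochain_mult_apply)

lemma apply_RZ_hom: "\<sigma> \<in> simplices n X \<Longrightarrow> (\<lambda>s. s \<sigma>) \<in> hom (RZ n) (F (hd \<sigma>))"
  by (rule homI) (auto simp: cochain_mult_apply intro: RC_apply RZ_RC)

lemma ev_cmul:
  assumes "s \<in> carrier (cochains F X n)" "x \<in> P" "keys c \<subseteq> simplices_above x n X"
  shows "ev x s (frag_cmul k c) = ev x s c [^]\<^bsub>F x\<^esub> k"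
  unfolding ev_def
  by (rule comm_group.lin_cmul[OF comm_group_at[OF assms(2)]]) (use ev_terms[OF XP assms(1,2)] assms(3) in blast)

lemma ev_duplicate:
  assumes "s \<in> carrier (cochains F X (Suc m))" "k \<le> m" "x \<in> P" "keys c \<subseteq> simplices_above x m X"
  shows "ev x (\<lambda>\<tau>\<in>simplices m X. s (duplicate k \<tau>)) c = ev x s (dup_chain k c)"
proof -
  interpret G: comm_group "F x" by (rule comm_group_at[OF assms(3)])
  have k: "duplicate k \<tau> \<in> simplices_above x (Suc m) X" if "\<tau> \<in> keys c" for \<tau>
    using that assms(4) keys_dup_chain[of "frag_of \<tau>" x m X k] assms(2) by auto
  have "ev x s (dup_chain k c) = lin (F x) (\<lambda>\<tau>. lin (F x) (\<lambda>\<tau>. \<rho> (hd \<tau>) x (s \<tau>)) (frag_of (duplicate k \<tau>))) c"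
    unfolding ev_def dup_chain_def
    by (rule G.lin_frag_extend[OF ev_terms[OF XP assms(1,3)]]) (use k in auto)
  also have "\<dots> = lin (F x) (\<lambda>\<tau>. \<rho> (hd (duplicate k \<tau>)) x (s (duplicate k \<tau>))) c"
    using k ev_terms[OF XP assms(1,3)] by (intro G.lin_cong G.lin_frag_of) (auto simp: Pi_iff)
  also have "\<dots> = ev x (\<lambda>\<tau>\<in>simplices m X. s (duplicate k \<tau>)) c"
    unfolding ev_def
  proof (rule G.lin_cong[symmetric])
    fix \<tau> assume "\<tau> \<in> keys c"
    then have t: "\<tau> \<in> simplices m X" using assms(4) by (auto simp: simplices_above_def)
    then show "\<rho> (hd \<tau>) x ((\<lambda>\<tau>\<in>simplices m X. s (duplicate k \<tau>)) \<tau>) = \<rho> (hd (duplicate k \<tau>)) x (s (duplicate k \<tau>))"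
      using hd_duplicate[OF simplices_nonempty[OF t]] by simp
  qed (use k ev_terms[OF XP assms(1,3)] in \<open>auto simp: Pi_iff\<close>)
  finally show ?thesis ..
qed

lemma duplicate_RC:
  assumes "s \<in> carrier (RC (Suc m))" "k \<le> m"
  shows "(\<lambda>\<tau>\<in>simplices m X. s (duplicate k \<tau>)) \<in> carrier (RC m)"
proof -
  have "s (duplicate k \<tau>) \<in> carrier (F (hd \<tau>))" if "\<tau> \<in> simplices m X" for \<tau>
    using RC_apply[OF assms(1) duplicate_simplex[OF that assms(2)]] hd_duplicate[OF simplices_nonempty[OF that]] by simp
  moreover have "s (duplicate k \<tau>) = \<one>\<^bsub>F (hd \<tau>)\<^esub>" if "\<tau> \<in> simplices m Y" for \<tau>
    using assms(1) duplicate_simplex[OF that assms(2)] hd_duplicate[OF simplices_nonempty[OF that]] by (simp add: RC_iff)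
  ultimately show ?thesis
    using simplices_mono[OF YX, of m] by (auto simp: RC_iff cochains_def)
qed

text \<open>
  Let \<open>t0\<close> be \<open>s\<close> composed with duplication at position \<open>k\<close>.  On a simplex \<open>\<sigma>\<close> with a repetition
  at \<open>k\<close>, the homotopy formula together with the cocycle condition on the duplicated simplex
  gives \<open>d t0 = \<plusminus> s\<close>, and on simplices degenerate below \<open>k\<close> it gives \<open>d t0 = 0\<close>.  Subtracting
  \<open>\<plusminus> d t0\<close> thus makes \<open>s\<close> trivial on the former and keeps it trivial on the latter.
\<close>

lemma normalise_step:
  assumes s: "s \<in> carrier (RZ (Suc m))" and k: "k \<le> m"
    and van: "\<And>\<sigma>. \<sigma> \<in> simplices (Suc m) X \<Longrightarrow> degen_below k \<sigma> \<Longrightarrow> s \<sigma> = \<one>\<^bsub>F (hd \<sigma>)\<^esub>"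
  shows "\<exists>t\<in>carrier (RC m). \<exists>s'\<in>carrier (RZ (Suc m)). s = s' \<otimes>\<^bsub>RZ (Suc m)\<^esub> dX m t \<and>
    (\<forall>\<sigma>\<in>simplices (Suc m) X. degen_below (Suc k) \<sigma> \<longrightarrow> s' \<sigma> = \<one>\<^bsub>F (hd \<sigma>)\<^esub>)"
proof -
  have sRC: "s \<in> carrier (RC (Suc m))" by (rule RZ_RC[OF s])
  have sC: "s \<in> carrier (cochains F X (Suc m))" by (rule RC_cochain[OF sRC])
  define t0 where "t0 = (\<lambda>\<tau>\<in>simplices m X. s (duplicate k \<tau>))"
  have t0: "t0 \<in> carrier (RC m)" unfolding t0_def by (rule duplicate_RC[OF sRC k])
  \<comment> \<open>the sign of the homotopy formula times the sign between the two boundary conventions\<close>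
  define \<eta> :: int where "\<eta> = (- 1) ^ k * (- 1) ^ Suc m"
  have \<eta>: "\<eta> * \<eta> = 1" by (cases "even k"; cases "even m") (auto simp: \<eta>_def)
  have u_ev: "dX m t0 \<sigma> = ev (hd \<sigma>) s (dup_chain k (boundary \<sigma>)) [^]\<^bsub>F (hd \<sigma>)\<^esub> ((- 1) ^ Suc m :: int)"
    if sig: "\<sigma> \<in> simplices (Suc m) X" for \<sigma>
  proof -
    have x: "hd \<sigma> \<in> P" using hd_simplex[OF sig] XP by blast
    have "dX m t0 \<sigma> = ev (hd \<sigma>) t0 (signed_boundary \<sigma>)"
      by (rule codiff_eq[OF XP RC_cochain[OF t0] sig])
    also have "signed_boundary \<sigma> = frag_cmul ((- 1) ^ Suc m) (boundary \<sigma>)"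
      using sig by (simp add: signed_boundary_def simplices_def)
    also have "ev (hd \<sigma>) t0 \<dots> = ev (hd \<sigma>) t0 (boundary \<sigma>) [^]\<^bsub>F (hd \<sigma>)\<^esub> ((- 1) ^ Suc m :: int)"
      by (rule ev_cmul[OF RC_cochain[OF t0] x keys_boundary_simplex[OF sig]])
    also have "ev (hd \<sigma>) t0 (boundary \<sigma>) = ev (hd \<sigma>) s (dup_chain k (boundary \<sigma>))"
      unfolding t0_def by (rule ev_duplicate[OF sC k x keys_boundary_simplex[OF sig]])
    finally show ?thesis .
  qed
  have ev_one: "ev (hd \<sigma>) s c = \<one>\<^bsub>F (hd \<sigma>)\<^esub>"
    if sig: "\<sigma> \<in> simplices (Suc m) X" and c: "keys c \<subseteq> Collect (degen_below k)" "keys c \<subseteq> simplices_above (hd \<sigma>) (Suc m) X"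
    for c \<sigma>
    unfolding ev_def
  proof (rule comm_group.lin_one_fun[OF group_at[OF sig]])
    fix \<tau> assume "\<tau> \<in> keys c"
    then have t: "\<tau> \<in> simplices (Suc m) X" "degen_below k \<tau>" "hd \<sigma> \<le> hd \<tau>"
      using c by (auto simp: simplices_above_def)
    have "hd \<sigma> \<in> P" "hd \<tau> \<in> P" using hd_simplex sig t(1) XP by blast+
    then show "\<rho> (hd \<tau>) (hd \<sigma>) (s \<tau>) = \<one>\<^bsub>F (hd \<sigma>)\<^esub>"
      using van[OF t(1,2)] hom_one[OF map_hom[OF _ _ t(3)]] group_at[OF sig] group_at[OF t(1)]
      by (simp add: comm_group.axioms)
  qed
  have u1: "dX m t0 \<sigma> = \<one>\<^bsub>F (hd \<sigma>)\<^esub>" if sig: "\<sigma> \<in> simplices (Suc m) X" and d: "degen_below k \<sigma>" for \<sigma>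
  proof -
    interpret G: comm_group "F (hd \<sigma>)" by (rule group_at[OF sig])
    show ?thesis
      unfolding u_ev[OF sig]
      using ev_one[OF sig keys_dup_chain_boundary[OF d] keys_dup_chain[OF keys_boundary_simplex[OF sig] k]] by simp
  qed
  have u2: "dX m t0 \<sigma> = s \<sigma> [^]\<^bsub>F (hd \<sigma>)\<^esub> \<eta>" if sig: "\<sigma> \<in> simplices (Suc m) X" and d: "degen_at k \<sigma>" for \<sigma>
  proof -
    let ?x = "hd \<sigma>"
    let ?D = "simplices_above ?x (Suc m) X"
    interpret G: comm_group "F ?x" by (rule group_at[OF sig])
    have x: "?x \<in> P" using hd_simplex[OF sig] XP by blast
    have f: "(\<lambda>\<tau>. \<rho> (hd \<tau>) ?x (s \<tau>)) \<in> ?D \<rightarrow> carrier (F ?x)" by (rule ev_terms[OF XP sC x])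
    have duplicate: "duplicate k \<sigma> \<in> simplices (Suc (Suc m)) X" "hd (duplicate k \<sigma>) = ?x"
      using duplicate_simplex[OF sig, of k] k hd_duplicate[OF simplices_nonempty[OF sig]] by auto
    have k1: "keys (dup_chain k (boundary \<sigma>)) \<subseteq> ?D" by (rule keys_dup_chain[OF keys_boundary_simplex[OF sig] k])
    have k2: "keys (boundary (duplicate k \<sigma>)) \<subseteq> ?D" using keys_boundary_simplex[OF duplicate(1)] duplicate(2) by simp
    have k3: "keys (frag_cmul ((- 1) ^ k) (frag_of \<sigma>)) \<subseteq> ?D" using sig by (auto simp: simplices_above_def)
    let ?e = "dup_chain k (boundary \<sigma>) + boundary (duplicate k \<sigma>) - frag_cmul ((- 1) ^ k) (frag_of \<sigma>)"
    have k4: "keys ?e \<subseteq> ?D" by (intro keys_diff_subset keys_add_subset k1 k2 k3)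
    have e: "ev ?x s ?e = \<one>\<^bsub>F ?x\<^esub>" by (rule ev_one[OF sig keys_duplicate_homotopy[OF d] k4])
    have "dX (Suc m) s (duplicate k \<sigma>) = \<one>\<^bsub>F ?x\<^esub>"
      using s duplicate by (simp add: RZ_iff_pointwise)
    then have "ev ?x s (boundary (duplicate k \<sigma>)) [^]\<^bsub>F ?x\<^esub> ((- 1) ^ Suc (Suc m) :: int) = \<one>\<^bsub>F ?x\<^esub>"
      using codiff_eq[OF XP sC duplicate(1)] ev_cmul[OF sC x k2, of "(- 1) ^ Suc (Suc m)"] duplicate
      by (simp add: signed_boundary_def simplices_def)
    then have b: "ev ?x s (boundary (duplicate k \<sigma>)) = \<one>\<^bsub>F ?x\<^esub>"
      using ev_closed[OF XP sC x k2] by (cases "even m") (auto simp: G.int_pow_neg)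
    have c: "ev ?x s (frag_cmul ((- 1) ^ k) (frag_of \<sigma>)) = s \<sigma> [^]\<^bsub>F ?x\<^esub> ((- 1) ^ k :: int)"
      using ev_cmul[OF sC x, of "frag_of \<sigma>" "(- 1) ^ k"] sig map_id[OF x] cochain_apply[OF sC sig]
      by (simp add: ev_def G.lin_frag_of simplices_above_def)
    \<comment> \<open>solve the homotopy formula for the term that computes \<open>d t0\<close>\<close>
    have "?e + frag_cmul ((- 1) ^ k) (frag_of \<sigma>) - boundary (duplicate k \<sigma>) = dup_chain k (boundary \<sigma>)" by simp
    moreover have "ev ?x s (?e + frag_cmul ((- 1) ^ k) (frag_of \<sigma>) - boundary (duplicate k \<sigma>)) =
        ev ?x s ?e \<otimes>\<^bsub>F ?x\<^esub> ev ?x s (frag_cmul ((- 1) ^ k) (frag_of \<sigma>)) \<otimes>\<^bsub>F ?x\<^esub> inv\<^bsub>F ?x\<^esub> ev ?x s (boundary (duplicate k \<sigma>))"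
    proof -
      have 1: "(\<lambda>\<tau>. \<rho> (hd \<tau>) ?x (s \<tau>)) \<in> keys ?e \<union> keys (frag_cmul ((- 1) ^ k) (frag_of \<sigma>)) \<rightarrow> carrier (F ?x)"
        using f k3 k4 by blast
      have "keys (?e + frag_cmul ((- 1) ^ k) (frag_of \<sigma>)) \<subseteq> ?D" by (intro keys_add_subset k3 k4)
      then have 2: "(\<lambda>\<tau>. \<rho> (hd \<tau>) ?x (s \<tau>)) \<in> keys (?e + frag_cmul ((- 1) ^ k) (frag_of \<sigma>)) \<union> keys (boundary (duplicate k \<sigma>)) \<rightarrow> carrier (F ?x)"
        using f k2 by blast
      show ?thesis
        unfolding ev_def G.lin_diff[OF 2] G.lin_add[OF 1] ..
    qed
    ultimately have "ev ?x s (dup_chain k (boundary \<sigma>)) = s \<sigma> [^]\<^bsub>F ?x\<^esub> ((- 1) ^ k :: int)"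
      using e b c cochain_apply[OF sC sig] by simp
    then show ?thesis
      unfolding u_ev[OF sig] \<eta>_def using cochain_apply[OF sC sig] by (simp add: G.int_pow_pow)
  qed
  let ?t = "t0 [^]\<^bsub>RC m\<^esub> \<eta>"
  have t: "?t \<in> carrier (RC m)" using t0 by (rule RC.int_pow_closed)
  have dt: "dX m ?t \<in> carrier (RZ (Suc m))" by (rule codiff_RZ[OF t])
  have dt_apply: "dX m ?t \<sigma> = dX m t0 \<sigma> [^]\<^bsub>F (hd \<sigma>)\<^esub> \<eta>" if sig: "\<sigma> \<in> simplices (Suc m) X" for \<sigma>
    unfolding d.hom_int_pow[OF t0]
    using hom_int_pow[OF apply_RC_hom[OF sig] codiff_RC_closed[OF t0]] group_at[OF sig] RC.is_group
    by (simp add: comm_group.axioms)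
  let ?s' = "s \<otimes>\<^bsub>RZ (Suc m)\<^esub> inv\<^bsub>RZ (Suc m)\<^esub> dX m ?t"
  have s': "?s' \<in> carrier (RZ (Suc m))" using s dt by (intro RZ.m_closed RZ.inv_closed)
  have eq: "s = ?s' \<otimes>\<^bsub>RZ (Suc m)\<^esub> dX m ?t"
    using s dt by (simp add: RZ.m_assoc del: mult_RZ one_RZ)
  have s'_apply: "?s' \<sigma> = s \<sigma> \<otimes>\<^bsub>F (hd \<sigma>)\<^esub> inv\<^bsub>F (hd \<sigma>)\<^esub> (dX m t0 \<sigma> [^]\<^bsub>F (hd \<sigma>)\<^esub> \<eta>)"
    if sig: "\<sigma> \<in> simplices (Suc m) X" for \<sigma>
  proof -
    interpret h: group_hom "RZ (Suc m)" "F (hd \<sigma>)" "\<lambda>s. s \<sigma>"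
      using apply_RZ_hom[OF sig] group_at[OF sig] RZ.is_group
      by (simp add: group_hom_def group_hom_axioms_def comm_group.axioms)
    show ?thesis using h.hom_mult[OF s RZ.inv_closed[OF dt]] h.hom_inv[OF dt] dt_apply[OF sig] by simp
  qed
  have "?s' \<sigma> = \<one>\<^bsub>F (hd \<sigma>)\<^esub>" if sig: "\<sigma> \<in> simplices (Suc m) X" and d: "degen_below (Suc k) \<sigma>" for \<sigma>
  proof -
    interpret G: comm_group "F (hd \<sigma>)" by (rule group_at[OF sig])
    from d consider "degen_below k \<sigma>" | "degen_at k \<sigma>" by (auto simp: degen_below_Suc)
    then show ?thesis
    proof cases
      case 1
      then show ?thesis unfolding s'_apply[OF sig] by (simp add: van[OF sig] u1[OF sig])
    next
      case 2
      then show ?thesis unfolding s'_apply[OF sig]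
        using cochain_apply[OF sC sig] by (simp add: u2[OF sig] G.int_pow_pow \<eta>)
    qed
  qed
  with t s' eq show ?thesis by blast
qed

lemma normalise:
  assumes s: "s \<in> carrier (RZ (Suc m))"
  shows "\<exists>t\<in>carrier (RC m). \<exists>s'\<in>carrier (RZ (Suc m)). s = s' \<otimes>\<^bsub>RZ (Suc m)\<^esub> dX m t \<and>
    (\<forall>\<sigma>\<in>simplices (Suc m) X. \<not> sorted_wrt (<) \<sigma> \<longrightarrow> s' \<sigma> = \<one>\<^bsub>F (hd \<sigma>)\<^esub>)"
proof -
  have "\<exists>t\<in>carrier (RC m). \<exists>s'\<in>carrier (RZ (Suc m)). s = s' \<otimes>\<^bsub>RZ (Suc m)\<^esub> dX m t \<and>
    (\<forall>\<sigma>\<in>simplices (Suc m) X. degen_below k \<sigma> \<longrightarrow> s' \<sigma> = \<one>\<^bsub>F (hd \<sigma>)\<^esub>)" if "k \<le> Suc m" for k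
    using that
  proof (induction k)
    case 0
    have "s = s \<otimes>\<^bsub>RZ (Suc m)\<^esub> dX m \<one>\<^bsub>RC m\<^esub>"
      using d.hom_one[of m] RC_cochain[OF RZ_RC[OF s]] by simp
    then show ?case using s RC.one_closed by (metis degen_below_0)
  next
    case (Suc k)
    then obtain t s' where 1: "t \<in> carrier (RC m)" "s' \<in> carrier (RZ (Suc m))" "s = s' \<otimes>\<^bsub>RZ (Suc m)\<^esub> dX m t"
      "\<And>\<sigma>. \<sigma> \<in> simplices (Suc m) X \<Longrightarrow> degen_below k \<sigma> \<Longrightarrow> s' \<sigma> = \<one>\<^bsub>F (hd \<sigma>)\<^esub>" by (metis Suc_leD)
    have "k \<le> m" using Suc.prems by simp
    from normalise_step[OF 1(2) this 1(4)] obtain t' s'' where 2: "t' \<in> carrier (RC m)"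
      "s'' \<in> carrier (RZ (Suc m))" "s' = s'' \<otimes>\<^bsub>RZ (Suc m)\<^esub> dX m t'"
      "\<forall>\<sigma>\<in>simplices (Suc m) X. degen_below (Suc k) \<sigma> \<longrightarrow> s'' \<sigma> = \<one>\<^bsub>F (hd \<sigma>)\<^esub>" by blast
    have "s = s'' \<otimes>\<^bsub>RZ (Suc m)\<^esub> (dX m t' \<otimes>\<^bsub>RZ (Suc m)\<^esub> dX m t)"
      unfolding 1(3) 2(3) using 2(2) codiff_RZ[OF 2(1)] codiff_RZ[OF 1(1)] by (rule RZ.m_assoc)
    also have "dX m t' \<otimes>\<^bsub>RZ (Suc m)\<^esub> dX m t = dX m (t' \<otimes>\<^bsub>RC m\<^esub> t)"
      by (rule hom_mult[OF codiff_RZ_hom 2(1) 1(1), symmetric])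
    finally show ?case using 2(2,4) RC.m_closed[OF 2(1) 1(1)] by blast
  qed
  moreover have "degen_below (Suc m) \<sigma> \<longleftrightarrow> \<not> sorted_wrt (<) \<sigma>" if "\<sigma> \<in> simplices (Suc m) X" for \<sigma>
    using that by (intro degen_below_iff) (simp_all add: simplices_def)
  ultimately show ?thesis by (metis order_refl)
qed

text \<open>
  Normalised cochains form a subcomplex.
\<close>

lemma normalised_cocycle:
  assumes s: "s \<in> carrier (RC n)"
    and van: "\<And>\<sigma>. \<sigma> \<in> simplices n X \<Longrightarrow> \<not> sorted_wrt (<) \<sigma> \<Longrightarrow> s \<sigma> = \<one>\<^bsub>F (hd \<sigma>)\<^esub>"
    and sig: "\<sigma> \<in> simplices (Suc n) X" and deg: "\<not> sorted_wrt (<) \<sigma>"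
  shows "dX n s \<sigma> = \<one>\<^bsub>F (hd \<sigma>)\<^esub>"
  unfolding codiff_eq[OF XP RC_cochain[OF s] sig] ev_def
proof (rule comm_group.lin_one_fun[OF group_at[OF sig]])
  fix \<tau> assume tk: "\<tau> \<in> keys (signed_boundary \<sigma>)"
  then have t: "\<tau> \<in> simplices n X" "hd \<sigma> \<le> hd \<tau>"
    using keys_signed_boundary_simplex[OF sig] by (auto simp: simplices_above_def)
  have "degen_below (Suc n) \<sigma>" using sig deg degen_below_iff[of \<sigma> "Suc n"] by (simp add: simplices_def)
  then have "degen_below (Suc n) \<tau>" using keys_boundary_degen_below tk by (auto simp: keys_signed_boundary)
  then have "\<not> sorted_wrt (<) \<tau>" using t degen_below_iff[of \<tau> "Suc n"] by (simp add: simplices_def)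
  moreover have "hd \<sigma> \<in> P" "hd \<tau> \<in> P" using hd_simplex sig t(1) XP by blast+
  ultimately show "\<rho> (hd \<tau>) (hd \<sigma>) (s \<tau>) = \<one>\<^bsub>F (hd \<sigma>)\<^esub>"
    using van[OF t(1)] hom_one[OF map_hom[OF _ _ t(2)]] group_at[OF sig] group_at[OF t(1)]
    by (simp add: comm_group.axioms)
qed

end

section \<open>Chains in a graded poset\<close>

lemma rev_upt_split: "j < n \<Longrightarrow> rev [0..<n] = rev [Suc j..<n] @ j # rev [0..<j]"
proof -
  assume "j < n"
  then have "[0..<n] = [0..<j] @ j # [Suc j..<n]"
    using upt_add_eq_append[of 0 j "n - j"] upt_conv_Cons[of j n] by simp
  then show ?thesis by simp
qed

lemma lookup_sum_frag_of: "finite B \<Longrightarrow> lookup (\<Sum>\<sigma>\<in>B. frag_of \<sigma>) \<sigma> = (if \<sigma> \<in> B then 1 else 0)"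
  by (induction B rule: finite_induct) (auto simp: lookup_add)

lemma (in comm_group) lin_single:
  assumes "\<And>k'. k' \<noteq> k \<Longrightarrow> f k' = \<one>" "f k \<in> carrier G"
  shows "lin G f c = f k [^] lookup c k"
proof -
  have f: "f \<in> A \<rightarrow> carrier G" for A using assms by (metis Pi_I one_closed)
  have "lin G f c = finprod G (\<lambda>k'. f k' [^] lookup c k') (insert k (keys c))"
    by (rule lin_superset) (use f in auto)
  also have "\<dots> = finprod G (\<lambda>k'. if k = k' then f k' [^] lookup c k' else \<one>) (insert k (keys c))"
    using assms by (intro finprod_cong') auto
  also have "\<dots> = f k [^] lookup c k"
    by (rule finprod_singleton) (use f[of UNIV] in auto)
  finally show ?thesis .
qed

locale graded_presheaf = presheaf P F \<rho>
  for P :: "'a::order set" and F :: "'a \<Rightarrow> 'b monoid" and \<rho> :: "'a \<Rightarrow> 'a \<Rightarrow> 'b \<Rightarrow> 'b" +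
  fixes rk :: "'a \<Rightarrow> int" and r :: int
  assumes locally_finite: "locally_finite_poset P" and graded: "graded_with_corank P rk r"
begin

abbreviation "cr \<equiv> corank rk r"
abbreviation "Sk n \<equiv> skel P rk r (int n)"
abbreviation "Sk' n \<equiv> skel P rk r (int n - 1)"
abbreviation "I n \<equiv> corank_set P rk r n"
abbreviation "Nd x n \<equiv> nd_simplices n (up_set P x)"
abbreviation "Rel x n \<equiv> A_rels P rk r x n"

lemma corank_less: "x \<in> P \<Longrightarrow> y \<in> P \<Longrightarrow> x < y \<Longrightarrow> cr y < cr x"
  using graded by (simp add: graded_with_corank_def rank_function_def corank_def)

lemma corank_le: "x \<in> P \<Longrightarrow> y \<in> P \<Longrightarrow> x \<le> y \<Longrightarrow> cr y \<le> cr x"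
  using corank_less[of x y] by (auto simp: order.order_iff_strict)

lemma corank_nonneg: "x \<in> P \<Longrightarrow> 0 \<le> cr x"
  using graded by (simp add: graded_with_corank_def corank_def)

lemma ex_cover_below:
  assumes "x \<in> P" "z \<in> P" "x < z"
  shows "\<exists>y. covers P x y \<and> y \<le> z"
proof -
  \<comment> \<open>an element of \<open>(x, z]\<close> of maximal corank has nothing between \<open>x\<close> and itself\<close>
  obtain w where w: "w \<in> P" "x < w" "w \<le> z"
    and max: "\<And>u. u \<in> P \<and> x < u \<and> u \<le> z \<Longrightarrow> nat (cr x - cr w) \<le> nat (cr x - cr u)"
    using ex_has_least_nat[of "\<lambda>w. w \<in> P \<and> x < w \<and> w \<le> z" z "\<lambda>w. nat (cr x - cr w)"] assms by auto
  have "\<not> (\<exists>u\<in>P. x < u \<and> u < w)"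
  proof safe
    fix u assume u: "u \<in> P" "x < u" "u < w"
    then have "nat (cr x - cr w) \<le> nat (cr x - cr u)" using max[of u] w by auto
    then show False using corank_less[OF assms(1) u(1,2)] corank_less[OF u(1) w(1) u(3)] by simp
  qed
  then show ?thesis using w assms by (auto simp: covers_def)
qed

text \<open>
  Any \<open>z > x\<close> lies above one of the finitely many covers of \<open>x\<close>, and covers have smaller corank;
  induction on the corank, which is bounded below by \<open>0\<close>.
\<close>

lemma finite_up_set: "x \<in> P \<Longrightarrow> finite (up_set P x)"
proof (induction "nat (cr x)" arbitrary: x rule: less_induct)
  case less
  have "up_set P x \<subseteq> insert x (\<Union>y\<in>{y. covers P x y}. up_set P y)"
  proof
    fix z assume "z \<in> up_set P x"
    then have z: "z \<in> P" "x \<le> z" by (auto simp: up_set_def)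
    show "z \<in> insert x (\<Union>y\<in>{y. covers P x y}. up_set P y)"
    proof (cases "x = z")
      case False
      then obtain y where "covers P x y" "y \<le> z" using ex_cover_below[of x z] z less.prems by (auto simp: order.strict_iff_order)
      then show ?thesis using z by (auto simp: up_set_def)
    qed simp
  qed
  moreover have "finite (up_set P y)" if "covers P x y" for y
  proof (rule less.hyps)
    show "y \<in> P" using that by (simp add: covers_def)
    then show "nat (cr y) < nat (cr x)"
      using corank_less[of x y] corank_nonneg[of y] that less.prems by (simp add: covers_def)
  qed
  moreover have "finite {y. covers P x y}"
    using locally_finite less.prems by (simp add: locally_finite_poset_def)
  ultimately show ?case by (auto intro: finite_subset)
qed

lemma finite_lists_up_set: "x \<in> P \<Longrightarrow> finite {\<tau>. set \<tau> \<subseteq> up_set P x \<and> length \<tau> = n}"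
  using finite_lists_length_eq[OF finite_up_set] .

lemma finite_Nd: "x \<in> P \<Longrightarrow> finite (Nd x n)"
  by (rule finite_subset[OF _ finite_lists_up_set[of x "Suc n"]]) (auto simp: nd_simplices_def)

lemma chain_length:
  assumes "sorted_wrt (<) \<sigma>" "set \<sigma> \<subseteq> P" "\<sigma> \<noteq> []"
  shows "int (length \<sigma>) \<le> cr (hd \<sigma>) + 1"
  using assms
proof (induction \<sigma>)
  case (Cons v \<tau>)
  show ?case
  proof (cases \<tau>)
    case Nil
    then show ?thesis using corank_nonneg[of v] Cons by simp
  next
    case (Cons w \<upsilon>)
    then show ?thesis using Cons.IH Cons.prems corank_less[of v w] by simp
  qed
qed simp

text \<open>
  Coranks strictly decrease along a chain and are non-negative, so a chain of maximal length
  compared to the corank of its first vertex realises every corank.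
\<close>

lemma full_chain:
  assumes "sorted_wrt (<) \<sigma>" "set \<sigma> \<subseteq> P" "\<sigma> \<noteq> []" "cr (hd \<sigma>) + 1 \<le> int (length \<sigma>)"
  shows "map cr \<sigma> = map int (rev [0..<length \<sigma>])"
  using assms
proof (induction \<sigma>)
  case (Cons v \<tau>)
  show ?case
  proof (cases \<tau>)
    case Nil
    then show ?thesis using corank_nonneg[of v] Cons by simp
  next
    case c: (Cons w \<upsilon>)
    have "cr w < cr v" using c Cons.prems by (intro corank_less) auto
    moreover have "int (length \<tau>) \<le> cr w + 1" using chain_length[of \<tau>] c Cons.prems by simp
    ultimately have "cr v = int (length \<tau>)" "cr (hd \<tau>) + 1 \<le> int (length \<tau>)" using c Cons.prems by auto
    then show ?thesis using Cons.IH Cons.prems c by simp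
  qed
qed simp

text \<open>
  With one vertex fewer than possible, a chain skips exactly one corank \<open>j\<close>.
\<close>

lemma gap_chain:
  assumes "sorted_wrt (<) \<tau>" "set \<tau> \<subseteq> P" "\<tau> \<noteq> []" "cr (hd \<tau>) = int (length \<tau>)"
  shows "\<exists>us vs j. \<tau> = hd \<tau> # us @ vs \<and> j < length \<tau> \<and>
    map cr us = map int (rev [Suc j..<length \<tau>]) \<and> map cr vs = map int (rev [0..<j])"
  using assms
proof (induction \<tau>)
  case (Cons v \<tau>)
  show ?case
  proof (cases \<tau>)
    case Nil
    then show ?thesis by (intro exI[of _ "[]"] exI[of _ 0]) simp
  next
    case c: (Cons w \<upsilon>)
    have "cr w < cr v" using c Cons.prems by (intro corank_less) auto
    moreover have "int (length \<tau>) \<le> cr w + 1" using chain_length[of \<tau>] c Cons.prems by simp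
    ultimately consider "cr w = int (length \<tau>)" | "cr w + 1 = int (length \<tau>)" using Cons.prems by force
    then show ?thesis
    proof cases
      case 1
      then obtain us vs j where h: "w # \<upsilon> = w # us @ vs" "j < length \<tau>"
        "map cr us = map int (rev [Suc j..<length \<tau>])" "map cr vs = map int (rev [0..<j])"
        using Cons.IH Cons.prems c by auto
      have "map cr (w # us) = map int (rev [Suc j..<length (v # \<tau>)])"
        using h 1 by simp
      moreover have "v # \<tau> = hd (v # \<tau>) # (w # us) @ vs" using h(1) c by simp
      moreover have "j < length (v # \<tau>)" using h(2) by simp
      ultimately show ?thesis using h(4) by blast
    next
      case 2
      then have "map cr \<tau> = map int (rev [0..<length \<tau>])"
        using Cons.prems c by (intro full_chain) auto
      then show ?thesis
        by (intro exI[of _ "[]"] exI[of _ \<tau>] exI[of _ "length \<tau>"]) simp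
    qed
  qed
qed simp

lemma Sk_subset: "Sk' n \<subseteq> Sk n" "Sk n \<subseteq> P"
  by (auto simp: skel_def)

sublocale pr: presheaf_pair P F \<rho> "Sk n" "Sk' n" for n
  by unfold_locales (rule Sk_subset)+

lemma I_P: "x \<in> I n \<Longrightarrow> x \<in> P" and I_corank: "x \<in> I n \<Longrightarrow> cr x = int n"
  by (auto simp: corank_set_def)

lemma strict_simplex_hd:
  assumes "\<sigma> \<in> simplices n (Sk n)" "sorted_wrt (<) \<sigma>"
  shows "hd \<sigma> \<in> I n"
proof -
  have "int (length \<sigma>) \<le> cr (hd \<sigma>) + 1"
    using assms Sk_subset(2)[of n] by (intro chain_length) (auto simp: simplices_def)
  then show ?thesis using hd_simplex[OF assms(1)] assms(1) by (auto simp: simplices_def skel_def corank_set_def)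
qed

lemma no_strict_simplex:
  assumes "\<sigma> \<in> simplices (Suc n) (Sk n)"
  shows "\<not> sorted_wrt (<) \<sigma>"
proof
  assume "sorted_wrt (<) \<sigma>"
  then have "int (length \<sigma>) \<le> cr (hd \<sigma>) + 1"
    using assms Sk_subset(2)[of n] by (intro chain_length) (auto simp: simplices_def)
  then show False using hd_simplex[OF assms] assms by (auto simp: simplices_def skel_def)
qed

lemma Nd_hd:
  assumes "x \<in> I n" "\<sigma> \<in> Nd x n"
  shows "hd \<sigma> = x"
proof (rule ccontr)
  assume "hd \<sigma> \<noteq> x"
  have s: "sorted_wrt (<) \<sigma>" "set \<sigma> \<subseteq> P" "\<sigma> \<noteq> []" "length \<sigma> = Suc n" "hd \<sigma> \<in> up_set P x"
    using assms(2) by (cases \<sigma>; auto simp: nd_simplices_def up_set_def)+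
  then have "cr (hd \<sigma>) < cr x"
    using \<open>hd \<sigma> \<noteq> x\<close> I_P[OF assms(1)] by (intro corank_less) (auto simp: up_set_def)
  then show False using chain_length[OF s(1-3)] s(4) I_corank[OF assms(1)] by simp
qed

text \<open>
  For \<open>x\<close> of corank \<open>n\<close> an \<open>n\<close>-simplex above \<open>x\<close> must start at \<open>x\<close>, so these sets partition the
  non-degenerate \<open>n\<close>-simplices of the \<open>n\<close>-skeleton.
\<close>

lemma Nd_iff:
  assumes "x \<in> I n"
  shows "\<sigma> \<in> Nd x n \<longleftrightarrow> \<sigma> \<in> simplices n (Sk n) \<and> sorted_wrt (<) \<sigma> \<and> hd \<sigma> = x"
proof
  assume s: "\<sigma> \<in> Nd x n"
  have "v \<in> Sk n" if "v \<in> set \<sigma>" for v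
  proof -
    have "v \<in> P" "x \<le> v" using s that by (auto simp: nd_simplices_def up_set_def)
    then show ?thesis using corank_le[of x v] I_P[OF assms] I_corank[OF assms] by (simp add: skel_def)
  qed
  moreover have "sorted_wrt (\<le>) \<sigma>"
    using s by (auto simp: nd_simplices_def intro: sorted_wrt_mono_rel[of _ "(<)"])
  ultimately show "\<sigma> \<in> simplices n (Sk n) \<and> sorted_wrt (<) \<sigma> \<and> hd \<sigma> = x"
    using s Nd_hd[OF assms s] by (auto simp: nd_simplices_def simplices_def)
next
  assume s: "\<sigma> \<in> simplices n (Sk n) \<and> sorted_wrt (<) \<sigma> \<and> hd \<sigma> = x"
  then have "set \<sigma> \<subseteq> up_set P x"
    using hd_le_simplex[of \<sigma> n "Sk n"] by (auto simp: up_set_def simplices_def skel_def)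
  then show "\<sigma> \<in> Nd x n" using s by (auto simp: nd_simplices_def simplices_def)
qed

lemma Nd_coranks:
  assumes "x \<in> I n" "\<sigma> \<in> Nd x n"
  shows "map cr \<sigma> = map int (rev [0..<Suc n])"
proof -
  have "map cr \<sigma> = map int (rev [0..<length \<sigma>])"
    using assms Nd_hd[OF assms] I_corank[OF assms(1)]
    by (intro full_chain) (auto simp: nd_simplices_def up_set_def)
  then show ?thesis using assms by (simp add: nd_simplices_def)
qed

text \<open>
  The simplices \<open>\<tau>\<close> that give compatible families.  For \<open>n = 0\<close> the set is empty because of the
  condition \<open>\<tau> \<noteq> []\<close>, which matches the triviality of coboundaries in degree \<open>0\<close>.
\<close>

definition gapped :: "'a \<Rightarrow> nat \<Rightarrow> 'a list set" where
  "gapped x n = {\<tau>. length \<tau> = n \<and> \<tau> \<noteq> [] \<and> hd \<tau> = x \<and> set \<tau> \<subseteq> up_set P x \<and> sorted_wrt (<) \<tau>}"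

lemma finite_gapped: "x \<in> P \<Longrightarrow> finite (gapped x n)"
  by (rule finite_subset[OF _ finite_lists_up_set[of x n]]) (auto simp: gapped_def)

definition family :: "'a \<Rightarrow> nat \<Rightarrow> 'a list \<Rightarrow> 'a list \<Rightarrow> 'a list set" where
  "family x n us vs = {x # us @ y # vs | y. x # us @ y # vs \<in> Nd x n}"

lemma finite_family: "x \<in> P \<Longrightarrow> finite (family x n us vs)"
  by (rule finite_subset[OF _ finite_Nd[of x n]]) (auto simp: family_def)

text \<open>
  The coranks serve as colours: \<open>\<tau>\<close> is a face of \<open>\<sigma>\<close> exactly when \<open>\<sigma>\<close> belongs to the compatible
  family of \<open>\<tau>\<close>.  The coefficient does not depend on \<open>\<sigma>\<close>, so up to one sign the coboundary of
  \<open>\<tau>\<close> is the relator.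
\<close>

lemma lookup_signed_boundary_gapped:
  assumes "x \<in> I n" "j < n" "map cr us = map int (rev [Suc j..<n])" "map cr vs = map int (rev [0..<j])"
    and "\<sigma> \<in> Nd x n"
  shows "lookup (signed_boundary \<sigma>) (x # us @ vs) =
    ((- 1) ^ n * (- 1) ^ Suc (length us)) * lookup (\<Sum>\<sigma>\<in>family x n us vs. frag_of \<sigma>) \<sigma>"
proof -
  have "map cr \<sigma> = map int (n # rev [Suc j..<n] @ j # rev [0..<j])"
    unfolding Nd_coranks[OF assms(1,5)] by (simp add: rev_upt_split[OF assms(2)])
  then have "map cr \<sigma> = map cr (x # us) @ int j # map cr vs"
    using assms I_corank[OF assms(1)] by simp
  moreover have "distinct (map cr \<sigma>)"
    unfolding Nd_coranks[OF assms(1,5)] by (simp add: distinct_map del: upt_Suc)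
  ultimately have "lookup (boundary \<sigma>) ((x # us) @ vs) =
      (if \<exists>y. \<sigma> = (x # us) @ y # vs then (- 1) ^ length (x # us) else 0)"
    by (intro lookup_boundary)
  moreover have "(\<exists>y. \<sigma> = (x # us) @ y # vs) \<longleftrightarrow> \<sigma> \<in> family x n us vs"
    using assms(5) by (auto simp: family_def)
  moreover have "length \<sigma> - 1 = n" using assms(5) by (simp add: nd_simplices_def)
  ultimately show ?thesis
    by (simp add: signed_boundary_def lookup_sum_frag_of finite_family[OF I_P[OF assms(1)]])
qed

lemma gapped_relator:
  assumes "x \<in> I n" "\<tau> \<in> gapped x n"
  shows "\<exists>R\<in>Rel x n. \<exists>e. e * e = 1 \<and> (\<forall>\<sigma>\<in>Nd x n. lookup (signed_boundary \<sigma>) \<tau> = e * lookup R \<sigma>)"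
proof -
  have t: "length \<tau> = n" "\<tau> \<noteq> []" "hd \<tau> = x" "set \<tau> \<subseteq> up_set P x" "sorted_wrt (<) \<tau>" "set \<tau> \<subseteq> P"
    using assms(2) by (auto simp: gapped_def up_set_def)
  obtain us vs j where g: "\<tau> = x # us @ vs" "j < n"
    "map cr us = map int (rev [Suc j..<n])" "map cr vs = map int (rev [0..<j])"
    using gap_chain[OF t(5,6,2)] t(1,3) I_corank[OF assms(1)] by auto
  have "x # us @ vs \<in> nd_simplices (n - 1) (up_set P x)"
    using t g by (auto simp: nd_simplices_def)
  then have "family x n us vs \<in> compatible_families P rk r x n"
    unfolding compatible_families_def family_def using g by blast
  then have R: "(\<Sum>\<sigma>\<in>family x n us vs. frag_of \<sigma>) \<in> Rel x n"
    unfolding A_rels_def by blast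
  have "((- 1) ^ n * (- 1) ^ Suc (length us)) * ((- 1) ^ n * (- 1) ^ Suc (length us)) = (1::int)"
    by (cases "even n"; cases "even (length us)") auto
  with lookup_signed_boundary_gapped[OF assms(1) g(2-4)] R show ?thesis
    unfolding g(1) by blast
qed

lemma relator_gapped:
  assumes "x \<in> I n" "R \<in> Rel x n"
  shows "\<exists>\<tau>\<in>gapped x n. \<exists>e. e * e = 1 \<and> (\<forall>\<sigma>\<in>Nd x n. lookup (signed_boundary \<sigma>) \<tau> = e * lookup R \<sigma>)"
proof -
  obtain us vs j where g: "R = (\<Sum>\<sigma>\<in>family x n us vs. frag_of \<sigma>)" "j < n"
    "map cr us = map int (rev [Suc j..<n])" "map cr vs = map int (rev [0..<j])"
    "x # us @ vs \<in> nd_simplices (n - 1) (up_set P x)"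
    using assms(2) unfolding A_rels_def compatible_families_def family_def by auto
  have "((- 1) ^ n * (- 1) ^ Suc (length us)) * ((- 1) ^ n * (- 1) ^ Suc (length us)) = (1::int)"
    by (cases "even n"; cases "even (length us)") auto
  moreover have "x # us @ vs \<in> gapped x n"
    using g by (auto simp: gapped_def nd_simplices_def)
  ultimately show ?thesis
    using lookup_signed_boundary_gapped[OF assms(1) g(2-4)] unfolding g(1) by blast
qed

lemma presentation_tensor_at:
  assumes "x \<in> I n"
  shows "presentation_tensor (Nd x n) (Rel x n) (F x)"
proof (intro presentation_tensor.intro presentation.intro presentation_tensor_axioms.intro)
  fix R assume "R \<in> Rel x n"
  then obtain us vs where R: "R = (\<Sum>\<sigma>\<in>family x n us vs. frag_of \<sigma>)"
    unfolding A_rels_def compatible_families_def family_def by auto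
  have "keys R \<subseteq> family x n us vs"
    unfolding R using keys_sum[of frag_of "family x n us vs"] by auto
  also have "\<dots> \<subseteq> Nd x n" by (auto simp: family_def)
  finally show "keys R \<subseteq> Nd x n" .
qed (use comm_group_at finite_Nd I_P[OF assms] in auto)

end

section \<open>The isomorphism\<close>

lemma rel_coboundaries_zero:
  "n = 0 \<Longrightarrow> rel_coboundaries F \<rho> X Y n = {\<one>\<^bsub>rel_cochains F X Y n\<^esub>}"
  by (simp add: rel_coboundaries_def)

lemma rel_coboundaries_Suc:
  "rel_coboundaries F \<rho> X Y (Suc m) = codiff F \<rho> X m ` carrier (rel_cochains F X Y m)"
  by (simp add: rel_coboundaries_def)

context graded_presheaf
begin

text \<open>
  A cochain of degree \<open>n - 1\<close> at \<open>x\<close>.  It takes values in \<open>F x\<close> everywhere and is trivial off the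
  gapped simplices, so that no domain conditions are needed when it is extended linearly.
\<close>

definition gapped_cochain :: "'a \<Rightarrow> nat \<Rightarrow> ('a list \<Rightarrow> 'b) \<Rightarrow> bool" where
  "gapped_cochain x n t \<longleftrightarrow>
     (\<forall>\<tau>. t \<tau> \<in> carrier (F x)) \<and> (\<forall>\<tau>. \<tau> \<notin> gapped x n \<longrightarrow> t \<tau> = \<one>\<^bsub>F x\<^esub>)"

definition local_codiff :: "'a \<Rightarrow> nat \<Rightarrow> ('a list \<Rightarrow> 'b) \<Rightarrow> 'a list \<Rightarrow> 'b" where
  "local_codiff x n t = (\<lambda>\<sigma>\<in>Nd x n. lin (F x) t (signed_boundary \<sigma>))"

text \<open>
  A local coboundary is the sum over gapped simplices \<open>\<tau>\<close> of the relator of \<open>\<tau>\<close> times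
  \<open>\<plusminus> t \<tau>\<close>.
\<close>

lemma local_codiff_mem_K:
  assumes "x \<in> I n" "gapped_cochain x n t"
  shows "local_codiff x n t \<in> presentation_tensor.K (Nd x n) (Rel x n) (F x)"
proof -
  interpret E: presentation_tensor "Nd x n" "Rel x n" "F x" by (rule presentation_tensor_at[OF assms(1)])
  have tc: "t \<tau> \<in> carrier (F x)" for \<tau> using assms(2) by (simp add: gapped_cochain_def)
  have t1: "t \<tau> = \<one>\<^bsub>F x\<^esub>" if "\<tau> \<notin> gapped x n" for \<tau> using assms(2) that by (simp add: gapped_cochain_def)
  define g where "g = (\<lambda>\<tau>. \<lambda>\<sigma>\<in>Nd x n. t \<tau> [^]\<^bsub>F x\<^esub> lookup (signed_boundary \<sigma>) \<tau>)"
  have gW: "g \<in> gapped x n \<rightarrow> carrier E.W" by (auto simp: g_def tc)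
  have "local_codiff x n t = finprod E.W g (gapped x n)"
  proof (rule extensionalityI[of _ "Nd x n"])
    show "local_codiff x n t \<in> extensional (Nd x n)" by (simp add: local_codiff_def)
    have "finprod E.W g (gapped x n) \<in> carrier E.W" by (rule E.W.finprod_closed[OF gW])
    then show "finprod E.W g (gapped x n) \<in> extensional (Nd x n)" by (auto simp: PiE_iff)
    fix \<sigma> assume s: "\<sigma> \<in> Nd x n"
    have fin: "finite (gapped x n)" by (rule finite_gapped[OF I_P[OF assms(1)]])
    have "local_codiff x n t \<sigma> = lin (F x) t (signed_boundary \<sigma>)" using s by (simp add: local_codiff_def)
    also have "\<dots> = finprod (F x) (\<lambda>\<tau>. t \<tau> [^]\<^bsub>F x\<^esub> lookup (signed_boundary \<sigma>) \<tau>) (keys (signed_boundary \<sigma>) \<union> gapped x n)"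
      using fin tc by (intro E.M.lin_superset) auto
    also have "\<dots> = finprod (F x) (\<lambda>\<tau>. t \<tau> [^]\<^bsub>F x\<^esub> lookup (signed_boundary \<sigma>) \<tau>) (gapped x n)"
      using fin tc t1 by (intro E.M.finprod_mono_neutral_cong_right) auto
    also have "\<dots> = finprod (F x) (\<lambda>\<tau>. g \<tau> \<sigma>) (gapped x n)"
      using s tc by (intro E.M.finprod_cong') (auto simp: g_def)
    also have "\<dots> = finprod E.W g (gapped x n) \<sigma>"
      by (rule E.finprod_W_apply[OF s gW, symmetric])
    finally show "local_codiff x n t \<sigma> = finprod E.W g (gapped x n) \<sigma>" .
  qed
  also have "\<dots> \<in> E.K"
  proof (rule E.W.finprod_mem_subgroup[OF E.K_subgroup])
    fix \<tau> assume "\<tau> \<in> gapped x n"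
    from gapped_relator[OF assms(1) this] obtain R e where R: "R \<in> Rel x n"
      "\<And>\<sigma>. \<sigma> \<in> Nd x n \<Longrightarrow> lookup (signed_boundary \<sigma>) \<tau> = e * lookup R \<sigma>" by blast
    have "g \<tau> = E.scal R (t \<tau> [^]\<^bsub>F x\<^esub> e)"
      unfolding g_def E.scal_def by (rule restrict_ext) (simp add: R(2) E.M.int_pow_pow tc)
    also have "\<dots> \<in> E.K"
      using R(1) tc by (intro E.scal_mem_K generate.incl) auto
    finally show "g \<tau> \<in> E.K" .
  qed
  finally show ?thesis .
qed

text \<open>
  Conversely a relator times \<open>m\<close> is the coboundary of a cochain concentrated on one gapped simplex,
  and local coboundaries are closed under the group operations.
\<close>

lemma K_local_codiff:
  assumes "x \<in> I n" "a \<in> presentation_tensor.K (Nd x n) (Rel x n) (F x)"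
  shows "\<exists>t. gapped_cochain x n t \<and> a = local_codiff x n t"
proof -
  interpret E: presentation_tensor "Nd x n" "Rel x n" "F x" by (rule presentation_tensor_at[OF assms(1)])
  have gen: "\<exists>t. gapped_cochain x n t \<and> E.scal R m = local_codiff x n t"
    if "R \<in> Rel x n" "m \<in> carrier (F x)" for R m
  proof -
    from relator_gapped[OF assms(1) that(1)] obtain \<tau> e where t: "\<tau> \<in> gapped x n" "e * e = 1"
      "\<And>\<sigma>. \<sigma> \<in> Nd x n \<Longrightarrow> lookup (signed_boundary \<sigma>) \<tau> = e * lookup R \<sigma>" by blast
    define f where "f = (\<lambda>\<tau>'. if \<tau>' = \<tau> then m [^]\<^bsub>F x\<^esub> e else \<one>\<^bsub>F x\<^esub>)"
    have "gapped_cochain x n f" using t that by (auto simp: gapped_cochain_def f_def)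
    moreover have "lin (F x) f (signed_boundary \<sigma>) = m [^]\<^bsub>F x\<^esub> lookup R \<sigma>" if "\<sigma> \<in> Nd x n" for \<sigma>
    proof -
      have "lin (F x) f (signed_boundary \<sigma>) = f \<tau> [^]\<^bsub>F x\<^esub> lookup (signed_boundary \<sigma>) \<tau>"
        using \<open>m \<in> carrier (F x)\<close> by (intro E.M.lin_single) (auto simp: f_def)
      also have "\<dots> = m [^]\<^bsub>F x\<^esub> ((e * e) * lookup R \<sigma>)"
        using \<open>m \<in> carrier (F x)\<close> by (simp add: f_def t(3)[OF that] E.M.int_pow_pow mult.assoc)
      finally show ?thesis by (simp add: t(2))
    qed
    then have "E.scal R m = local_codiff x n f"
      unfolding E.scal_def local_codiff_def by (intro restrict_ext) simp
    ultimately show ?thesis by blast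
  qed
  show ?thesis
    using assms(2) unfolding E.K_def
  proof (induction a rule: generate.induct)
    case one
    have "gapped_cochain x n (\<lambda>_. \<one>\<^bsub>F x\<^esub>)" by (simp add: gapped_cochain_def)
    moreover have "\<one>\<^bsub>E.W\<^esub> = local_codiff x n (\<lambda>_. \<one>\<^bsub>F x\<^esub>)"
      by (auto simp: local_codiff_def E.M.lin_one_fun intro!: restrict_ext)
    ultimately show ?case by blast
  next
    case (incl h)
    then show ?case using gen by auto
  next
    case (inv h)
    then obtain R m where h: "h = E.scal R m" "R \<in> Rel x n" "m \<in> carrier (F x)" by auto
    then have "inv\<^bsub>E.W\<^esub> h = E.scal R (inv\<^bsub>F x\<^esub> m)"
      using group_hom.hom_inv[of "F x" E.W "E.scal R" m] E.scal_hom_right[of R] E.M.is_group E.W.is_group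
      by (simp add: group_hom_def group_hom_axioms_def)
    then show ?case using gen[OF h(2) E.M.inv_closed[OF h(3)]] by simp
  next
    case (eng a b)
    then obtain t u where t: "gapped_cochain x n t" "a = local_codiff x n t"
      and u: "gapped_cochain x n u" "b = local_codiff x n u" by blast
    have "gapped_cochain x n (\<lambda>\<tau>. t \<tau> \<otimes>\<^bsub>F x\<^esub> u \<tau>)"
      using t(1) u(1) by (simp add: gapped_cochain_def)
    moreover have "a \<otimes>\<^bsub>E.W\<^esub> b = local_codiff x n (\<lambda>\<tau>. t \<tau> \<otimes>\<^bsub>F x\<^esub> u \<tau>)"
      unfolding t(2) u(2) using t(1) u(1)
      by (auto simp: local_codiff_def gapped_cochain_def intro!: restrict_ext E.M.lin_mult_fun[symmetric])
    ultimately show ?case by blast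
  qed
qed

text \<open>
  The face that deletes \<open>x\<close> lies in the smaller skeleton, where a relative cochain vanishes; all
  other faces are gapped simplices starting at \<open>x\<close>.
\<close>

lemma codiff_on_Nd:
  assumes x: "x \<in> I (Suc m)" and t: "t \<in> carrier (pr.RC (Suc m) m)" and s: "\<sigma> \<in> Nd x (Suc m)"
  shows "pr.dX (Suc m) m t \<sigma> =
    lin (F x) (\<lambda>\<tau>. if \<tau> \<in> gapped x (Suc m) then t \<tau> else \<one>\<^bsub>F x\<^esub>) (signed_boundary \<sigma>)"
proof -
  let ?X = "Sk (Suc m)"
  have sig: "\<sigma> \<in> simplices (Suc m) ?X" "sorted_wrt (<) \<sigma>" "hd \<sigma> = x"
    using s Nd_iff[OF x] by auto
  have xP: "x \<in> P" by (rule I_P[OF x])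
  interpret G: comm_group "F x" by (rule comm_group_at[OF xP])
  have "pr.dX (Suc m) m t \<sigma> = ev x t (signed_boundary \<sigma>)"
    using codiff_eq[OF Sk_subset(2) pr.RC_cochain[OF t] sig(1)] sig(3) by simp
  also have "\<dots> = lin (F x) (\<lambda>\<tau>. if \<tau> \<in> gapped x (Suc m) then t \<tau> else \<one>\<^bsub>F x\<^esub>) (signed_boundary \<sigma>)"
    unfolding ev_def
  proof (rule G.lin_cong[symmetric])
    show "(\<lambda>\<tau>. \<rho> (hd \<tau>) x (t \<tau>)) \<in> keys (signed_boundary \<sigma>) \<rightarrow> carrier (F x)"
      using ev_terms[OF Sk_subset(2) pr.RC_cochain[OF t] xP] keys_signed_boundary_simplex[OF sig(1)] sig(3) by blast
    fix \<tau> assume tk: "\<tau> \<in> keys (signed_boundary \<sigma>)"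
    then have tau: "\<tau> \<in> simplices m ?X" "x \<le> hd \<tau>"
      using keys_signed_boundary_simplex[OF sig(1)] sig(3) by (auto simp: simplices_above_def)
    have sub: "set \<tau> \<subseteq> set \<sigma>" "sorted_wrt (<) \<tau>"
      using subseq_keys_boundary[of \<tau> \<sigma> "(<)"] tk sig(2) by (auto simp: keys_signed_boundary)
    have yP: "hd \<tau> \<in> P" using hd_simplex[OF tau(1)] Sk_subset(2) by blast
    show "(if \<tau> \<in> gapped x (Suc m) then t \<tau> else \<one>\<^bsub>F x\<^esub>) = \<rho> (hd \<tau>) x (t \<tau>)"
    proof (cases "hd \<tau> = x")
      case True
      then have "\<tau> \<in> gapped x (Suc m)"
        using tau sub s by (auto simp: gapped_def simplices_def nd_simplices_def)
      then show ?thesis using map_id[OF xP] pr.RC_apply[OF t tau(1)] True by simp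
    next
      case False
      then have notg: "\<tau> \<notin> gapped x (Suc m)" by (simp add: gapped_def)
      have "x < hd \<tau>" using False tau(2) by auto
      then have "cr (hd \<tau>) < int (Suc m)" using corank_less[OF xP yP] I_corank[OF x] by simp
      moreover have "cr v \<le> cr (hd \<tau>)" if "v \<in> set \<tau>" for v
        using that hd_le_simplex[OF tau(1) that] tau(1) Sk_subset(2)[of "Suc m"] yP
        by (intro corank_le) (auto simp: simplices_def)
      ultimately have "\<tau> \<in> simplices m (Sk' (Suc m))"
        using tau(1) by (force simp: simplices_def skel_def)
      then have "t \<tau> = \<one>\<^bsub>F (hd \<tau>)\<^esub>" using iffD1[OF pr.RC_iff t] by blast
      then show ?thesis
        using notg hom_one[OF map_hom[OF xP yP tau(2)]] comm_group_at[OF yP] G.is_group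
        by (simp add: comm_group.axioms)
    qed
  qed
  finally show ?thesis .
qed

abbreviation "TA n x \<equiv> tensor_group (A_group P rk r x n) (F x)"
abbreviation "target n \<equiv> product_group (I n) (TA n)"
abbreviation "Ph x n \<equiv> presentation_tensor.Phi (Nd x n) (Rel x n) (F x)"

lemma Ph_hom: "x \<in> I n \<Longrightarrow> Ph x n \<in> hom (product_group (Nd x n) (\<lambda>_. F x)) (TA n x)"
  using presentation_tensor.Phi_hom[OF presentation_tensor_at] by (simp add: A_group_def)

lemma Ph_surj: "x \<in> I n \<Longrightarrow> Ph x n ` carrier (product_group (Nd x n) (\<lambda>_. F x)) = carrier (TA n x)"
  using presentation_tensor.Phi_surj[OF presentation_tensor_at] by (simp add: A_group_def)

lemma TA_comm_group:
  assumes "x \<in> I n"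
  shows "comm_group (TA n x)"
proof -
  interpret E: presentation_tensor "Nd x n" "Rel x n" "F x" by (rule presentation_tensor_at[OF assms])
  show ?thesis using E.T.comm_group_axioms by (simp add: A_group_def)
qed

lemma target_comm_group: "comm_group (target n)"
  by (rule comm_group_product_group) (rule TA_comm_group)

lemma Ph_kernel:
  assumes "x \<in> I n" "a \<in> carrier (product_group (Nd x n) (\<lambda>_. F x))"
  shows "Ph x n a = \<one>\<^bsub>TA n x\<^esub> \<longleftrightarrow> a \<in> presentation_tensor.K (Nd x n) (Rel x n) (F x)"
  using presentation_tensor.kernel_Phi[OF presentation_tensor_at[OF assms(1)]] assms(2)
  by (auto simp: A_group_def kernel_def)

text \<open>
  On cocycles this is \<open>s \<mapsto> (\<Sum>\<sigma>. \<sigma> \<otimes> s \<sigma>)_x\<close>; it induces the isomorphism on cohomology.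
\<close>

definition cell_map :: "nat \<Rightarrow> ('a list \<Rightarrow> 'b) \<Rightarrow> 'a \<Rightarrow> (('a list \<Rightarrow>\<^sub>0 int) set \<times> 'b \<Rightarrow>\<^sub>0 int) set" where
  "cell_map n s = (\<lambda>x\<in>I n. Ph x n (restrict s (Nd x n)))"

lemma restrict_Nd_closed:
  assumes "x \<in> I n" "s \<in> carrier (cochains F (Sk n) n)"
  shows "restrict s (Nd x n) \<in> carrier (product_group (Nd x n) (\<lambda>_. F x))"
proof -
  have "s \<sigma> \<in> carrier (F x)" if "\<sigma> \<in> Nd x n" for \<sigma>
    using that Nd_iff[OF assms(1)] cochain_apply[OF assms(2), of \<sigma>] by auto
  then show ?thesis by simp
qed

lemma restrict_Nd_mult:
  assumes "x \<in> I n"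
  shows "restrict (s \<otimes>\<^bsub>cochains F (Sk n) n\<^esub> t) (Nd x n) =
    restrict s (Nd x n) \<otimes>\<^bsub>product_group (Nd x n) (\<lambda>_. F x)\<^esub> restrict t (Nd x n)"
proof -
  have "(s \<otimes>\<^bsub>cochains F (Sk n) n\<^esub> t) \<sigma> = s \<sigma> \<otimes>\<^bsub>F x\<^esub> t \<sigma>" if "\<sigma> \<in> Nd x n" for \<sigma>
    using that Nd_iff[OF assms] cochain_mult_apply[of \<sigma> n "Sk n" s t] by auto
  then show ?thesis by (auto intro!: restrict_ext)
qed

lemma cell_map_hom: "cell_map n \<in> hom (pr.RZ n n) (target n)"
proof (rule homI)
  fix s assume "s \<in> carrier (pr.RZ n n)"
  then have s: "s \<in> carrier (cochains F (Sk n) n)" using pr.RC_cochain pr.RZ_RC by blast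
  show "cell_map n s \<in> carrier (target n)"
    using hom_in_carrier[OF Ph_hom restrict_Nd_closed[OF _ s]] by (simp add: cell_map_def)
  fix t assume "t \<in> carrier (pr.RZ n n)"
  then have t: "t \<in> carrier (cochains F (Sk n) n)" using pr.RC_cochain pr.RZ_RC by blast
  have "cell_map n (s \<otimes>\<^bsub>pr.RZ n n\<^esub> t) = (\<lambda>x\<in>I n. Ph x n (restrict s (Nd x n)) \<otimes>\<^bsub>TA n x\<^esub> Ph x n (restrict t (Nd x n)))"
    unfolding cell_map_def pr.mult_RZ
  proof (rule restrict_ext)
    fix x assume x: "x \<in> I n"
    show "Ph x n (restrict (s \<otimes>\<^bsub>cochains F (Sk n) n\<^esub> t) (Nd x n)) =
        Ph x n (restrict s (Nd x n)) \<otimes>\<^bsub>TA n x\<^esub> Ph x n (restrict t (Nd x n))"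
      unfolding restrict_Nd_mult[OF x]
      by (rule hom_mult[OF Ph_hom[OF x] restrict_Nd_closed[OF x s] restrict_Nd_closed[OF x t]])
  qed
  also have "\<dots> = cell_map n s \<otimes>\<^bsub>target n\<^esub> cell_map n t"
    by (auto simp: cell_map_def intro!: restrict_ext)
  finally show "cell_map n (s \<otimes>\<^bsub>pr.RZ n n\<^esub> t) = cell_map n s \<otimes>\<^bsub>target n\<^esub> cell_map n t" .
qed

lemma cell_map_eq_one_iff:
  assumes "s \<in> carrier (pr.RZ n n)"
  shows "cell_map n s = \<one>\<^bsub>target n\<^esub> \<longleftrightarrow>
    (\<forall>x\<in>I n. restrict s (Nd x n) \<in> presentation_tensor.K (Nd x n) (Rel x n) (F x))"
proof -
  have s: "s \<in> carrier (cochains F (Sk n) n)" using assms pr.RC_cochain pr.RZ_RC by blast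
  have "cell_map n s = \<one>\<^bsub>target n\<^esub> \<longleftrightarrow> (\<forall>x\<in>I n. Ph x n (restrict s (Nd x n)) = \<one>\<^bsub>TA n x\<^esub>)"
    by (auto simp: cell_map_def restrict_def fun_eq_iff)
  then show ?thesis using Ph_kernel[OF _ restrict_Nd_closed[OF _ s]] by simp
qed

lemma cell_map_coboundary:
  assumes "t \<in> carrier (pr.RC (Suc m) m)"
  shows "cell_map (Suc m) (pr.dX (Suc m) m t) = \<one>\<^bsub>target (Suc m)\<^esub>"
  unfolding cell_map_eq_one_iff[OF pr.codiff_RZ[OF assms]]
proof
  fix x assume x: "x \<in> I (Suc m)"
  interpret G: comm_group "F x" by (rule comm_group_at[OF I_P[OF x]])
  define t' where "t' = (\<lambda>\<tau>. if \<tau> \<in> gapped x (Suc m) then t \<tau> else \<one>\<^bsub>F x\<^esub>)"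
  have "t \<tau> \<in> carrier (F x)" if "\<tau> \<in> gapped x (Suc m)" for \<tau>
  proof -
    have "\<tau> \<in> simplices m (Sk (Suc m))"
      using that corank_le[OF I_P[OF x]] I_corank[OF x]
      by (fastforce simp: gapped_def simplices_def skel_def up_set_def intro: sorted_wrt_mono_rel[of _ "(<)"])
    then show ?thesis using pr.RC_apply[OF assms, of \<tau>] that by (simp add: gapped_def)
  qed
  then have "gapped_cochain x (Suc m) t'" by (simp add: gapped_cochain_def t'_def)
  from local_codiff_mem_K[OF x this]
  have "local_codiff x (Suc m) t' \<in> presentation_tensor.K (Nd x (Suc m)) (Rel x (Suc m)) (F x)" .
  also have "local_codiff x (Suc m) t' = restrict (pr.dX (Suc m) m t) (Nd x (Suc m))"
    unfolding local_codiff_def using codiff_on_Nd[OF x assms] by (intro restrict_ext) (simp add: t'_def)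
  finally show "restrict (pr.dX (Suc m) m t) (Nd x (Suc m))
      \<in> presentation_tensor.K (Nd x (Suc m)) (Rel x (Suc m)) (F x)" .
qed

text \<open>
  Arbitrary values on the non-degenerate \<open>n\<close>-simplices, extended by zero, form a cocycle: every
  \<open>(n+1)\<close>-simplex of the \<open>n\<close>-skeleton is degenerate, and normalised cochains have normalised
  coboundaries.
\<close>

lemma strict_cochain_cocycle:
  assumes "\<And>x \<sigma>. x \<in> I n \<Longrightarrow> \<sigma> \<in> Nd x n \<Longrightarrow> w \<sigma> \<in> carrier (F x)"
  shows "(\<lambda>\<sigma>\<in>simplices n (Sk n). if sorted_wrt (<) \<sigma> then w \<sigma> else \<one>\<^bsub>F (hd \<sigma>)\<^esub>) \<in> carrier (pr.RZ n n)"
    (is "?s \<in> _")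
proof -
  have strict: "hd \<sigma> \<in> I n \<and> \<sigma> \<in> Nd (hd \<sigma>) n" if "\<sigma> \<in> simplices n (Sk n)" "sorted_wrt (<) \<sigma>" for \<sigma>
    using strict_simplex_hd[OF that] Nd_iff that by blast
  have s: "?s \<in> carrier (pr.RC n n)"
    unfolding pr.RC_iff
  proof
    have "(if sorted_wrt (<) \<sigma> then w \<sigma> else \<one>\<^bsub>F (hd \<sigma>)\<^esub>) \<in> carrier (F (hd \<sigma>))"
      if "\<sigma> \<in> simplices n (Sk n)" for \<sigma>
    proof -
      interpret G: comm_group "F (hd \<sigma>)" by (rule pr.group_at[OF that])
      show ?thesis using strict[OF that] assms by auto
    qed
    then show "?s \<in> carrier (cochains F (Sk n) n)" by (simp add: cochains_def)
    show "\<forall>\<sigma>\<in>simplices n (Sk' n). ?s \<sigma> = \<one>\<^bsub>F (hd \<sigma>)\<^esub>"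
    proof
      fix \<sigma> assume s: "\<sigma> \<in> simplices n (Sk' n)"
      then have sX: "\<sigma> \<in> simplices n (Sk n)" using simplices_mono[OF Sk_subset(1)] by blast
      have "hd \<sigma> \<notin> I n" using hd_simplex[OF s] by (simp add: skel_def corank_set_def)
      then have "\<not> sorted_wrt (<) \<sigma>" using strict[OF sX] by blast
      then show "?s \<sigma> = \<one>\<^bsub>F (hd \<sigma>)\<^esub>" using sX by simp
    qed
  qed
  show ?thesis
    unfolding pr.RZ_iff_pointwise
  proof (intro conjI s ballI)
    fix \<sigma> assume sig: "\<sigma> \<in> simplices (Suc n) (Sk n)"
    show "pr.dX n n ?s \<sigma> = \<one>\<^bsub>F (hd \<sigma>)\<^esub>"
      by (rule pr.normalised_cocycle[OF s _ sig no_strict_simplex[OF sig]]) simp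
  qed
qed

lemma cell_map_surj: "cell_map n ` carrier (pr.RZ n n) = carrier (target n)"
proof
  show "cell_map n ` carrier (pr.RZ n n) \<subseteq> carrier (target n)"
    using hom_in_carrier[OF cell_map_hom] by blast
  show "carrier (target n) \<subseteq> cell_map n ` carrier (pr.RZ n n)"
  proof
    fix u assume u: "u \<in> carrier (target n)"
    have "\<exists>a\<in>carrier (product_group (Nd x n) (\<lambda>_. F x)). Ph x n a = u x" if "x \<in> I n" for x
    proof -
      have "u x \<in> carrier (TA n x)" using u that by auto
      then show ?thesis unfolding Ph_surj[OF that, symmetric] by auto
    qed
    then obtain a where a: "\<And>x. x \<in> I n \<Longrightarrow> a x \<in> carrier (product_group (Nd x n) (\<lambda>_. F x))"
      "\<And>x. x \<in> I n \<Longrightarrow> Ph x n (a x) = u x" by metis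
    define s where "s = (\<lambda>\<sigma>\<in>simplices n (Sk n). if sorted_wrt (<) \<sigma> then a (hd \<sigma>) \<sigma> else \<one>\<^bsub>F (hd \<sigma>)\<^esub>)"
    have "a (hd \<sigma>) \<sigma> \<in> carrier (F x)" if "x \<in> I n" "\<sigma> \<in> Nd x n" for x \<sigma>
      using a(1)[OF that(1)] that Nd_hd[OF that] by auto
    then have s: "s \<in> carrier (pr.RZ n n)" unfolding s_def by (rule strict_cochain_cocycle)
    have "restrict s (Nd x n) = a x" if x: "x \<in> I n" for x
    proof (rule extensionalityI[of _ "Nd x n"])
      show "a x \<in> extensional (Nd x n)" using a(1)[OF x] by (auto simp: PiE_iff)
      fix \<sigma> assume "\<sigma> \<in> Nd x n"
      then show "restrict s (Nd x n) \<sigma> = a x \<sigma>" using Nd_iff[OF x, of \<sigma>] by (auto simp: s_def)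
    qed simp
    then have "cell_map n s x = u x" if "x \<in> I n" for x using that a(2) by (simp add: cell_map_def)
    then have "cell_map n s = u"
      using u by (intro extensionalityI[of _ "I n"]) (auto simp: cell_map_def PiE_iff)
    then show "u \<in> cell_map n ` carrier (pr.RZ n n)" using s by blast
  qed
qed

text \<open>
  Coboundaries are local coboundaries at each \<open>x\<close>, hence die.  Conversely, normalise a cocycle in
  the kernel; at each \<open>x\<close> it is a local coboundary, and the local cochains glue to a global one
  because a gapped simplex determines its first vertex.  In degree \<open>0\<close> every simplex is
  non-degenerate and local coboundaries are trivial.
\<close>

lemma cell_map_kernel: "kernel (pr.RZ n n) (target n) (cell_map n) = pr.RB n n"
proof
  show "pr.RB n n \<subseteq> kernel (pr.RZ n n) (target n) (cell_map n)"
  proof (cases n)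
    case 0
    have "cell_map n \<one>\<^bsub>pr.RZ n n\<^esub> = \<one>\<^bsub>target n\<^esub>"
      by (rule hom_one[OF cell_map_hom pr.RZ.is_group comm_group.axioms(2)[OF target_comm_group]])
    moreover have "\<one>\<^bsub>pr.RZ n n\<^esub> \<in> carrier (pr.RZ n n)" by (rule pr.RZ.one_closed)
    moreover have "pr.RB n n = {\<one>\<^bsub>pr.RZ n n\<^esub>}"
      unfolding rel_coboundaries_zero[OF 0] pr.one_RC pr.one_RZ ..
    ultimately show ?thesis by (simp add: kernel_def)
  next
    case (Suc m)
    show ?thesis
      unfolding Suc rel_coboundaries_Suc kernel_def using cell_map_coboundary pr.codiff_RZ by blast
  qed
  show "kernel (pr.RZ n n) (target n) (cell_map n) \<subseteq> pr.RB n n"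
  proof
    fix s assume "s \<in> kernel (pr.RZ n n) (target n) (cell_map n)"
    then have s: "s \<in> carrier (pr.RZ n n)" "cell_map n s = \<one>\<^bsub>target n\<^esub>" by (auto simp: kernel_def)
    show "s \<in> pr.RB n n"
    proof (cases n)
      case 0
      have "s = \<one>\<^bsub>cochains F (Sk n) n\<^esub>"
      proof (rule cochain_eqI[OF pr.RC_cochain[OF pr.RZ_RC[OF s(1)]] pr.CX.one_closed])
        fix \<sigma> assume sig: "\<sigma> \<in> simplices n (Sk n)"
        then have "sorted_wrt (<) \<sigma>" using 0 by (cases \<sigma>) (auto simp: simplices_def)
        then have x: "hd \<sigma> \<in> I n" "\<sigma> \<in> Nd (hd \<sigma>) n"
          using strict_simplex_hd[OF sig] Nd_iff sig by blast+
        interpret G: comm_group "F (hd \<sigma>)" by (rule pr.group_at[OF sig])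
        obtain t where t: "gapped_cochain (hd \<sigma>) n t" "restrict s (Nd (hd \<sigma>) n) = local_codiff (hd \<sigma>) n t"
          using K_local_codiff[OF x(1)] s cell_map_eq_one_iff[OF s(1)] x(1) by blast
        have "t \<tau> = \<one>\<^bsub>F (hd \<sigma>)\<^esub>" for \<tau>
          using t(1) 0 by (simp add: gapped_cochain_def gapped_def)
        then have "local_codiff (hd \<sigma>) n t \<sigma> = \<one>\<^bsub>F (hd \<sigma>)\<^esub>"
          using x(2) by (simp add: local_codiff_def G.lin_one_fun)
        then have "s \<sigma> = \<one>\<^bsub>F (hd \<sigma>)\<^esub>" using x(2) by (simp flip: t(2))
        then show "s \<sigma> = \<one>\<^bsub>cochains F (Sk n) n\<^esub> \<sigma>" using sig by (simp add: cochains_def)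
      qed
      then show ?thesis unfolding rel_coboundaries_zero[OF 0] pr.one_RC by simp
    next
      case (Suc m)
      have s': "s \<in> carrier (pr.RZ (Suc m) (Suc m))" using s(1) Suc by simp
      obtain t0 s1 where t0: "t0 \<in> carrier (pr.RC (Suc m) m)" and s1: "s1 \<in> carrier (pr.RZ (Suc m) (Suc m))"
        and eq: "s = s1 \<otimes>\<^bsub>pr.RZ (Suc m) (Suc m)\<^esub> pr.dX (Suc m) m t0"
        and norm: "\<And>\<sigma>. \<sigma> \<in> simplices (Suc m) (Sk (Suc m)) \<Longrightarrow> \<not> sorted_wrt (<) \<sigma> \<Longrightarrow> s1 \<sigma> = \<one>\<^bsub>F (hd \<sigma>)\<^esub>"
        using pr.normalise[OF s'] by blast
      interpret T: comm_group "target (Suc m)" by (rule target_comm_group)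
      have "cell_map (Suc m) s = cell_map (Suc m) s1 \<otimes>\<^bsub>target (Suc m)\<^esub> cell_map (Suc m) (pr.dX (Suc m) m t0)"
        unfolding eq by (rule hom_mult[OF cell_map_hom s1 pr.codiff_RZ[OF t0]])
      also have "\<dots> = cell_map (Suc m) s1"
        unfolding cell_map_coboundary[OF t0] by (rule T.r_one[OF hom_in_carrier[OF cell_map_hom s1]])
      finally have "cell_map (Suc m) s1 = \<one>\<^bsub>target (Suc m)\<^esub>" using s(2) Suc by simp
      then have "\<exists>t. gapped_cochain x (Suc m) t \<and> restrict s1 (Nd x (Suc m)) = local_codiff x (Suc m) t"
        if "x \<in> I (Suc m)" for x
        using K_local_codiff[OF that] cell_map_eq_one_iff[OF s1] that by blast
      then obtain t where t: "\<And>x. x \<in> I (Suc m) \<Longrightarrow> gapped_cochain x (Suc m) (t x)"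
        "\<And>x. x \<in> I (Suc m) \<Longrightarrow> restrict s1 (Nd x (Suc m)) = local_codiff x (Suc m) (t x)" by metis
      \<comment> \<open>glue: a gapped simplex is governed by the local cochain at its first vertex\<close>
      define tg where "tg = (\<lambda>\<tau>\<in>simplices m (Sk (Suc m)).
        if hd \<tau> \<in> I (Suc m) \<and> \<tau> \<in> gapped (hd \<tau>) (Suc m) then t (hd \<tau>) \<tau> else \<one>\<^bsub>F (hd \<tau>)\<^esub>)"
      have tg: "tg \<in> carrier (pr.RC (Suc m) m)"
        unfolding pr.RC_iff
      proof
        have "(if hd \<tau> \<in> I (Suc m) \<and> \<tau> \<in> gapped (hd \<tau>) (Suc m) then t (hd \<tau>) \<tau> else \<one>\<^bsub>F (hd \<tau>)\<^esub>)
            \<in> carrier (F (hd \<tau>))" if "\<tau> \<in> simplices m (Sk (Suc m))" for \<tau>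
        proof -
          interpret G: comm_group "F (hd \<tau>)" by (rule pr.group_at[OF that])
          show ?thesis using t(1)[of "hd \<tau>"] by (simp add: gapped_cochain_def)
        qed
        then show "tg \<in> carrier (cochains F (Sk (Suc m)) m)" by (simp add: cochains_def tg_def)
        show "\<forall>\<tau>\<in>simplices m (Sk' (Suc m)). tg \<tau> = \<one>\<^bsub>F (hd \<tau>)\<^esub>"
        proof
          fix \<tau> assume tau: "\<tau> \<in> simplices m (Sk' (Suc m))"
          then have tX: "\<tau> \<in> simplices m (Sk (Suc m))" using simplices_mono[OF Sk_subset(1)] by blast
          have "hd \<tau> \<notin> I (Suc m)" using hd_simplex[OF tau] by (simp add: skel_def corank_set_def)
          then show "tg \<tau> = \<one>\<^bsub>F (hd \<tau>)\<^esub>" using tX by (simp add: tg_def)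
        qed
      qed
      have "s1 = pr.dX (Suc m) m tg"
      proof (rule cochain_eqI[OF pr.RC_cochain[OF pr.RZ_RC[OF s1]] codiff_closed[OF Sk_subset(2) pr.RC_cochain[OF tg]]])
        fix \<sigma> assume sig: "\<sigma> \<in> simplices (Suc m) (Sk (Suc m))"
        show "s1 \<sigma> = pr.dX (Suc m) m tg \<sigma>"
        proof (cases "sorted_wrt (<) \<sigma>")
          case False
          have "pr.dX (Suc m) m tg \<sigma> = \<one>\<^bsub>F (hd \<sigma>)\<^esub>"
            by (rule pr.normalised_cocycle[OF tg _ sig False]) (simp add: tg_def gapped_def)
          then show ?thesis using norm[OF sig False] by simp
        next
          case True
          let ?x = "hd \<sigma>"
          have x: "?x \<in> I (Suc m)" "\<sigma> \<in> Nd ?x (Suc m)"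
            using strict_simplex_hd[OF sig True] Nd_iff sig True by blast+
          interpret G: comm_group "F ?x" by (rule pr.group_at[OF sig])
          have "s1 \<sigma> = lin (F ?x) (t ?x) (signed_boundary \<sigma>)"
            using t(2)[OF x(1)] x(2) by (simp add: local_codiff_def restrict_def fun_eq_iff) metis
          also have "\<dots> = lin (F ?x) (\<lambda>\<tau>. if \<tau> \<in> gapped ?x (Suc m) then tg \<tau> else \<one>\<^bsub>F ?x\<^esub>) (signed_boundary \<sigma>)"
          proof (rule G.lin_cong[symmetric])
            show "t ?x \<in> keys (signed_boundary \<sigma>) \<rightarrow> carrier (F ?x)"
              using t(1)[OF x(1)] by (simp add: gapped_cochain_def)
            fix \<tau> assume "\<tau> \<in> keys (signed_boundary \<sigma>)"
            then have "\<tau> \<in> simplices m (Sk (Suc m))"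
              using keys_signed_boundary_simplex[OF sig] by (auto simp: simplices_above_def)
            moreover have "hd \<tau> = ?x" if "\<tau> \<in> gapped ?x (Suc m)" using that by (simp add: gapped_def)
            ultimately show "(if \<tau> \<in> gapped ?x (Suc m) then tg \<tau> else \<one>\<^bsub>F ?x\<^esub>) = t ?x \<tau>"
              using t(1)[OF x(1)] x(1) by (auto simp: tg_def gapped_cochain_def)
          qed
          also have "\<dots> = pr.dX (Suc m) m tg \<sigma>"
            by (rule codiff_on_Nd[OF x(1) tg x(2), symmetric])
          finally show ?thesis .
        qed
      qed
      then have "s = pr.dX (Suc m) m (tg \<otimes>\<^bsub>pr.RC (Suc m) m\<^esub> t0)"
        unfolding eq using hom_mult[OF pr.codiff_RZ_hom tg t0] by simp
      then show ?thesis
        unfolding Suc rel_coboundaries_Suc using pr.RC.m_closed[OF tg t0] by blast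
    qed
  qed
qed

text \<open>
  The value of \<open>cell_map\<close> on any representative of the cohomology class.
\<close>

definition phi :: "nat \<Rightarrow> ('a list \<Rightarrow> 'b) set \<Rightarrow> 'a \<Rightarrow> (('a list \<Rightarrow>\<^sub>0 int) set \<times> 'b \<Rightarrow>\<^sub>0 int) set" where
  "phi n c = the_elem (cell_map n ` c)"

sublocale hm: group_hom "rel_cocycles F \<rho> (Sk n) (Sk' n) n" "target n" "cell_map n" for n
  using cell_map_hom pr.RZ.is_group comm_group.axioms(2)[OF target_comm_group]
  by (simp add: group_hom_def group_hom_axioms_def)

theorem phi_iso: "phi n \<in> iso (cellular_cochains P rk r F \<rho> n) (target n)"
  using hm.FactGroup_iso_set[OF cell_map_surj]
  unfolding phi_def cellular_cochains_def rel_cohomology_def cell_map_kernel .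

end

section \<open>The connecting homomorphism\<close>

text \<open>
  Extension by zero splits the restriction of cochains to a subposet.
\<close>

definition cochain_extend :: "('a::order \<Rightarrow> 'b monoid) \<Rightarrow> 'a set \<Rightarrow> 'a set \<Rightarrow> nat \<Rightarrow> ('a list \<Rightarrow> 'b) \<Rightarrow> 'a list \<Rightarrow> 'b" where
  "cochain_extend F X Y n u = (\<lambda>\<tau>\<in>simplices n X. if \<tau> \<in> simplices n Y then u \<tau> else \<one>\<^bsub>F (hd \<tau>)\<^esub>)"

context presheaf
begin

lemma cochain_extend_closed:
  assumes "Z \<subseteq> Y" "Y \<subseteq> X" "X \<subseteq> P" "u \<in> carrier (rel_cochains F Y Z n)"
  shows "cochain_extend F X Y n u \<in> carrier (rel_cochains F X Z n)"
proof -
  interpret a: presheaf_pair P F \<rho> Y Z by unfold_locales (use assms in auto)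
  interpret b: presheaf_pair P F \<rho> X Z by unfold_locales (use assms in auto)
  have "(if \<tau> \<in> simplices n Y then u \<tau> else \<one>\<^bsub>F (hd \<tau>)\<^esub>) \<in> carrier (F (hd \<tau>))" if "\<tau> \<in> simplices n X" for \<tau>
  proof -
    interpret G: comm_group "F (hd \<tau>)" by (rule b.group_at[OF that])
    show ?thesis using a.RC_apply[OF assms(4)] by simp
  qed
  moreover have "cochain_extend F X Y n u \<sigma> = \<one>\<^bsub>F (hd \<sigma>)\<^esub>" if "\<sigma> \<in> simplices n Z" for \<sigma>
  proof -
    have "\<sigma> \<in> simplices n Y" "\<sigma> \<in> simplices n X" using that simplices_mono assms(1,2) by blast+
    then show ?thesis using that assms(4) by (simp add: cochain_extend_def a.RC_iff)
  qed
  ultimately show ?thesis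
    unfolding b.RC_iff by (simp add: cochain_extend_def cochains_def)
qed

lemma restrict_cochain_extend:
  assumes "Y \<subseteq> X" "u \<in> carrier (cochains F Y n)"
  shows "cochain_restrict Y n (cochain_extend F X Y n u) = u"
proof (rule cochain_eqI[OF _ assms(2)])
  have "u \<in> extensional (simplices n Y)" using assms(2) by (simp add: cochains_def PiE_iff)
  then have "cochain_restrict Y n (cochain_extend F X Y n u) = u"
    using simplices_mono[OF assms(1), of n]
    by (auto simp: cochain_restrict_def cochain_extend_def restrict_def fun_eq_iff extensional_def)
  then show "cochain_restrict Y n (cochain_extend F X Y n u) \<in> carrier (cochains F Y n)"
    using assms(2) by simp
qed (use simplices_mono[OF assms(1), of n] in \<open>auto simp: cochain_restrict_def cochain_extend_def\<close>)

lemma codiff_lift_cocycle: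
  assumes "Z \<subseteq> Y" "Y \<subseteq> X" "X \<subseteq> P" "t \<in> carrier (rel_cochains F X Z n)"
    and "cochain_restrict Y n t \<in> carrier (rel_cocycles F \<rho> Y Z n)"
  shows "codiff F \<rho> X n t \<in> carrier (rel_cocycles F \<rho> X Y (Suc n))"
proof -
  interpret a: presheaf_pair P F \<rho> Y Z by unfold_locales (use assms in auto)
  interpret b: presheaf_pair P F \<rho> X Z by unfold_locales (use assms in auto)
  interpret e: presheaf_pair P F \<rho> X Y by unfold_locales (use assms in auto)
  have t: "t \<in> carrier (cochains F X n)" by (rule b.RC_cochain[OF assms(4)])
  have "codiff F \<rho> X n t \<sigma> = \<one>\<^bsub>F (hd \<sigma>)\<^esub>" if "\<sigma> \<in> simplices (Suc n) Y" for \<sigma>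
    using codiff_restrict[OF assms(2,3) t that] assms(5) that by (simp add: a.RZ_iff_pointwise)
  then show ?thesis
    unfolding e.RZ_iff e.RC_iff using codiff_closed[OF assms(3) t] codiff_codiff[OF assms(3) t] by blast
qed

text \<open>
  A primitive of \<open>b\<close> extends by zero to the larger space, and \<open>d\<close> of the extension restricts to
  \<open>b\<close> and is killed by \<open>d\<close>.  In degree \<open>0\<close> the only coboundary is zero.
\<close>

lemma coboundary_lift:
  assumes "Z \<subseteq> Y" "Y \<subseteq> X" "X \<subseteq> P" "b \<in> rel_coboundaries F \<rho> Y Z n"
  shows "\<exists>v\<in>carrier (rel_cochains F X Z n). cochain_restrict Y n v = b \<and>
    codiff F \<rho> X n v = \<one>\<^bsub>cochains F X (Suc n)\<^esub>"
proof -
  interpret a: presheaf_pair P F \<rho> Y Z by unfold_locales (use assms in auto)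
  interpret b: presheaf_pair P F \<rho> X Z by unfold_locales (use assms in auto)
  interpret e: presheaf_pair P F \<rho> X Y by unfold_locales (use assms in auto)
  show ?thesis
  proof (cases n)
    case 0
    have "b = \<one>\<^bsub>cochains F Y n\<^esub>" using assms(4) unfolding rel_coboundaries_zero[OF 0] a.one_RC by simp
    then have "cochain_restrict Y n \<one>\<^bsub>b.RC n\<^esub> = b" using e.res.hom_one[of n] by simp
    moreover have "codiff F \<rho> X n \<one>\<^bsub>b.RC n\<^esub> = \<one>\<^bsub>cochains F X (Suc n)\<^esub>" using b.d.hom_one[of n] by simp
    ultimately show ?thesis using b.RC.one_closed[of n] by blast
  next
    case (Suc m)
    then obtain u where u: "u \<in> carrier (a.RC m)" "b = codiff F \<rho> Y m u"
      using assms(4) rel_coboundaries_Suc by blast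
    let ?u = "cochain_extend F X Y m u"
    have U: "?u \<in> carrier (b.RC m)" by (rule cochain_extend_closed[OF assms(1-3) u(1)])
    have dU: "codiff F \<rho> X m ?u \<in> carrier (b.RC n)" unfolding Suc by (rule b.codiff_RC_closed[OF U])
    have uY: "u \<in> carrier (cochains F Y m)" by (rule a.RC_cochain[OF u(1)])
    have YP: "Y \<subseteq> P" using assms by blast
    have "cochain_restrict Y n (codiff F \<rho> X m ?u) = b"
    proof (rule cochain_eqI)
      show "cochain_restrict Y n (codiff F \<rho> X m ?u) \<in> carrier (cochains F Y n)"
        by (rule cochain_restrict_closed[OF assms(2) b.RC_cochain[OF dU]])
      show "b \<in> carrier (cochains F Y n)" unfolding u(2) Suc by (rule codiff_closed[OF YP uY])
      fix \<sigma> assume "\<sigma> \<in> simplices n Y"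
      then show "cochain_restrict Y n (codiff F \<rho> X m ?u) \<sigma> = b \<sigma>"
        using codiff_restrict[OF assms(2,3) b.RC_cochain[OF U], of \<sigma>] restrict_cochain_extend[OF assms(2) uY] Suc
        by (simp add: u(2) cochain_restrict_def)
    qed
    moreover have "codiff F \<rho> X n (codiff F \<rho> X m ?u) = \<one>\<^bsub>cochains F X (Suc n)\<^esub>"
      unfolding Suc by (rule codiff_codiff[OF assms(3) b.RC_cochain[OF U]])
    ultimately show ?thesis using dU by blast
  qed
qed

text \<open>
  Two lifts of one class differ, up to the lift of a coboundary, by a cochain \<open>w\<close> that vanishes on
  the smaller space; so their codifferentials differ by a relative coboundary, and the definite
  description in \<open>connecting_hom\<close> has a unique solution.
\<close>

lemma connecting_hom_eq:
  assumes "Z \<subseteq> Y" "Y \<subseteq> X" "X \<subseteq> P" "t \<in> carrier (rel_cochains F X Z n)"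
    and "cochain_restrict Y n t \<in> carrier (rel_cocycles F \<rho> Y Z n)"
  shows "connecting_hom F \<rho> X Y Z n (rel_class F \<rho> Y Z n (cochain_restrict Y n t)) =
    rel_class F \<rho> X Y (Suc n) (codiff F \<rho> X n t)"
proof -
  interpret a: presheaf_pair P F \<rho> Y Z by unfold_locales (use assms in auto)
  interpret b: presheaf_pair P F \<rho> X Z by unfold_locales (use assms in auto)
  interpret e: presheaf_pair P F \<rho> X Y by unfold_locales (use assms in auto)
  let ?s = "cochain_restrict Y n t"
  have dt: "codiff F \<rho> X n t \<in> carrier (e.RZ (Suc n))" by (rule codiff_lift_cocycle[OF assms])
  show ?thesis
    unfolding connecting_hom_def
  proof (rule the_equality)
    show "\<exists>t'\<in>carrier (rel_cochains F X Z n). cochain_restrict Y n t' \<in> rel_class F \<rho> Y Z n ?s \<and>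
        rel_class F \<rho> X Y (Suc n) (codiff F \<rho> X n t) = rel_class F \<rho> X Y (Suc n) (codiff F \<rho> X n t')"
      using assms(4) a.RZ.rcos_self[OF assms(5) a.RB_subgroup] unfolding rel_class_def by blast
  next
    fix c assume "\<exists>t'\<in>carrier (rel_cochains F X Z n). cochain_restrict Y n t' \<in> rel_class F \<rho> Y Z n ?s \<and>
        c = rel_class F \<rho> X Y (Suc n) (codiff F \<rho> X n t')"
    then obtain t' where t': "t' \<in> carrier (b.RC n)" "cochain_restrict Y n t' \<in> rel_class F \<rho> Y Z n ?s"
      "c = rel_class F \<rho> X Y (Suc n) (codiff F \<rho> X n t')" by blast
    obtain b where b: "b \<in> a.RB n" "cochain_restrict Y n t' = b \<otimes>\<^bsub>cochains F Y n\<^esub> ?s"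
      using t'(2) unfolding rel_class_def r_coset_def by auto
    obtain v where v: "v \<in> carrier (b.RC n)" "cochain_restrict Y n v = b"
      "codiff F \<rho> X n v = \<one>\<^bsub>cochains F X (Suc n)\<^esub>"
      using coboundary_lift[OF assms(1-3) b(1)] by blast
    have C: "t \<in> carrier (cochains F X n)" "t' \<in> carrier (cochains F X n)" "v \<in> carrier (cochains F X n)"
      using assms(4) t'(1) v(1) b.RC_cochain by blast+
    let ?vt = "v \<otimes>\<^bsub>cochains F X n\<^esub> t"
    define w where "w = t' \<otimes>\<^bsub>cochains F X n\<^esub> inv\<^bsub>cochains F X n\<^esub> ?vt"
    have vt: "?vt \<in> carrier (cochains F X n)" using C by blast
    have w: "w \<in> carrier (cochains F X n)" unfolding w_def using C vt by blast
    have res_vt: "cochain_restrict Y n ?vt = cochain_restrict Y n t'"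
      using C by (simp add: e.res.hom_mult v(2) b(2))
    interpret CY: comm_group "cochains F Y n" by (rule comm_group_cochains[OF a.XP])
    have "cochain_restrict Y n w = \<one>\<^bsub>cochains F Y n\<^esub>"
      unfolding w_def using C vt cochain_restrict_closed[OF assms(2) C(2)]
      by (simp add: e.res.hom_mult e.res.hom_inv res_vt)
    then have wRC: "w \<in> carrier (e.RC n)"
      using w by (simp add: rel_cochains_def kernel_def)
    have "t' = w \<otimes>\<^bsub>cochains F X n\<^esub> ?vt"
      unfolding w_def using C vt by (simp add: b.CX.m_assoc)
    then have "codiff F \<rho> X n t' = codiff F \<rho> X n w \<otimes>\<^bsub>cochains F X (Suc n)\<^esub> codiff F \<rho> X n ?vt"
      using hom_mult[OF codiff_hom[OF assms(3)] w vt] by simp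
    also have "codiff F \<rho> X n ?vt = codiff F \<rho> X n t"
      using hom_mult[OF codiff_hom[OF assms(3)] C(3,1)] v(3) codiff_closed[OF assms(3) C(1)] by simp
    finally have "codiff F \<rho> X n t' \<in> e.RB (Suc n) #>\<^bsub>e.RZ (Suc n)\<^esub> codiff F \<rho> X n t"
      using wRC unfolding rel_coboundaries_Suc r_coset_def by auto
    then show "c = rel_class F \<rho> X Y (Suc n) (codiff F \<rho> X n t)"
      unfolding t'(3) rel_class_def by (rule e.RZ.repr_independence[OF _ dt e.RB_subgroup, symmetric])
  qed
qed

end

section \<open>The differential\<close>

context graded_presheaf
begin

lemma phi_rel_class:
  assumes "s \<in> carrier (pr.RZ n n)"
  shows "phi n (rel_class F \<rho> (Sk n) (Sk' n) n s) = cell_map n s"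
proof -
  have B: "pr.RB n n \<subseteq> carrier (pr.RZ n n)" by (rule subgroup.subset[OF pr.RB_subgroup])
  have "cell_map n (b \<otimes>\<^bsub>pr.RZ n n\<^esub> s) = cell_map n s" if "b \<in> pr.RB n n" for b
  proof -
    have "cell_map n b = \<one>\<^bsub>target n\<^esub>" using that unfolding cell_map_kernel[symmetric] by (simp add: kernel_def)
    then show ?thesis
      using hm.hom_mult[OF subsetD[OF B that] assms] hm.H.l_one[OF hm.hom_closed[OF assms]] by simp
  qed
  then have "cell_map n c = cell_map n s" if "c \<in> rel_class F \<rho> (Sk n) (Sk' n) n s" for c
    using that unfolding rel_class_def r_coset_def by auto
  moreover have "s \<in> rel_class F \<rho> (Sk n) (Sk' n) n s"
    unfolding rel_class_def by (rule pr.RZ.rcos_self[OF assms pr.RB_subgroup])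
  ultimately have "cell_map n ` rel_class F \<rho> (Sk n) (Sk' n) n s = {cell_map n s}" by blast
  then show ?thesis by (simp add: phi_def)
qed

abbreviation "ext n \<equiv> cochain_extend F (Sk (Suc n)) (Sk n) n"

text \<open>
  A representative of the connecting homomorphism on the class of \<open>s\<close>, obtained from the lift by
  zero.
\<close>

definition lift_codiff :: "nat \<Rightarrow> ('a list \<Rightarrow> 'b) \<Rightarrow> 'a list \<Rightarrow> 'b" where
  "lift_codiff n s = codiff F \<rho> (Sk (Suc n)) n (ext n s)"

lemma Sk_Suc: "skel P rk r (int n + 1) = Sk (Suc n)" "Sk n = Sk' (Suc n)"
  by (simp_all add: add.commute)

lemma Sk_Suc_subset: "Sk n \<subseteq> Sk (Suc n)"
  by (auto simp: skel_def)

lemma extend_facts: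
  assumes "s \<in> carrier (pr.RZ n n)"
  shows "ext n s \<in> carrier (rel_cochains F (Sk (Suc n)) (Sk' n) n)"
    and "cochain_restrict (Sk n) n (ext n s) = s"
    and "ext n s \<in> carrier (cochains F (Sk (Suc n)) n)"
proof -
  show 1: "ext n s \<in> carrier (rel_cochains F (Sk (Suc n)) (Sk' n) n)"
    by (rule cochain_extend_closed[OF Sk_subset(1) Sk_Suc_subset Sk_subset(2) pr.RZ_RC[OF assms]])
  show "cochain_restrict (Sk n) n (ext n s) = s"
    by (rule restrict_cochain_extend[OF Sk_Suc_subset pr.RC_cochain[OF pr.RZ_RC[OF assms]]])
  show "ext n s \<in> carrier (cochains F (Sk (Suc n)) n)"
    using 1 by (simp add: rel_cochains_def kernel_def)
qed

lemma lift_codiff_cocycle: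
  assumes "s \<in> carrier (pr.RZ n n)"
  shows "lift_codiff n s \<in> carrier (pr.RZ (Suc n) (Suc n))"
  unfolding lift_codiff_def Sk_Suc(2)[symmetric]
  using codiff_lift_cocycle[OF Sk_subset(1) Sk_Suc_subset Sk_subset(2) extend_facts(1)[OF assms]]
    extend_facts(2)[OF assms] assms by simp

lemma phi_cellular_diff:
  assumes "s \<in> carrier (pr.RZ n n)"
  shows "phi (Suc n) (cellular_diff P rk r F \<rho> n (rel_class F \<rho> (Sk n) (Sk' n) n s)) =
    cell_map (Suc n) (lift_codiff n s)"
proof -
  have "cellular_diff P rk r F \<rho> n (rel_class F \<rho> (Sk n) (Sk' n) n s) =
      rel_class F \<rho> (Sk (Suc n)) (Sk n) (Suc n) (lift_codiff n s)"
    unfolding cellular_diff_def Sk_Suc(1) lift_codiff_def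
    using connecting_hom_eq[OF Sk_subset(1) Sk_Suc_subset Sk_subset(2) extend_facts(1)[OF assms]]
      extend_facts(2)[OF assms] assms by simp
  then show ?thesis
    using phi_rel_class[OF lift_codiff_cocycle[OF assms]] unfolding Sk_Suc(2) by simp
qed

lemma lift_codiff_mult:
  assumes "s \<in> carrier (pr.RZ n n)" "t \<in> carrier (pr.RZ n n)"
  shows "lift_codiff n (s \<otimes>\<^bsub>pr.RZ n n\<^esub> t) =
    lift_codiff n s \<otimes>\<^bsub>pr.RZ (Suc n) (Suc n)\<^esub> lift_codiff n t"
proof -
  have "ext n (s \<otimes>\<^bsub>cochains F (Sk n) n\<^esub> t) =
      ext n s \<otimes>\<^bsub>cochains F (Sk (Suc n)) n\<^esub> ext n t"
  proof (rule cochain_eqI)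
    show "ext n (s \<otimes>\<^bsub>cochains F (Sk n) n\<^esub> t) \<in> carrier (cochains F (Sk (Suc n)) n)"
      using extend_facts(3)[OF pr.RZ.m_closed[OF assms]] by simp
    show "ext n s \<otimes>\<^bsub>cochains F (Sk (Suc n)) n\<^esub>
        ext n t \<in> carrier (cochains F (Sk (Suc n)) n)"
      by (rule pr.CX.m_closed[OF extend_facts(3)[OF assms(1)] extend_facts(3)[OF assms(2)]])
    fix \<tau> assume t: "\<tau> \<in> simplices n (Sk (Suc n))"
    then have "hd \<tau> \<in> P" using hd_simplex Sk_subset(2) by blast
    then interpret G: comm_group "F (hd \<tau>)" by (rule comm_group_at)
    show "ext n (s \<otimes>\<^bsub>cochains F (Sk n) n\<^esub> t) \<tau> =
        (ext n s \<otimes>\<^bsub>cochains F (Sk (Suc n)) n\<^esub>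
         ext n t) \<tau>"
      using t by (simp add: cochain_mult_apply cochain_extend_def)
  qed
  then show ?thesis
    unfolding lift_codiff_def pr.mult_RZ
    using hom_mult[OF codiff_hom[OF Sk_subset(2)] extend_facts(3)[OF assms(1)] extend_facts(3)[OF assms(2)]] by simp
qed

text \<open>
  In \<open>d(x\<sigma>) = x d(\<sigma>) \<plusminus> \<sigma>\<close> the cone consists of simplices that start at \<open>x\<close>, which is not in
  the \<open>n\<close>-skeleton, so the extension by zero vanishes on them.
\<close>

lemma lift_codiff_apply:
  assumes s: "s \<in> carrier (pr.RZ n n)" and x: "x \<in> I (Suc n)" and sig: "x # \<sigma> \<in> Nd x (Suc n)"
  shows "lift_codiff n s (x # \<sigma>) = \<rho> (hd \<sigma>) x (s \<sigma>) [^]\<^bsub>F x\<^esub> ((- 1) ^ Suc n :: int)"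
proof -
  let ?X = "Sk (Suc n)" and ?t = "ext n s"
  have xs: "x # \<sigma> \<in> simplices (Suc n) ?X" "sorted_wrt (<) (x # \<sigma>)" using sig Nd_iff[OF x] by auto
  have xP: "x \<in> P" by (rule I_P[OF x])
  interpret G: comm_group "F x" by (rule comm_group_at[OF xP])
  have len: "length \<sigma> = Suc n" "\<sigma> \<noteq> []" using xs by (auto simp: simplices_def)
  have "cr v \<le> int n" if "v \<in> set \<sigma>" for v
    using that xs corank_less[OF xP, of v] I_corank[OF x] Sk_subset(2)[of "Suc n"] by (auto simp: simplices_def)
  then have sn: "\<sigma> \<in> simplices n (Sk n)"
    using xs(1) len by (auto simp: simplices_def skel_def)
  have f: "(\<lambda>\<tau>. \<rho> (hd \<tau>) x (?t \<tau>)) \<in> simplices_above x n ?X \<rightarrow> carrier (F x)"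
    by (rule ev_terms[OF Sk_subset(2) extend_facts(3)[OF s] xP])
  have sX: "\<sigma> \<in> simplices_above x n ?X"
    using simplices_mono[OF Sk_Suc_subset] sn xs(1) len(2) by (auto simp: simplices_above_def simplices_def)
  have fs: "\<rho> (hd \<sigma>) x (?t \<sigma>) \<in> carrier (F x)" using f sX by blast
  have ts: "?t \<sigma> = s \<sigma>"
    using sn sX by (simp add: cochain_extend_def simplices_above_def)
  have keys: "keys (cone x (signed_boundary \<sigma>) + frag_cmul ((- 1) ^ Suc n) (frag_of \<sigma>)) \<subseteq> simplices_above x n ?X"
    using keys_signed_boundary_simplex[OF xs(1)] by (simp add: signed_boundary_Cons[OF len(2)] len(1))
  have "keys (frag_cmul ((- 1) ^ Suc n) (frag_of \<sigma>)) \<subseteq> simplices_above x n ?X" using sX by auto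
  from keys_diff_subset[OF keys this]
  have keys2: "keys (cone x (signed_boundary \<sigma>)) \<subseteq> simplices_above x n ?X"
    by (simp only: add_diff_cancel_right')
  have "lift_codiff n s (x # \<sigma>) = ev x ?t (signed_boundary (x # \<sigma>))"
    unfolding lift_codiff_def using codiff_eq[OF Sk_subset(2) extend_facts(3)[OF s] xs(1)] by simp
  also have "signed_boundary (x # \<sigma>) = cone x (signed_boundary \<sigma>) + frag_cmul ((- 1) ^ Suc n) (frag_of \<sigma>)"
    by (simp add: signed_boundary_Cons[OF len(2)] len(1))
  also have "ev x ?t \<dots> = ev x ?t (cone x (signed_boundary \<sigma>)) \<otimes>\<^bsub>F x\<^esub> ev x ?t (frag_cmul ((- 1) ^ Suc n) (frag_of \<sigma>))"
    unfolding ev_def by (rule G.lin_add) (use f keys2 sX in auto)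
  also have "ev x ?t (cone x (signed_boundary \<sigma>)) = \<one>\<^bsub>F x\<^esub>"
    unfolding ev_def
  proof (rule G.lin_one_fun)
    fix \<tau> assume "\<tau> \<in> keys (cone x (signed_boundary \<sigma>))"
    then have "hd \<tau> = x" "\<tau> \<in> simplices n ?X" using keys2 by (auto simp: simplices_above_def)
    moreover have "\<tau> \<notin> simplices n (Sk n)"
      using hd_simplex[of \<tau> n "Sk n"] \<open>hd \<tau> = x\<close> I_corank[OF x] by (auto simp: skel_def)
    ultimately show "\<rho> (hd \<tau>) x (?t \<tau>) = \<one>\<^bsub>F x\<^esub>"
      using map_id[OF xP] by (simp add: cochain_extend_def)
  qed
  also have "ev x ?t (frag_cmul ((- 1) ^ Suc n) (frag_of \<sigma>)) = \<rho> (hd \<sigma>) x (?t \<sigma>) [^]\<^bsub>F x\<^esub> ((- 1) ^ Suc n :: int)"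
  proof -
    have "ev x ?t (frag_cmul ((- 1) ^ Suc n) (frag_of \<sigma>)) = ev x ?t (frag_of \<sigma>) [^]\<^bsub>F x\<^esub> ((- 1) ^ Suc n :: int)"
      unfolding ev_def by (rule G.lin_cmul) (use fs in simp)
    also have "ev x ?t (frag_of \<sigma>) = \<rho> (hd \<sigma>) x (?t \<sigma>)"
      unfolding ev_def by (rule G.lin_frag_of) (rule fs)
    finally show ?thesis .
  qed
  finally show ?thesis
    using fs unfolding ts by (simp only: G.l_one G.int_pow_closed)
qed

abbreviation "delta_entry n y x \<equiv> matrix_element (I n) (TA n) (cellular_cochains P rk r F \<rho> n)
  (phi n) (phi (Suc n)) (cellular_diff P rk r F \<rho> n) y x"

text \<open>
  The inverse of \<open>phi\<close> need not be known explicitly: any cocycle that maps to the given element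
  computes the matrix element.
\<close>

lemma delta_entry_eq:
  assumes "x \<in> I (Suc n)" "s \<in> carrier (pr.RZ n n)" "cell_map n s = factor_incl (I n) (TA n) y u"
  shows "delta_entry n y x u = Ph x (Suc n) (restrict (lift_codiff n s) (Nd x (Suc n)))"
proof -
  let ?c = "rel_class F \<rho> (Sk n) (Sk' n) n s"
  have "?c \<in> carrier (cellular_cochains P rk r F \<rho> n)"
    using assms(2) unfolding cellular_cochains_def rel_cohomology_def rel_class_def FactGroup_def RCOSETS_def by auto
  moreover have "phi n ?c = factor_incl (I n) (TA n) y u"
    using phi_rel_class[OF assms(2)] assms(3) by simp
  moreover have "inj_on (phi n) (carrier (cellular_cochains P rk r F \<rho> n))"
    using phi_iso[of n] by (auto simp: iso_def bij_betw_def)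
  ultimately have "inv_into (carrier (cellular_cochains P rk r F \<rho> n)) (phi n) (factor_incl (I n) (TA n) y u) = ?c"
    by (intro inv_into_f_eq)
  then show ?thesis
    using phi_cellular_diff[OF assms(2)] assms(1) by (simp add: matrix_element_def cell_map_def)
qed

lemma factor_incl_hom:
  assumes "y \<in> I n"
  shows "factor_incl (I n) (TA n) y \<in> hom (TA n y) (target n)"
proof (rule homI)
  fix u assume "u \<in> carrier (TA n y)"
  then have "(if k = y then u else \<one>\<^bsub>TA n k\<^esub>) \<in> carrier (TA n k)" if "k \<in> I n" for k
    using comm_group.axioms(2)[OF TA_comm_group[OF that]] by (simp add: group.is_monoid)
  then show "factor_incl (I n) (TA n) y u \<in> carrier (target n)"
    by (simp add: factor_incl_def)
next
  fix u v
  have "(if k = y then u \<otimes>\<^bsub>TA n y\<^esub> v else \<one>\<^bsub>TA n k\<^esub>) =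
      (if k = y then u else \<one>\<^bsub>TA n k\<^esub>) \<otimes>\<^bsub>TA n k\<^esub> (if k = y then v else \<one>\<^bsub>TA n k\<^esub>)" if "k \<in> I n" for k
    using comm_group.axioms(2)[OF TA_comm_group[OF that]] by (simp add: group.is_monoid)
  then show "factor_incl (I n) (TA n) y (u \<otimes>\<^bsub>TA n y\<^esub> v) =
      factor_incl (I n) (TA n) y u \<otimes>\<^bsub>target n\<^esub> factor_incl (I n) (TA n) y v"
    by (auto simp: factor_incl_def intro!: restrict_ext)
qed

lemma delta_entry_hom:
  assumes x: "x \<in> I (Suc n)" and y: "y \<in> I n"
  shows "delta_entry n y x \<in> hom (TA n y) (TA (Suc n) x)"
proof -
  have rep: "\<exists>s\<in>carrier (pr.RZ n n). cell_map n s = factor_incl (I n) (TA n) y u" if "u \<in> carrier (TA n y)" for u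
    using hom_in_carrier[OF factor_incl_hom[OF y] that] unfolding cell_map_surj[symmetric] by auto
  have closed: "restrict (lift_codiff n s) (Nd x (Suc n)) \<in> carrier (product_group (Nd x (Suc n)) (\<lambda>_. F x))"
    if "s \<in> carrier (pr.RZ n n)" for s
    by (rule restrict_Nd_closed[OF x pr.RC_cochain[OF pr.RZ_RC[OF lift_codiff_cocycle[OF that]]]])
  show ?thesis
  proof (rule homI)
    fix u assume "u \<in> carrier (TA n y)"
    then obtain s where s: "s \<in> carrier (pr.RZ n n)" "cell_map n s = factor_incl (I n) (TA n) y u"
      using rep by blast
    show "delta_entry n y x u \<in> carrier (TA (Suc n) x)"
      unfolding delta_entry_eq[OF x s] by (rule hom_in_carrier[OF Ph_hom[OF x] closed[OF s(1)]])
  next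
    fix u v assume uv: "u \<in> carrier (TA n y)" "v \<in> carrier (TA n y)"
    obtain s where s: "s \<in> carrier (pr.RZ n n)" "cell_map n s = factor_incl (I n) (TA n) y u"
      using rep[OF uv(1)] by blast
    obtain t where t: "t \<in> carrier (pr.RZ n n)" "cell_map n t = factor_incl (I n) (TA n) y v"
      using rep[OF uv(2)] by blast
    have st: "s \<otimes>\<^bsub>pr.RZ n n\<^esub> t \<in> carrier (pr.RZ n n)" using s(1) t(1) by (rule pr.RZ.m_closed)
    have "cell_map n (s \<otimes>\<^bsub>pr.RZ n n\<^esub> t) = factor_incl (I n) (TA n) y (u \<otimes>\<^bsub>TA n y\<^esub> v)"
      unfolding hom_mult[OF cell_map_hom s(1) t(1)] hom_mult[OF factor_incl_hom[OF y] uv] s(2) t(2) ..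
    from delta_entry_eq[OF x st this]
    show "delta_entry n y x (u \<otimes>\<^bsub>TA n y\<^esub> v) = delta_entry n y x u \<otimes>\<^bsub>TA (Suc n) x\<^esub> delta_entry n y x v"
      unfolding lift_codiff_mult[OF s(1) t(1)] unfolding pr.mult_RZ restrict_Nd_mult[OF x]
        hom_mult[OF Ph_hom[OF x] closed[OF s(1)] closed[OF t(1)]] delta_entry_eq[OF x s] delta_entry_eq[OF x t] .
  qed
qed

lemma Ph_single:
  assumes "x \<in> I n" "\<sigma> \<in> Nd x n" "a \<sigma> \<in> carrier (F x)"
    and "\<And>\<sigma>'. \<sigma>' \<in> Nd x n \<Longrightarrow> \<sigma>' \<noteq> \<sigma> \<Longrightarrow> a \<sigma>' = \<one>\<^bsub>F x\<^esub>"
  shows "Ph x n a = pure_tensor (A_group P rk r x n) (F x) (A_gen P rk r x n \<sigma>) (a \<sigma>)"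
  unfolding A_group_def A_gen_def
  by (rule presentation_tensor.Phi_single[OF presentation_tensor_at[OF assms(1)], of \<sigma> a, OF assms(2-4)])

text \<open>
  The element \<open>\<sigma> \<otimes> a\<close> of the factor \<open>y\<close> is represented by the cochain with value \<open>a\<close> at \<open>\<sigma>\<close> and
  zero elsewhere; its lifted coboundary is concentrated, among the chains starting at \<open>x\<close>, on
  \<open>x\<sigma>\<close>.
\<close>

lemma delta_entry_pure_tensor:
  assumes x: "x \<in> I (Suc n)" and y: "y \<in> I n" and cov: "covers P x y"
    and sig: "\<sigma> \<in> Nd y n" and a: "a \<in> carrier (F y)"
  shows "delta_entry n y x (pure_tensor (A_group P rk r y n) (F y) (A_gen P rk r y n \<sigma>) a) =
    pure_tensor (A_group P rk r x (Suc n)) (F x) (A_gen P rk r x (Suc n) (x # \<sigma>))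
      (\<rho> y x a [^]\<^bsub>F x\<^esub> ((- 1) ^ Suc n :: int))"
proof -
  have P: "x \<in> P" "y \<in> P" and xy: "x < y" using cov by (auto simp: covers_def)
  interpret Gx: comm_group "F x" by (rule comm_group_at[OF P(1)])
  interpret Gy: comm_group "F y" by (rule comm_group_at[OF P(2)])
  have hds: "hd \<sigma> = y" by (rule Nd_hd[OF y sig])
  define w where "w = (\<lambda>\<sigma>'. if \<sigma>' = \<sigma> then a else \<one>\<^bsub>F (hd \<sigma>')\<^esub>)"
  define s where "s = (\<lambda>\<sigma>'\<in>simplices n (Sk n). if sorted_wrt (<) \<sigma>' then w \<sigma>' else \<one>\<^bsub>F (hd \<sigma>')\<^esub>)"
  have "w \<sigma>' \<in> carrier (F z)" if "z \<in> I n" "\<sigma>' \<in> Nd z n" for z \<sigma>'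
  proof -
    interpret Gz: comm_group "F z" by (rule comm_group_at[OF I_P[OF that(1)]])
    show ?thesis using Nd_hd[OF that] a hds by (auto simp: w_def)
  qed
  then have s: "s \<in> carrier (pr.RZ n n)" unfolding s_def by (rule strict_cochain_cocycle)
  have s_apply: "s \<sigma>' = (if \<sigma>' = \<sigma> then a else \<one>\<^bsub>F (hd \<sigma>')\<^esub>)" if "\<sigma>' \<in> simplices n (Sk n)" for \<sigma>'
    using that sig by (auto simp: s_def w_def nd_simplices_def)
  have hs: "cell_map n s = factor_incl (I n) (TA n) y
      (pure_tensor (A_group P rk r y n) (F y) (A_gen P rk r y n \<sigma>) a)"
    unfolding cell_map_def factor_incl_def
  proof (rule restrict_ext)
    fix z assume z: "z \<in> I n"
    have rs: "restrict s (Nd z n) \<sigma>' = (if \<sigma>' = \<sigma> then a else \<one>\<^bsub>F z\<^esub>)" if "\<sigma>' \<in> Nd z n" for \<sigma>'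
      using that Nd_iff[OF z] s_apply by auto
    show "Ph z n (restrict s (Nd z n)) =
        (if z = y then pure_tensor (A_group P rk r y n) (F y) (A_gen P rk r y n \<sigma>) a else \<one>\<^bsub>TA n z\<^esub>)"
    proof (cases "z = y")
      case True
      then show ?thesis
        using Ph_single[OF y sig, of "restrict s (Nd y n)"] rs sig a by auto
    next
      case False
      then have "\<sigma> \<notin> Nd z n" using Nd_hd[OF z] hds by blast
      then have "restrict s (Nd z n) = \<one>\<^bsub>product_group (Nd z n) (\<lambda>_. F z)\<^esub>"
        using rs by (auto simp: fun_eq_iff restrict_def)
      moreover have "Ph z n \<one>\<^bsub>product_group (Nd z n) (\<lambda>_. F z)\<^esub> = \<one>\<^bsub>TA n z\<^esub>"
        by (rule hom_one[OF Ph_hom[OF z]])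
          (use comm_group_at[OF I_P[OF z]] TA_comm_group[OF z] in \<open>auto simp: comm_group.axioms\<close>)
      ultimately show ?thesis using False by simp
    qed
  qed
  let ?b = "restrict (lift_codiff n s) (Nd x (Suc n))"
  have Nx: "x # \<sigma> \<in> Nd x (Suc n)"
    using sig xy P by (auto simp: nd_simplices_def up_set_def)
  have b: "?b (x # \<sigma>') = \<rho> (hd \<sigma>') x (s \<sigma>') [^]\<^bsub>F x\<^esub> ((- 1) ^ Suc n :: int)" if "x # \<sigma>' \<in> Nd x (Suc n)" for \<sigma>'
    using lift_codiff_apply[OF s x that] that by simp
  have "\<sigma> \<in> simplices n (Sk n)" using sig Nd_iff[OF y] by blast
  then have b1: "?b (x # \<sigma>) = \<rho> y x a [^]\<^bsub>F x\<^esub> ((- 1) ^ Suc n :: int)"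
    using b[OF Nx] s_apply[of \<sigma>] hds by simp
  have rho: "\<rho> y x a \<in> carrier (F x)"
    using hom_in_carrier[OF map_hom[OF P] a] xy by simp
  have b2: "?b \<upsilon> = \<one>\<^bsub>F x\<^esub>" if u: "\<upsilon> \<in> Nd x (Suc n)" "\<upsilon> \<noteq> x # \<sigma>" for \<upsilon>
  proof -
    obtain \<sigma>' where v: "\<upsilon> = x # \<sigma>'" using Nd_hd[OF x u(1)] u(1) by (cases \<upsilon>) (auto simp: nd_simplices_def)
    have N: "x # \<sigma>' \<in> Nd x (Suc n)" using u v by simp
    then have "\<sigma>' \<noteq> []" and ord: "sorted_wrt (<) (x # \<sigma>')" "set \<sigma>' \<subseteq> P" "length \<sigma>' = Suc n"
      by (auto simp: nd_simplices_def up_set_def)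
    then have hd: "hd \<sigma>' \<in> P" "x \<le> hd \<sigma>'" by (cases \<sigma>'; auto)+
    have "cr v \<le> int n" if "v \<in> set \<sigma>'" for v
      using that ord corank_less[OF P(1), of v] I_corank[OF x] by auto
    then have "\<sigma>' \<in> simplices n (Sk n)"
      using ord by (auto simp: simplices_def skel_def intro: sorted_wrt_mono_rel[of _ "(<)"])
    then have "s \<sigma>' = \<one>\<^bsub>F (hd \<sigma>')\<^esub>" using s_apply u v by auto
    moreover have "\<rho> (hd \<sigma>') x \<one>\<^bsub>F (hd \<sigma>')\<^esub> = \<one>\<^bsub>F x\<^esub>"
      by (rule hom_one[OF map_hom[OF P(1) hd]]) (use comm_group_at[OF hd(1)] Gx.is_group in \<open>auto simp: comm_group.axioms\<close>)
    ultimately show ?thesis using b[OF N] v by simp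
  qed
  have "delta_entry n y x (pure_tensor (A_group P rk r y n) (F y) (A_gen P rk r y n \<sigma>) a) = Ph x (Suc n) ?b"
    by (rule delta_entry_eq[OF x s hs])
  also have "\<dots> = pure_tensor (A_group P rk r x (Suc n)) (F x) (A_gen P rk r x (Suc n) (x # \<sigma>)) (?b (x # \<sigma>))"
  proof (rule Ph_single[OF x Nx])
    show "?b (x # \<sigma>) \<in> carrier (F x)" unfolding b1 using rho by (rule Gx.int_pow_closed)
  qed (rule b2)
  finally show ?thesis unfolding b1 .
qed

end

theorem proposition7:
  fixes P :: "'a::order set" and rk :: "'a \<Rightarrow> int" and r :: int
    and F :: "'a \<Rightarrow> 'b monoid" and \<rho> :: "'a \<Rightarrow> 'a \<Rightarrow> 'b \<Rightarrow> 'b"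
  assumes "locally_finite_poset P"
    and "graded_with_corank P rk r"
    and "presheaf P F \<rho>"
  shows "\<exists>\<phi> :: nat \<Rightarrow> ('a list \<Rightarrow> 'b) set \<Rightarrow> 'a \<Rightarrow> (('a list \<Rightarrow>\<^sub>0 int) set \<times> 'b \<Rightarrow>\<^sub>0 int) set.
    (\<forall>n. \<phi> n \<in> iso (cellular_cochains P rk r F \<rho> n)
       (product_group (corank_set P rk r n) (\<lambda>x. tensor_group (A_group P rk r x n) (F x)))) \<and>
    (\<forall>n x y. x \<in> corank_set P rk r (Suc n) \<and> y \<in> corank_set P rk r n \<and> covers P x y \<longrightarrow>
       (let \<delta>yx = matrix_element (corank_set P rk r n)
              (\<lambda>z. tensor_group (A_group P rk r z n) (F z))
              (cellular_cochains P rk r F \<rho> n) (\<phi> n) (\<phi> (Suc n)) (cellular_diff P rk r F \<rho> n) y x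
        in \<delta>yx \<in> hom (tensor_group (A_group P rk r y n) (F y))
                   (tensor_group (A_group P rk r x (Suc n)) (F x)) \<and>
           (\<forall>\<sigma> \<in> nd_simplices n (up_set P y). \<forall>a \<in> carrier (F y).
              \<delta>yx (pure_tensor (A_group P rk r y n) (F y) (A_gen P rk r y n \<sigma>) a) =
              pure_tensor (A_group P rk r x (Suc n)) (F x) (A_gen P rk r x (Suc n) (x # \<sigma>))
                (\<rho> y x a [^]\<^bsub>F x\<^esub> ((-1) ^ Suc n :: int)))))"
proof -
  interpret presheaf P F \<rho> by fact
  interpret graded_presheaf P F \<rho> rk r by unfold_locales (fact assms)+
  show ?thesis
    unfolding Let_def
    by (intro exI[of _ phi] conjI allI impI ballI phi_iso delta_entry_hom delta_entry_pure_tensor) auto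
qed

end
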